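(* Let $P,Q,R$ be three distinct points on the conic $\mathcal K$, and let $h\in\mathcal H^\circ$ be the map with $h(\mathbb A)=h(\mathbb F)=P$, $h(\mathbb B)=h(\mathbb E)=Q$, $h(\mathbb C)=h(\mathbb D)=R$. Let $X_h=\beta^{-1}(h)$, and for each of the sixty Pascal symbols $s$ consider the restricted morphism $q_s:X_h\to(\mathbb P^2)^*$. Let $P',Q',R'$ and the line $\mathbf{ch}$ be as defined in the context. (1) The map $q_s:X_h\to(\mathbb P^2)^*$ is constant for $44$ values of the symbol $s$. Amongst these, there are $8$ values each for which the image is the line $PQ$, $PR$ or $QR$; there are $4$ values each for which the image is the line $PP'$, $QQ'$ or $RR'$; and there are $8$ values of $s$ for which the image is the line $\mathbf{ch}$. (2) The map $q_s:X_h\to(\mathbb P^2)^*$ is non-constant for $16$ values of $s$. There are $4$ values for which the image is the pencil of lines through $P$, and similarly $4$ each for $Q$ and $R$. For the remaining $4$ values, the image is all of $(\mathbb P^2)^*$.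
   Context: Work over the complex numbers. Let $\mathcal K\subseteq\mathbb P^2$ be a nonsingular conic, let $L=\{\mathbb A,\mathbb B,\mathbb C,\mathbb D,\mathbb E,\mathbb F\}$ be a set of six letters, and let $\mathcal H=\mathcal K^{L}\simeq(\mathbb P^1)^6$ be the variety of all maps $h:L\to\mathcal K$. The type of a partition of $L$ is the list of its block sizes. For a partition $\pi$, the polydiagonal of type $\pi$ is $\Delta_\pi=\{h\in\mathcal H: h(x)=h(y)\text{ whenever }x,y\text{ are in the same block of }\pi\}$. A Pascal symbol is an array $s=\left\{\begin{array}{ccc} x_1&x_2&x_3\\ y_1&y_2&y_3\end{array}\right\}$ with $\{x_1,x_2,x_3,y_1,y_2,y_3\}=L$, considered up to permuting its rows and permuting its columns; there are $60$ symbols. For injective $h$, Pascal's theorem says that the three points $h(x_i)h(y_j)\cap h(x_j)h(y_i)$ ($1\le i<j\le 3$) are collinear, where $PQ$ denotes the line joining $P,Q$; the line containing them is the Pascal line. The assignment of the Pascal line to $h$ defines a rational map $p_s:\mathcal H\dashrightarrow(\mathbb P^2)^*$ to the space of lines in $\mathbb P^2$. Let $\mathcal H^\circ=\mathcal H\setminus\bigcup_\mu\Delta_\mu$, the union being over all partitions $\mu$ of type $(3,2,1)$ or $(4,1,1)$. For $\pi$ of type $(2,2,1,1)$, $(3,1,1,1)$ or $(2,2,2)$, put $\Delta_\pi^\circ=\mathcal H^\circ\cap\Delta_\pi$. Let $Z\subseteq\mathcal H^\circ$ be the union of all $\Delta^\circ_\pi$ with $\pi$ of type $(2,2,2)$,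 and $Y\subseteq\mathcal H^\circ$ the union of all $\Delta^\circ_\pi$ with $\pi$ of type $(2,2,1,1)$ or $(3,1,1,1)$. Let $\beta_1:\mathbb X'\to\mathcal H^\circ$ be the blow-up along $Z$, let $Y'\subseteq\mathbb X'$ be the proper transform of $Y$, let $\beta_2:\mathbb X\to\mathbb X'$ be the blow-up along $Y'$, and let $\beta=\beta_1\circ\beta_2:\mathbb X\to\mathcal H^\circ$. For every Pascal symbol $s$, $q_s:\mathbb X\to(\mathbb P^2)^*$ denotes the (unique, existing) regular morphism extending the rational map $p_s\circ\beta$. The points $P',Q',R'$ are respectively the poles of the lines $QR,PR,PQ$ with respect to $\mathcal K$ (e.g. $P'$ is the intersection of the tangent lines to $\mathcal K$ at $Q$ and $R$). By a theorem of Chasles the triangles $PQR$ and $P'Q'R'$ are in perspective; in particular the points $PQ\cap P'Q'$, $PR\cap P'R'$, $QR\cap Q'R'$ are collinear, and $\mathbf{ch}$ denotes the line containing them. The pencil of lines through a point $T\in\mathbb P^2$ is the set of all lines in $\mathbb P^2$ passing through $T$, a line in $(\mathbb P^2)^*$. *)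

theory Defs
  imports "HOL-Analysis.Analysis" "HOL-Library.Multiset" "HOL-Library.Disjoint_Sets"
begin

section \<open>Projective spaces\<close>

typedef 'n proj = "{L :: (complex ^ 'n) set. vec.subspace L \<and> vec.dim L = 1}"
proof
  show "vec.span {axis undefined 1 :: complex ^ 'n}
      \<in> {L. vec.subspace L \<and> vec.dim L = 1}"
    by (simp add: vec.dim_span vec.dim_singleton axis_eq_0_iff)
qed

definition proj_of :: "complex ^ 'n \<Rightarrow> 'n::finite proj" where
  "proj_of v = Abs_proj (vec.span {v})"

text \<open>Some vector of homogeneous coordinates; everything below is independent of the choice.\<close>

definition homog :: "'n::finite proj \<Rightarrow> complex ^ 'n" where
  "homog p = (SOME v. v \<noteq> 0 \<and> v \<in> Rep_proj p)"

section \<open>Regular functions and Zariski topology\<close>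

text \<open>An ambient space is given by its \<^emph>\<open>coordinate ratios\<close>: pairs of a principal open set and
  a function that matters only there. On projective space these are the \<open>x\<^sub>i / x\<^sub>j\<close> on
  \<open>x\<^sub>j \<noteq> 0\<close>; on a product they are pulled back from the factors.\<close>

class ambient =
  fixes coord_ratios :: "('a set \<times> ('a \<Rightarrow> complex)) set"

instantiation proj :: (finite) ambient
begin
definition "coord_ratios =
  {({p :: 'a proj. homog p $ j \<noteq> 0}, \<lambda>p. homog p $ i / homog p $ j) | i j. True}"
instance ..
end

instantiation "fun" :: (type, ambient) ambient
begin
definition "coord_ratios =
  {({h :: 'a \<Rightarrow> 'b. h x \<in> D}, \<lambda>h. \<phi> (h x)) | x D \<phi>. (D, \<phi>) \<in> coord_ratios}"
instance ..
end

instantiation prod :: (ambient, ambient) ambient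
begin
definition "coord_ratios =
  {({x :: 'a \<times> 'b. fst x \<in> D}, \<lambda>x. \<phi> (fst x)) | D \<phi>. (D, \<phi>) \<in> coord_ratios} \<union>
  {({x :: 'a \<times> 'b. snd x \<in> D}, \<lambda>x. \<phi> (snd x)) | D \<phi>. (D, \<phi>) \<in> coord_ratios}"
instance ..
end

text \<open>Rational expressions in the coordinate ratios, each with an open domain on which it is
  regular. On a product of projective spaces these are, locally, the quotients \<open>F / G\<close> of
  multihomogeneous polynomials of the same multidegree, on \<open>G \<noteq> 0\<close>.\<close>

inductive_set rational_funs :: "('a::ambient set \<times> ('a \<Rightarrow> complex)) set" where
  const: "(UNIV, \<lambda>_. c) \<in> rational_funs"
| coord: "(D, \<phi>) \<in> coord_ratios \<Longrightarrow> (D, \<phi>) \<in> rational_funs"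
| add: "(D, \<phi>) \<in> rational_funs \<Longrightarrow> (E, \<psi>) \<in> rational_funs
    \<Longrightarrow> (D \<inter> E, \<lambda>x. \<phi> x + \<psi> x) \<in> rational_funs"
| mult: "(D, \<phi>) \<in> rational_funs \<Longrightarrow> (E, \<psi>) \<in> rational_funs
    \<Longrightarrow> (D \<inter> E, \<lambda>x. \<phi> x * \<psi> x) \<in> rational_funs"
| inverse: "(D, \<phi>) \<in> rational_funs
    \<Longrightarrow> ({x \<in> D. \<phi> x \<noteq> 0}, \<lambda>x. inverse (\<phi> x)) \<in> rational_funs"

definition zariski :: "'a::ambient topology" where
  "zariski = topology_generated_by (fst ` rational_funs)"

definition zariski_on :: "'a::ambient set \<Rightarrow> 'a topology" where
  "zariski_on X = subtopology zariski X"

text \<open>In the next definitions \<open>X\<close> and \<open>U\<close> are locally closed.\<close>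

definition regular_on :: "'a::ambient set \<Rightarrow> ('a \<Rightarrow> complex) \<Rightarrow> bool" where
  "regular_on U \<phi> \<longleftrightarrow>
    (\<forall>x\<in>U. \<exists>D \<psi>. (D, \<psi>) \<in> rational_funs \<and> x \<in> D \<and> (\<forall>y\<in>U \<inter> D. \<phi> y = \<psi> y))"

definition regular_map :: "'a::ambient set \<Rightarrow> ('a \<Rightarrow> 'n::finite proj) \<Rightarrow> bool" where
  "regular_map X q \<longleftrightarrow>
    (\<forall>x\<in>X. \<exists>U f. openin (zariski_on X) U \<and> x \<in> U \<and> (\<forall>i. regular_on U (f i)) \<and>
      (\<forall>y\<in>U. (\<chi> i. f i y) \<noteq> 0 \<and> q y = proj_of (\<chi> i. f i y)))"

section \<open>Blow-ups\<close>

text \<open>The functions \<open>f i\<close> generate, at every point of \<open>U\<close>, the ideal of germs of regular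
  functions on \<open>U\<close> vanishing on \<open>Z\<close>.\<close>

definition generates_ideal :: "'a::ambient set \<Rightarrow> 'a set \<Rightarrow> ('n::finite \<Rightarrow> 'a \<Rightarrow> complex) \<Rightarrow> bool" where
  "generates_ideal U Z f \<longleftrightarrow>
    (\<forall>i. regular_on U (f i) \<and> (\<forall>y\<in>U \<inter> Z. f i y = 0)) \<and>
    (\<forall>x\<in>U. \<forall>V \<phi>. openin (zariski_on U) V \<and> x \<in> V \<and> regular_on V \<phi> \<and> (\<forall>y\<in>V \<inter> Z. \<phi> y = 0) \<longrightarrow>
      (\<exists>W a. openin (zariski_on U) W \<and> x \<in> W \<and> W \<subseteq> V \<and> (\<forall>i. regular_on W (a i)) \<and>
        (\<forall>y\<in>W. \<phi> y = (\<Sum>i\<in>UNIV. a i y * f i y))))"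

text \<open>\<open>g\<close> is the map from \<open>X - Z\<close> to a projective space whose homogeneous coordinates are, locally
  on \<open>X\<close>, generators of the ideal sheaf of \<open>Z\<close>. Globally they may be sections of a
  twist of that ideal sheaf, so local systems of generators may differ by a common unit.\<close>

definition ideal_generator_map :: "'a::ambient set \<Rightarrow> 'a set \<Rightarrow> ('a \<Rightarrow> 'n::finite proj) \<Rightarrow> bool" where
  "ideal_generator_map X Z g \<longleftrightarrow>
    (\<forall>x\<in>X. \<exists>U f. openin (zariski_on X) U \<and> x \<in> U \<and> generates_ideal U Z f \<and>
      (\<forall>y\<in>U - Z. g y = proj_of (\<chi> i. f i y)))"

text \<open>The blow-up of \<open>X\<close> along the closed set \<open>Z\<close> (with its reduced structure) is the
  closure in \<open>X \<times> \<P>\<^sup>N\<close> of the graph of such a map; different choices of generators give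
  isomorphic blow-ups over \<open>X\<close>. The blow-down morphism is \<^const>\<open>fst\<close>.\<close>

definition blowup :: "'a::ambient set \<Rightarrow> 'a set \<Rightarrow> ('a \<Rightarrow> 'n::finite proj) \<Rightarrow> ('a \<times> 'n proj) set" where
  "blowup X Z g = zariski_on (X \<times> UNIV) closure_of {(x, g x) | x. x \<in> X - Z}"

definition proper_transform :: "('a::ambient \<times> 'n::finite proj) set \<Rightarrow> 'a set \<Rightarrow> 'a set \<Rightarrow> ('a \<times> 'n proj) set" where
  "proper_transform X' Z Y = zariski_on X' closure_of {x \<in> X'. fst x \<in> Y - Z}"

section \<open>Plane geometry\<close>

text \<open>A point of the dual plane is the line with the corresponding coefficients; thus
  \<^typ>\<open>3 proj\<close> serves both as the plane and as its dual.\<close>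

definition on_line :: "3 proj \<Rightarrow> 3 proj \<Rightarrow> bool" where
  "on_line p l \<longleftrightarrow> scalar_product (homog l) (homog p) = 0"

definition join :: "3 proj \<Rightarrow> 3 proj \<Rightarrow> 3 proj" where
  "join p q = (THE l. on_line p l \<and> on_line q l)"

definition meet :: "3 proj \<Rightarrow> 3 proj \<Rightarrow> 3 proj" where
  "meet l m = (THE p. on_line p l \<and> on_line p m)"

definition pencil :: "3 proj \<Rightarrow> 3 proj set" where
  "pencil p = {l. on_line p l}"

definition conic :: "complex ^ 3 ^ 3 \<Rightarrow> 3 proj set" where
  "conic M = {p. scalar_product (homog p) (M *v homog p) = 0}"

text \<open>Jacobian criterion: the gradient \<open>2 M v\<close> of the form does not vanish on the conic.\<close>

definition nonsingular_conic :: "complex ^ 3 ^ 3 \<Rightarrow> bool" where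
  "nonsingular_conic M \<longleftrightarrow> transpose M = M \<and>
    (\<forall>v. v \<noteq> 0 \<and> scalar_product v (M *v v) = 0 \<longrightarrow> M *v v \<noteq> 0)"

definition polar :: "complex ^ 3 ^ 3 \<Rightarrow> 3 proj \<Rightarrow> 3 proj" where
  "polar M p = proj_of (M *v homog p)"

definition pole :: "complex ^ 3 ^ 3 \<Rightarrow> 3 proj \<Rightarrow> 3 proj" where
  "pole M l = (THE p. polar M p = l)"

definition chasles_line :: "complex ^ 3 ^ 3 \<Rightarrow> 3 proj \<Rightarrow> 3 proj \<Rightarrow> 3 proj \<Rightarrow> 3 proj" where
  "chasles_line M P Q R =
    (let P' = pole M (join Q R); Q' = pole M (join P R); R' = pole M (join P Q) in
     THE l. on_line (meet (join P Q) (join P' Q')) l \<and>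
            on_line (meet (join P R) (join P' R')) l \<and>
            on_line (meet (join Q R) (join Q' R')) l)"

section \<open>Hexads on the conic\<close>

datatype letter = LA | LB | LC | LD | LE | LF

definition hexads :: "3 proj set \<Rightarrow> (letter \<Rightarrow> 3 proj) set" where
  "hexads K = {h. range h \<subseteq> K}"

definition polydiagonal :: "3 proj set \<Rightarrow> letter set set \<Rightarrow> (letter \<Rightarrow> 3 proj) set" where
  "polydiagonal K \<pi> = {h \<in> hexads K. \<forall>b\<in>\<pi>. \<forall>x\<in>b. \<forall>y\<in>b. h x = h y}"

definition partition_type :: "letter set set \<Rightarrow> nat multiset" where
  "partition_type \<pi> = image_mset card (mset_set \<pi>)"

definition polydiagonals :: "3 proj set \<Rightarrow> nat multiset set \<Rightarrow> (letter \<Rightarrow> 3 proj) set" where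
  "polydiagonals K T =
    \<Union> {polydiagonal K \<pi> | \<pi>. partition_on UNIV \<pi> \<and> partition_type \<pi> \<in> T}"

definition Hcirc :: "3 proj set \<Rightarrow> (letter \<Rightarrow> 3 proj) set" where
  "Hcirc K = hexads K - polydiagonals K {{#3, 2, 1#}, {#4, 1, 1#}}"

definition Zlocus :: "3 proj set \<Rightarrow> (letter \<Rightarrow> 3 proj) set" where
  "Zlocus K = Hcirc K \<inter> polydiagonals K {{#2, 2, 2#}}"

definition Ylocus :: "3 proj set \<Rightarrow> (letter \<Rightarrow> 3 proj) set" where
  "Ylocus K = Hcirc K \<inter> polydiagonals K {{#2, 2, 1, 1#}, {#3, 1, 1, 1#}}"

section \<open>Pascal symbols\<close>

text \<open>An array is indexed by row and column: \<open>x\<close> is \<open>a 0\<close> and \<open>y\<close> is \<open>a 1\<close>.\<close>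

definition pascal_arrays :: "(2 \<Rightarrow> 3 \<Rightarrow> letter) set" where
  "pascal_arrays = {a. range (case_prod a) = UNIV}"

definition array_equiv :: "((2 \<Rightarrow> 3 \<Rightarrow> letter) \<times> (2 \<Rightarrow> 3 \<Rightarrow> letter)) set" where
  "array_equiv = {(a, b). a \<in> pascal_arrays \<and> b \<in> pascal_arrays \<and>
    (\<exists>\<sigma> \<tau>. bij \<sigma> \<and> bij \<tau> \<and> b = (\<lambda>i j. a (\<sigma> i) (\<tau> j)))}"

definition pascal_symbols :: "(2 \<Rightarrow> 3 \<Rightarrow> letter) set set" where
  "pascal_symbols = pascal_arrays // array_equiv"

text \<open>Meaningful for injective \<open>h\<close> with values on a nonsingular conic; the condition does not
  depend on the representative \<open>a\<close> of \<open>s\<close>.\<close>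

definition pascal_line :: "(2 \<Rightarrow> 3 \<Rightarrow> letter) set \<Rightarrow> (letter \<Rightarrow> 3 proj) \<Rightarrow> 3 proj" where
  "pascal_line s h = (THE l. \<forall>a\<in>s. \<forall>i j. i \<noteq> j \<longrightarrow>
    on_line (meet (join (h (a 0 i)) (h (a 1 j))) (join (h (a 0 j)) (h (a 1 i)))) l)"

text \<open>The morphism extending the rational map \<open>p\<^sub>s \<circ> \<beta>\<close>; two extensions agree on \<open>X\<close>, since the
  points over injective maps are dense there.\<close>

definition extends_pascal ::
  "'a::ambient set \<Rightarrow> ('a \<Rightarrow> letter \<Rightarrow> 3 proj) \<Rightarrow> (2 \<Rightarrow> 3 \<Rightarrow> letter) set \<Rightarrow> ('a \<Rightarrow> 3 proj) \<Rightarrow> bool" where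
  "extends_pascal X \<beta> s q \<longleftrightarrow> regular_map X q \<and>
    (\<forall>x\<in>X. inj (\<beta> x) \<longrightarrow> q x = pascal_line s (\<beta> x))"

end

theory Submission
  imports Defs "HOL-Complex_Analysis.Complex_Singularities"
    "HOL-Combinatorics.Multiset_Permutations"
begin

text \<open>Parametrise the conic by \<open>t \<mapsto> (1, t, t\<^sup>2)\<close> in suitable coordinates, with \<open>P, Q, R\<close> at \<open>0, 1, -1\<close>.
  The Pascal line is then given by three polynomials in the six parameters, and no description of
  the two blow-ups is needed. Upper bounds for the images: an identity between regular functions
  that holds over injective hexads holds on the whole of \<open>X\<close>, as these are dense near the fibre.
  Thus \<open>q\<^sub>s\<close> is constant wherever the polynomials do not vanish simultaneously at \<open>h\<close>; if over \<open>h\<close>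
  one column of \<open>s\<close> consists of two equal points and the other two columns agree, the Pascal line is a
  combination \<open>v A + w B\<close> of two lines whose intersection tends to that point, which puts
  the image into a pencil. Lower bounds: an analytic curve of hexads through \<open>h\<close> lifts to any
  blow-up, since a vector of germs of analytic functions of one variable is a power of the variable
  times a vector with nonzero value. Hence every limit of Pascal lines along such a curve is a value
  of \<open>q\<^sub>s\<close> on the fibre.\<close>

subsection \<open>Germs of functions\<close>

text \<open>Upper and lower bounds both substitute a map into regular functions: the identity near a
  point of the blow-up, or an analytic curve. The locale \<open>germs\<close> isolates the
  properties of a local ring that such substitutions need, so each substitution rule is proved once
  for both settings. Density of injective hexads is obtained from curves rather than from
  irreducibility: each hexad in the chart is the value at \<open>t = 0\<close> of a curve with
  parameters \<open>z + t * \<xi> + t ^ 2 * \<theta>\<close>, where \<theta> separates the letters.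
  The quadratic term also leaves the direction \<xi> free, so it can be chosen to make the
  coefficient of \<open>t\<close> in the Pascal form a prescribed line. One order of vanishing
  suffices in every degenerate case: three doubled columns lead to Lagrange interpolation, one
  doubled column to a combination of two chords. That no other degeneration occurs is a finite
  check. Three points of a conic can be placed at any three parameters, and 0, 1, -1 make all data
  at \<open>h\<close> integral, so the 720 arrays are classified by evaluation; each symbol accounts
  for 12 of them.\<close>

lemma rational_dom_Int:
  assumes "D \<in> fst ` rational_funs" "E \<in> fst ` rational_funs"
  shows "D \<inter> E \<in> fst ` rational_funs"
proof -
  from assms obtain \<phi> \<psi> where "(D, \<phi>) \<in> rational_funs" "(E, \<psi>) \<in> rational_funs"
    by auto
  then have "(D \<inter> E, \<lambda>x. \<phi> x + \<psi> x) \<in> rational_funs"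
    by (rule rational_funs.add)
  then show ?thesis by force
qed

lemma UNIV_rational_dom: "UNIV \<in> fst ` rational_funs"
  using rational_funs.const[of undefined] by force

text \<open>Domains of rational functions are closed under intersection, so they form a base of
  neighbourhoods and not merely a subbase. In filter form, "on a small enough neighbourhood" becomes
  \<open>eventually\<close>.\<close>

definition zariski_nhds :: "'a::ambient set \<Rightarrow> 'a \<Rightarrow> 'a filter" where
  "zariski_nhds X x = (INF D\<in>{D \<in> fst ` rational_funs. x \<in> D}. principal (X \<inter> D))"

lemma eventually_zariski_nhds:
  "eventually P (zariski_nhds X x) \<longleftrightarrow>
    (\<exists>D\<in>fst ` rational_funs. x \<in> D \<and> (\<forall>y\<in>X \<inter> D. P y))"
proof -
  have "eventually P (zariski_nhds X x) \<longleftrightarrow>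
    (\<exists>D\<in>{D \<in> fst ` rational_funs. x \<in> D}. eventually P (principal (X \<inter> D)))"
    unfolding zariski_nhds_def
  proof (rule eventually_INF_base)
    show "{D \<in> fst ` rational_funs. x \<in> D} \<noteq> {}"
      using UNIV_rational_dom by blast
  next
    fix D E assume "D \<in> {D \<in> fst ` rational_funs. x \<in> D}" "E \<in> {D \<in> fst ` rational_funs. x \<in> D}"
    then show "\<exists>G\<in>{D \<in> fst ` rational_funs. x \<in> D}.
        principal (X \<inter> G) \<le> inf (principal (X \<inter> D)) (principal (X \<inter> E))"
      using rational_dom_Int[of D E] by (intro bexI[of _ "D \<inter> E"]) auto
  qed
  then show ?thesis by (simp add: eventually_principal)
qed

lemma eventually_zariski_nhds_self:
  "eventually P (zariski_nhds X x) \<Longrightarrow> x \<in> X \<Longrightarrow> P x"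
  by (auto simp: eventually_zariski_nhds)

lemma eventually_zariski_nhds_in: "eventually (\<lambda>y. y \<in> X) (zariski_nhds X x)"
  using UNIV_rational_dom by (auto simp: eventually_zariski_nhds)

lemma eventually_zariski_nhds_dom:
  "D \<in> fst ` rational_funs \<Longrightarrow> x \<in> D \<Longrightarrow> eventually (\<lambda>y. y \<in> D) (zariski_nhds X x)"
  by (auto simp: eventually_zariski_nhds)

lemma eventually_eventually_zariski_nhds:
  assumes "eventually P (zariski_nhds X x)"
  shows "eventually (\<lambda>y. eventually P (zariski_nhds X y)) (zariski_nhds X x)"
  using assms unfolding eventually_zariski_nhds by blast

lemma topspace_zariski_on [simp]: "topspace (zariski_on X) = X"
proof -
  have "topspace zariski = (UNIV :: 'a set)"
    unfolding zariski_def topology_generated_by_topspace using UNIV_rational_dom by blast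
  then show ?thesis by (simp add: zariski_on_def)
qed

text \<open>Finite intersections and unions both preserve the property that every point has one
  basic domain inside the set, which is all that the filter sees.\<close>

lemma openin_zariski_on_iff:
  "openin (zariski_on X) U \<longleftrightarrow> U \<subseteq> X \<and> (\<forall>x\<in>U. eventually (\<lambda>y. y \<in> U) (zariski_nhds X x))"
proof
  assume "openin (zariski_on X) U"
  then obtain T where T: "openin zariski T" "U = T \<inter> X"
    by (auto simp: zariski_on_def openin_subtopology)
  have "generate_topology_on (fst ` rational_funs) T"
    using T(1) by (simp add: zariski_def openin_topology_generated_by_iff)
  then have "\<forall>x\<in>T. \<exists>D\<in>fst ` rational_funs. x \<in> D \<and> D \<subseteq> T"
  proof induction
    case (Int a b)
    show ?case
    proof
      fix x assume "x \<in> a \<inter> b"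
      then have "\<exists>D\<in>fst ` rational_funs. x \<in> D \<and> D \<subseteq> a" "\<exists>D\<in>fst ` rational_funs. x \<in> D \<and> D \<subseteq> b"
        using Int.IH by simp_all
      then obtain D E where "D \<in> fst ` rational_funs" "x \<in> D" "D \<subseteq> a"
        "E \<in> fst ` rational_funs" "x \<in> E" "E \<subseteq> b" by blast
      then show "\<exists>D\<in>fst ` rational_funs. x \<in> D \<and> D \<subseteq> a \<inter> b"
        by (intro bexI[of _ "D \<inter> E"] rational_dom_Int) auto
    qed
  next
    case (UN K)
    then show ?case by (meson Sup_upper UnionE order_trans)
  next
    case (Basis s)
    then show ?case by auto
  qed simp
  then have *: "\<exists>D\<in>fst ` rational_funs. x \<in> D \<and> D \<subseteq> T" if "x \<in> T" for x
    using that by (rule bspec)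
  have "eventually (\<lambda>y. y \<in> U) (zariski_nhds X x)" if "x \<in> U" for x
  proof -
    have "x \<in> T" using that T(2) by simp
    from *[OF this] obtain D where "D \<in> fst ` rational_funs" "x \<in> D" "D \<subseteq> T" by (elim bexE conjE)
    then show ?thesis
      unfolding eventually_zariski_nhds T(2) by (intro bexI[of _ D]) auto
  qed
  then show "U \<subseteq> X \<and> (\<forall>x\<in>U. eventually (\<lambda>y. y \<in> U) (zariski_nhds X x))"
    using T(2) by simp
next
  assume U: "U \<subseteq> X \<and> (\<forall>x\<in>U. eventually (\<lambda>y. y \<in> U) (zariski_nhds X x))"
  let ?\<D> = "{D \<in> fst ` rational_funs. X \<inter> D \<subseteq> U}"
  have "openin zariski (\<Union>?\<D>)"
    unfolding zariski_def openin_topology_generated_by_iff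
    by (rule generate_topology_on.UN) (blast intro: generate_topology_on.Basis)
  moreover have "U = \<Union>?\<D> \<inter> X"
    using U unfolding eventually_zariski_nhds by blast
  ultimately show "openin (zariski_on X) U"
    unfolding zariski_on_def openin_subtopology by blast
qed

lemma openin_zariski_on_nhds:
  "openin (zariski_on X) U \<Longrightarrow> x \<in> U \<Longrightarrow> eventually (\<lambda>y. y \<in> U) (zariski_nhds X x)"
  by (simp add: openin_zariski_on_iff)

lemma zariski_nhds_open:
  assumes "openin (zariski_on X) U" "x \<in> U"
  shows "zariski_nhds U x = zariski_nhds X x"
proof -
  from assms obtain E where E: "E \<in> fst ` rational_funs" "x \<in> E" "X \<inter> E \<subseteq> U" and "U \<subseteq> X"
    unfolding openin_zariski_on_iff eventually_zariski_nhds by blast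
  have "eventually P (zariski_nhds U x) \<longleftrightarrow> eventually P (zariski_nhds X x)" for P
  proof
    assume "eventually P (zariski_nhds U x)"
    then obtain D where "D \<in> fst ` rational_funs" "x \<in> D" "\<forall>y\<in>U \<inter> D. P y"
      unfolding eventually_zariski_nhds by blast
    then show "eventually P (zariski_nhds X x)"
      unfolding eventually_zariski_nhds using E
      by (intro bexI[of _ "D \<inter> E"] rational_dom_Int) auto
  next
    assume "eventually P (zariski_nhds X x)"
    then show "eventually P (zariski_nhds U x)"
      unfolding eventually_zariski_nhds using \<open>U \<subseteq> X\<close> by blast
  qed
  then show ?thesis by (simp add: filter_eq_iff)
qed

lemma in_closure_of_zariski_on:
  assumes "S \<subseteq> X"
  shows "x \<in> zariski_on X closure_of S \<longleftrightarrow> x \<in> X \<and> (\<exists>\<^sub>F y in zariski_nhds X x. y \<in> S)"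
proof
  assume x: "x \<in> zariski_on X closure_of S"
  have "\<not> eventually (\<lambda>y. y \<notin> S) (zariski_nhds X x)"
  proof
    assume "eventually (\<lambda>y. y \<notin> S) (zariski_nhds X x)"
    then obtain D where D: "D \<in> fst ` rational_funs" "x \<in> D" "\<forall>y\<in>X \<inter> D. y \<notin> S"
      unfolding eventually_zariski_nhds by blast
    have "openin (zariski_on X) (X \<inter> D)"
      unfolding openin_zariski_on_iff eventually_zariski_nhds using D by blast
    then show False using x D unfolding in_closure_of by auto
  qed
  then show "x \<in> X \<and> (\<exists>\<^sub>F y in zariski_nhds X x. y \<in> S)"
    using x by (auto simp: frequently_def in_closure_of)
next
  assume x: "x \<in> X \<and> (\<exists>\<^sub>F y in zariski_nhds X x. y \<in> S)"
  show "x \<in> zariski_on X closure_of S"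
    unfolding in_closure_of
  proof (intro conjI allI impI)
    fix T assume "x \<in> T \<and> openin (zariski_on X) T"
    then have "eventually (\<lambda>y. y \<in> T) (zariski_nhds X x)"
      by (auto intro: openin_zariski_on_nhds)
    with x have "\<exists>\<^sub>F y in zariski_nhds X x. y \<in> T \<and> y \<in> S"
      by (intro frequently_eventually_conj) auto
    then show "\<exists>y. y \<in> S \<and> y \<in> T" by (auto dest: frequently_ex)
  qed (use x in simp)
qed

text \<open>The rules of a local ring of germs at \<open>x0\<close>: a germ with nonzero value is a
  unit and stays nonzero nearby. Because of \<open>at_center\<close> the filter has to include the
  centre itself, so \<open>nhds 0\<close> qualifies and \<open>at 0\<close> does not.\<close>

locale germs =
  fixes F :: "'b filter" and A :: "('b \<Rightarrow> complex) set" and x0 :: 'b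
  assumes const: "(\<lambda>_. c) \<in> A"
    and add: "\<phi> \<in> A \<Longrightarrow> \<psi> \<in> A \<Longrightarrow> (\<lambda>x. \<phi> x + \<psi> x) \<in> A"
    and mult: "\<phi> \<in> A \<Longrightarrow> \<psi> \<in> A \<Longrightarrow> (\<lambda>x. \<phi> x * \<psi> x) \<in> A"
    and inverse: "\<phi> \<in> A \<Longrightarrow> \<phi> x0 \<noteq> 0 \<Longrightarrow> (\<lambda>x. inverse (\<phi> x)) \<in> A"
    and nonzero: "\<phi> \<in> A \<Longrightarrow> \<phi> x0 \<noteq> 0 \<Longrightarrow> eventually (\<lambda>x. \<phi> x \<noteq> 0) F"
    and cong: "\<phi> \<in> A \<Longrightarrow> eventually (\<lambda>x. \<psi> x = \<phi> x) F \<Longrightarrow> \<psi> \<in> A"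
    and at_center: "eventually P F \<Longrightarrow> P x0"
begin

lemma uminus: "\<phi> \<in> A \<Longrightarrow> (\<lambda>x. - \<phi> x) \<in> A"
  using mult[OF const[of "-1"]] by force

lemma diff: "\<phi> \<in> A \<Longrightarrow> \<psi> \<in> A \<Longrightarrow> (\<lambda>x. \<phi> x - \<psi> x) \<in> A"
  using add[OF _ uminus] by force

lemma divide: "\<phi> \<in> A \<Longrightarrow> \<psi> \<in> A \<Longrightarrow> \<psi> x0 \<noteq> 0 \<Longrightarrow> (\<lambda>x. \<phi> x / \<psi> x) \<in> A"
  using mult[OF _ inverse] by (simp add: divide_inverse)

lemma sum: "(\<And>i. i \<in> I \<Longrightarrow> \<phi> i \<in> A) \<Longrightarrow> (\<lambda>x. \<Sum>i\<in>I. \<phi> i x) \<in> A"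
  by (induction I rule: infinite_finite_induct) (auto intro: const add)

lemmas intros = const add mult uminus diff sum

text \<open>Substitution is demanded for coordinate ratios only; induction over
  \<open>rational_funs\<close> extends it to rational expressions, and \<open>cong\<close> to
  regular functions.\<close>

definition germ_map :: "('b \<Rightarrow> 'a::ambient) \<Rightarrow> bool" where
  "germ_map \<gamma> \<longleftrightarrow> (\<forall>(D, \<phi>)\<in>coord_ratios. \<gamma> x0 \<in> D \<longrightarrow>
    eventually (\<lambda>x. \<gamma> x \<in> D) F \<and> (\<lambda>x. \<phi> (\<gamma> x)) \<in> A)"

lemma germ_map_rational:
  assumes "germ_map \<gamma>" "(D, \<phi>) \<in> rational_funs" "\<gamma> x0 \<in> D"
  shows "eventually (\<lambda>x. \<gamma> x \<in> D) F \<and> (\<lambda>x. \<phi> (\<gamma> x)) \<in> A"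
  using assms(2,3)
proof (induction D \<phi>)
  case (inverse D \<phi>)
  then have "eventually (\<lambda>x. \<gamma> x \<in> D) F" "eventually (\<lambda>x. \<phi> (\<gamma> x) \<noteq> 0) F"
    using nonzero[of "\<lambda>x. \<phi> (\<gamma> x)"] by auto
  then show ?case using inverse germs.inverse[OF germs_axioms] by (auto elim: eventually_elim2)
next
  case (coord D \<phi>)
  then show ?case using assms(1) by (auto simp: germ_map_def)
qed (auto intro: const add mult eventually_conj)

lemma germ_map_nhds:
  assumes "germ_map \<gamma>" "eventually P (zariski_nhds X (\<gamma> x0))" "eventually (\<lambda>x. \<gamma> x \<in> X) F"
  shows "eventually (\<lambda>x. P (\<gamma> x)) F"
proof -
  obtain D \<phi> where D: "(D, \<phi>) \<in> rational_funs" "\<gamma> x0 \<in> D" "\<forall>y\<in>X \<inter> D. P y"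
    using assms(2) by (auto simp: eventually_zariski_nhds)
  have "eventually (\<lambda>x. \<gamma> x \<in> D) F"
    using germ_map_rational[OF assms(1) D(1,2)] by blast
  with assms(3) show ?thesis by eventually_elim (use D(3) in blast)
qed

lemma germ_map_Pair: "germ_map \<gamma> \<Longrightarrow> germ_map \<delta> \<Longrightarrow> germ_map (\<lambda>x. (\<gamma> x, \<delta> x))"
  unfolding germ_map_def coord_ratios_prod_def by auto

lemma germ_map_fun: "(\<And>i. germ_map (\<lambda>x. \<gamma> x i)) \<Longrightarrow> germ_map \<gamma>"
  unfolding germ_map_def coord_ratios_fun_def by fastforce

lemma germ_map_fun_apply:
  assumes "germ_map \<gamma>"
  shows "germ_map (\<lambda>x. \<gamma> x i)"
  unfolding germ_map_def
proof (intro ballI, clarify)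
  fix D :: "'c set" and \<phi>
  assume "(D, \<phi>) \<in> coord_ratios" "\<gamma> x0 i \<in> D"
  then have "({h. h i \<in> D}, \<lambda>h. \<phi> (h i)) \<in> coord_ratios" "\<gamma> x0 \<in> {h. h i \<in> D}"
    by (auto simp: coord_ratios_fun_def)
  from germ_map_rational[OF assms rational_funs.coord[OF this(1)] this(2)]
  show "eventually (\<lambda>x. \<gamma> x i \<in> D) F \<and> (\<lambda>x. \<phi> (\<gamma> x i)) \<in> A" by simp
qed

lemma germ_map_fst:
  assumes "germ_map \<gamma>"
  shows "germ_map (\<lambda>x. fst (\<gamma> x))"
  unfolding germ_map_def
proof (intro ballI, clarify)
  fix D and \<phi>
  assume "(D, \<phi>) \<in> coord_ratios" "fst (\<gamma> x0) \<in> D"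
  then have "({x. fst x \<in> D}, \<lambda>x. \<phi> (fst x)) \<in> coord_ratios" "\<gamma> x0 \<in> {x. fst x \<in> D}"
    by (auto simp: coord_ratios_prod_def)
  from germ_map_rational[OF assms rational_funs.coord[OF this(1)] this(2)]
  show "eventually (\<lambda>x. fst (\<gamma> x) \<in> D) F \<and> (\<lambda>x. \<phi> (fst (\<gamma> x))) \<in> A" by simp
qed

end

definition regular_at :: "'a::ambient set \<Rightarrow> 'a \<Rightarrow> ('a \<Rightarrow> complex) set" where
  "regular_at X x = {\<phi>. \<exists>(D, \<psi>)\<in>rational_funs. x \<in> D \<and>
    eventually (\<lambda>y. \<phi> y = \<psi> y) (zariski_nhds X x)}"

text \<open>The delicate rule is \<open>nonzero\<close>: the locus where a rational expression is
  invertible is itself a basic domain, namely that of its inverse.\<close>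

lemma germs_zariski:
  assumes "x \<in> X"
  shows "germs (zariski_nhds X x) (regular_at X x) x"
proof -
  have *: "\<exists>D \<psi>. (D, \<psi>) \<in> rational_funs \<and> x \<in> D \<and> eventually (\<lambda>y. \<phi> y = \<psi> y) (zariski_nhds X x) \<and> \<phi> x = \<psi> x
    \<and> eventually (\<lambda>y. y \<in> D) (zariski_nhds X x)"
    if "\<phi> \<in> regular_at X x" for \<phi>
  proof -
    from that obtain D \<psi> where D: "(D, \<psi>) \<in> rational_funs" "x \<in> D" 
      "eventually (\<lambda>y. \<phi> y = \<psi> y) (zariski_nhds X x)"
      by (auto simp: regular_at_def)
    moreover have "D \<in> fst ` rational_funs" using D(1) by force
    ultimately show ?thesis
      using eventually_zariski_nhds_self[OF D(3) assms] eventually_zariski_nhds_dom[of D x X] by blast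
  qed
  have I: "\<phi> \<in> regular_at X x" if "(D, \<psi>) \<in> rational_funs" "x \<in> D" 
     "eventually (\<lambda>y. \<phi> y = \<psi> y) (zariski_nhds X x)" for \<phi> D \<psi>
    using that unfolding regular_at_def by blast
  show ?thesis
  proof
    show "(\<lambda>_. c) \<in> regular_at X x" for c
      by (rule I[OF rational_funs.const[of c]]) auto
    show "(\<lambda>y. \<phi> y + \<psi> y) \<in> regular_at X x" if "\<phi> \<in> regular_at X x" "\<psi> \<in> regular_at X x" for \<phi> \<psi>
    proof -
      from *[OF that(1)] obtain D \<phi>' where D: "(D, \<phi>') \<in> rational_funs" "x \<in> D"
        "eventually (\<lambda>y. \<phi> y = \<phi>' y) (zariski_nhds X x)" by blast
      from *[OF that(2)] obtain E \<psi>' where E: "(E, \<psi>') \<in> rational_funs" "x \<in> E"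
        "eventually (\<lambda>y. \<psi> y = \<psi>' y) (zariski_nhds X x)" by blast
      show ?thesis
      proof (rule I[OF rational_funs.add[OF D(1) E(1)]])
        show "eventually (\<lambda>y. \<phi> y + \<psi> y = \<phi>' y + \<psi>' y) (zariski_nhds X x)"
          using D(3) E(3) by eventually_elim simp
      qed (use D E in simp)
    qed
    show "(\<lambda>y. \<phi> y * \<psi> y) \<in> regular_at X x" if "\<phi> \<in> regular_at X x" "\<psi> \<in> regular_at X x" for \<phi> \<psi>
    proof -
      from *[OF that(1)] obtain D \<phi>' where D: "(D, \<phi>') \<in> rational_funs" "x \<in> D"
        "eventually (\<lambda>y. \<phi> y = \<phi>' y) (zariski_nhds X x)" by blast
      from *[OF that(2)] obtain E \<psi>' where E: "(E, \<psi>') \<in> rational_funs" "x \<in> E"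
        "eventually (\<lambda>y. \<psi> y = \<psi>' y) (zariski_nhds X x)" by blast
      show ?thesis
      proof (rule I[OF rational_funs.mult[OF D(1) E(1)]])
        show "eventually (\<lambda>y. \<phi> y * \<psi> y = \<phi>' y * \<psi>' y) (zariski_nhds X x)"
          using D(3) E(3) by eventually_elim simp
      qed (use D E in simp)
    qed
    show "(\<lambda>y. inverse (\<phi> y)) \<in> regular_at X x" if "\<phi> \<in> regular_at X x" "\<phi> x \<noteq> 0" for \<phi>
    proof -
      from *[OF that(1)] obtain D \<psi> where D: "(D, \<psi>) \<in> rational_funs" "x \<in> D" "\<phi> x = \<psi> x"
        "eventually (\<lambda>y. \<phi> y = \<psi> y) (zariski_nhds X x)" by blast
      show ?thesis
      proof (rule I[OF rational_funs.inverse[OF D(1)]])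
        show "eventually (\<lambda>y. inverse (\<phi> y) = inverse (\<psi> y)) (zariski_nhds X x)"
          using D(4) by eventually_elim simp
      qed (use D that(2) in simp)
    qed
    show "eventually (\<lambda>y. \<phi> y \<noteq> 0) (zariski_nhds X x)" if \<phi>: "\<phi> \<in> regular_at X x" "\<phi> x \<noteq> 0" for \<phi>
    proof -
      from *[OF \<phi>(1)] obtain D \<psi> where D: "(D, \<psi>) \<in> rational_funs" "x \<in> D" "\<phi> x = \<psi> x"
        and ev: "eventually (\<lambda>y. \<phi> y = \<psi> y) (zariski_nhds X x)" by blast
      have "{x \<in> D. \<psi> x \<noteq> 0} \<in> fst ` rational_funs"
        using rational_funs.inverse[OF D(1)] by force
      then have "eventually (\<lambda>y. y \<in> {x \<in> D. \<psi> x \<noteq> 0}) (zariski_nhds X x)"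
        by (rule eventually_zariski_nhds_dom) (use D \<phi>(2) in auto)
      with ev show ?thesis by eventually_elim auto
    qed
    show "\<psi> \<in> regular_at X x" 
      if "\<phi> \<in> regular_at X x" "eventually (\<lambda>y. \<psi> y = \<phi> y) (zariski_nhds X x)" for \<phi> \<psi>
    proof -
      from *[OF that(1)] obtain D \<phi>' where D: "(D, \<phi>') \<in> rational_funs" "x \<in> D"
        "eventually (\<lambda>y. \<phi> y = \<phi>' y) (zariski_nhds X x)" by blast
      show ?thesis
        by (rule I[OF D(1,2)]) (use D(3) that(2) in eventually_elim, simp)
    qed
  qed (use eventually_zariski_nhds_self assms in blast)
qed

lemma regular_on_imp_regular_at:
  assumes "regular_on U \<phi>" "openin (zariski_on X) U" "x \<in> U"
  shows "\<phi> \<in> regular_at X x"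
proof -
  from assms(1,3) obtain D \<psi> where D: "(D, \<psi>) \<in> rational_funs" "x \<in> D" "\<forall>y\<in>U \<inter> D. \<phi> y = \<psi> y"
    unfolding regular_on_def by blast
  have "D \<in> fst ` rational_funs" using D(1) by force
  then have "eventually (\<lambda>y. \<phi> y = \<psi> y) (zariski_nhds X x)"
    using D unfolding zariski_nhds_open[OF assms(2,3), symmetric] eventually_zariski_nhds by blast
  then show ?thesis using D by (auto simp: regular_at_def)
qed

lemma (in germs) germ_map_regular:
  assumes "germ_map \<gamma>" "\<phi> \<in> regular_at X (\<gamma> x0)" "eventually (\<lambda>x. \<gamma> x \<in> X) F"
  shows "(\<lambda>x. \<phi> (\<gamma> x)) \<in> A"
proof -
  obtain D \<psi> where D: "(D, \<psi>) \<in> rational_funs" "\<gamma> x0 \<in> D"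
    "eventually (\<lambda>y. \<phi> y = \<psi> y) (zariski_nhds X (\<gamma> x0))"
    using assms(2) by (auto simp: regular_at_def)
  have "(\<lambda>x. \<psi> (\<gamma> x)) \<in> A" using germ_map_rational[OF assms(1) D(1,2)] by blast
  moreover have "eventually (\<lambda>x. \<phi> (\<gamma> x) = \<psi> (\<gamma> x)) F"
    using germ_map_nhds[OF assms(1) D(3) assms(3)] .
  ultimately show ?thesis by (rule cong)
qed

lemma germ_map_id_zariski:
  assumes "x \<in> X"
  shows "germs.germ_map (zariski_nhds X x) (regular_at X x) x (\<lambda>y. y)"
proof -
  interpret germs "zariski_nhds X x" "regular_at X x" x by (rule germs_zariski[OF assms])
  have "eventually (\<lambda>y. y \<in> D) (zariski_nhds X x)" "\<phi> \<in> regular_at X x" 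
    if "(D, \<phi>) \<in> coord_ratios" "x \<in> D" for D \<phi>
  proof -
    have D: "(D, \<phi>) \<in> rational_funs" using that by (intro rational_funs.coord)
    then have "D \<in> fst ` rational_funs" by force
    then show "eventually (\<lambda>y. y \<in> D) (zariski_nhds X x)"
      using that eventually_zariski_nhds_dom by blast
    show "\<phi> \<in> regular_at X x" using D that by (auto simp: regular_at_def intro!: bexI[of _ "(D,\<phi>)"])
  qed
  then show ?thesis by (auto simp: germ_map_def)
qed

lemma germs_analytic: "germs (nhds (0::complex)) {f. f analytic_on {0}} 0"
proof
  fix \<phi> :: "complex \<Rightarrow> complex"
  assume \<phi>: "\<phi> \<in> {f. f analytic_on {0}}" "\<phi> 0 \<noteq> 0"
  then have "isCont \<phi> 0" using analytic_at_imp_isCont by blast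
  then show "eventually (\<lambda>x. \<phi> x \<noteq> 0) (nhds 0)"
    using \<phi>(2) by (simp add: isCont_def tendsto_imp_eventually_ne eventually_nhds_conv_at)
next
  fix \<phi> \<psi> :: "complex \<Rightarrow> complex"
  assume \<phi>: "\<phi> \<in> {f. f analytic_on {0}}" and eq: "eventually (\<lambda>x. \<psi> x = \<phi> x) (nhds 0)"
  obtain d where d: "d > 0" "\<phi> holomorphic_on ball 0 d" using \<phi> by (auto simp: analytic_on_def)
  obtain e where e: "e > 0" "\<forall>x\<in>ball 0 e. \<psi> x = \<phi> x"
    using eq by (auto simp: eventually_nhds_metric dist_commute)
  have "\<phi> holomorphic_on ball 0 (min d e)" by (rule holomorphic_on_subset[OF d(2)]) auto
  then have "\<psi> holomorphic_on ball 0 (min d e)"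
    by (rule holomorphic_transform) (use e(2) in auto)
  then show "\<psi> \<in> {f. f analytic_on {0}}"
    using d(1) e(1) by (auto simp: analytic_on_def intro!: exI[of _ "min d e"])
next
  show "P 0" if "eventually P (nhds (0::complex))" for P
    using that by (rule eventually_nhds_x_imp_x)
qed (auto simp: analytic_on_add analytic_on_mult analytic_on_const intro!: analytic_on_inverse)

subsection \<open>Homogeneous coordinates\<close>

lemma Rep_proj_proj_of: "v \<noteq> 0 \<Longrightarrow> Rep_proj (proj_of v) = vec.span {v}"
  unfolding proj_of_def by (rule Abs_proj_inverse) (simp add: vec.dim_span vec.dim_singleton)

lemma span_singleton_scale:
  fixes v :: "complex ^ 'n"
  assumes "w \<in> vec.span {v}" "w \<noteq> 0"
  shows "vec.span {w} = vec.span {v}"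
proof -
  from assms obtain c where c: "w = c *s v" by (auto simp: vec.span_singleton)
  with assms(2) have "c \<noteq> 0" by auto
  then have *: "k *s v = (k / c) *s w" for k by (simp add: c vector_smult_assoc)
  show ?thesis
  proof
    show "vec.span {w} \<subseteq> vec.span {v}"
      by (auto simp: vec.span_singleton c vector_smult_assoc)
    show "vec.span {v} \<subseteq> vec.span {w}"
      unfolding vec.span_singleton using * by blast
  qed
qed

lemma homog_props: "homog p \<noteq> 0" "homog p \<in> Rep_proj p" "proj_of (homog p) = p"
proof -
  have L: "vec.subspace (Rep_proj p)" "vec.dim (Rep_proj p) = 1"
    using Rep_proj[of p] by auto
  obtain B where B: "B \<subseteq> Rep_proj p" "vec.independent B" "Rep_proj p \<subseteq> vec.span B" "card B = 1"
    using vec.basis_exists[of "Rep_proj p"] L(2) by metis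
  then obtain v where v: "B = {v}" by (auto simp: card_1_singleton_iff)
  have "v \<noteq> 0" using B(2) v vec.dependent_zero by blast
  have span: "Rep_proj p = vec.span {v}"
    using B v L(1) vec.span_minimal by blast
  have "\<exists>v. v \<noteq> 0 \<and> v \<in> Rep_proj p" using \<open>v \<noteq> 0\<close> B v by blast
  then have h: "homog p \<noteq> 0 \<and> homog p \<in> Rep_proj p"
    unfolding homog_def by (rule someI_ex)
  then show "homog p \<noteq> 0" "homog p \<in> Rep_proj p" by auto
  have "vec.span {homog p} = Rep_proj p"
    using h span span_singleton_scale[of "homog p" v] by simp
  then show "proj_of (homog p) = p" by (simp add: proj_of_def Rep_proj_inverse)
qed

lemma homog_proj_of:
  assumes "v \<noteq> 0"
  obtains c where "c \<noteq> 0" "homog (proj_of v) = c *s v"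
proof -
  have "homog (proj_of v) \<in> vec.span {v}"
    using homog_props(2)[of "proj_of v"] Rep_proj_proj_of[OF assms] by simp
  then obtain c where c: "homog (proj_of v) = c *s v" by (auto simp: vec.span_singleton)
  with homog_props(1)[of "proj_of v"] have "c \<noteq> 0" by auto
  with c that show ?thesis by blast
qed

lemma proj_of_scale: "c \<noteq> 0 \<Longrightarrow> proj_of (c *s v) = proj_of v"
proof (cases "v = 0")
  case False
  assume "c \<noteq> 0"
  then have "vec.span {c *s v} = vec.span {v}"
    using False by (intro span_singleton_scale) (auto simp: vec.span_singleton)
  then show ?thesis by (simp add: proj_of_def)
qed simp

lemma proj_of_eq_iff:
  assumes "u \<noteq> 0" "v \<noteq> 0"
  shows "proj_of u = proj_of v \<longleftrightarrow> (\<exists>c. u = c *s v)"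
proof
  assume "proj_of u = proj_of v"
  then have "vec.span {u} = vec.span {v}" using Rep_proj_proj_of assms by metis
  then have "u \<in> vec.span {v}" using vec.span_base[of u "{u}"] by auto
  then show "\<exists>c. u = c *s v" by (auto simp: vec.span_singleton)
next
  assume "\<exists>c. u = c *s v"
  then obtain c where "u = c *s v" ..
  with assms show "proj_of u = proj_of v" by (cases "c = 0") (auto simp: proj_of_scale)
qed

context germs
begin

text \<open>\<open>homog\<close> picks representatives without any regularity; the unknown scalar
  cancels in each coordinate ratio.\<close>

lemma germ_map_proj:
  fixes f :: "'n::finite \<Rightarrow> 'b \<Rightarrow> complex"
  assumes f: "\<And>i. f i \<in> A" and nz: "\<exists>i. f i x0 \<noteq> 0"
    and eq: "eventually (\<lambda>x. \<gamma> x = proj_of (\<chi> i. f i x)) F"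
  shows "germ_map \<gamma>"
  unfolding germ_map_def coord_ratios_proj_def
proof (clarify, rule conjI)
  fix i j
  have ratio: "(homog p $ j \<noteq> 0 \<longleftrightarrow> f j x \<noteq> 0) \<and> homog p $ i / homog p $ j = f i x / f j x"
    if nz: "\<exists>i. f i x \<noteq> 0" and p: "p = proj_of (\<chi> i. f i x)" for p x
  proof -
    from nz have "(\<chi> i. f i x) \<noteq> 0" by (auto simp: vec_eq_iff)
    then obtain c where c: "c \<noteq> 0" "homog p = c *s (\<chi> i. f i x)"
      using homog_proj_of p by metis
    show ?thesis using c by simp
  qed
  assume "homog (\<gamma> x0) $ j \<noteq> 0"
  then have j: "f j x0 \<noteq> 0" using ratio[OF nz at_center[OF eq]] by simp
  then have ev: "eventually (\<lambda>x. f j x \<noteq> 0) F" by (rule nonzero[OF f])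
  show "eventually (\<lambda>x. \<gamma> x \<in> {p. homog p $ j \<noteq> 0}) F"
    using eq ev by eventually_elim (use ratio in blast)
  have "(\<lambda>x. f i x / f j x) \<in> A" by (intro divide f j)
  then show "(\<lambda>x. homog (\<gamma> x) $ i / homog (\<gamma> x) $ j) \<in> A"
  proof (rule cong)
    show "eventually (\<lambda>x. homog (\<gamma> x) $ i / homog (\<gamma> x) $ j = f i x / f j x) F"
      using eq ev by eventually_elim (use ratio in blast)
  qed
qed

text \<open>A single linear form in \<open>homog\<close> depends on the choice of representative at
  each point. A quotient of two forms does not, and becomes a germ after dividing both by a
  coordinate that is nonzero at the centre.\<close>

lemma homog_ratio:
  fixes \<gamma> :: "'b \<Rightarrow> 'n::finite proj"
  assumes "germ_map \<gamma>" "scalar_product v (homog (\<gamma> x0)) \<noteq> 0"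
  shows "eventually (\<lambda>x. scalar_product v (homog (\<gamma> x)) \<noteq> 0) F"
    and "(\<lambda>x. scalar_product u (homog (\<gamma> x)) / scalar_product v (homog (\<gamma> x))) \<in> A"
proof -
  obtain j where j: "homog (\<gamma> x0) $ j \<noteq> 0"
    using homog_props(1)[of "\<gamma> x0"] by (auto simp: vec_eq_iff)
  have co: "({p. homog p $ j \<noteq> 0}, \<lambda>p. homog p $ i / homog p $ j) \<in> coord_ratios" for i :: 'n
    by (auto simp: coord_ratios_proj_def)
  have r: "(\<lambda>x. homog (\<gamma> x) $ i / homog (\<gamma> x) $ j) \<in> A" for i
    using germ_map_rational[OF assms(1) rational_funs.coord[OF co]] j by auto
  have ev: "eventually (\<lambda>x. homog (\<gamma> x) $ j \<noteq> 0) F"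
    using germ_map_rational[OF assms(1) rational_funs.coord[OF co]] j by auto
  define S where "S = (\<lambda>w x. \<Sum>i\<in>UNIV. w $ i * (homog (\<gamma> x) $ i / homog (\<gamma> x) $ j))"
  have S: "S w x = scalar_product w (homog (\<gamma> x)) / homog (\<gamma> x) $ j" for w x
    by (simp add: S_def scalar_product_def sum_divide_distrib)
  have SA: "S w \<in> A" for w unfolding S_def by (intro sum mult const r)
  have "S v x0 \<noteq> 0" using assms(2) j by (simp add: S)
  from nonzero[OF SA this] show "eventually (\<lambda>x. scalar_product v (homog (\<gamma> x)) \<noteq> 0) F"
    by eventually_elim (simp add: S)
  have "(\<lambda>x. S u x / S v x) \<in> A" by (intro divide SA) fact
  then show "(\<lambda>x. scalar_product u (homog (\<gamma> x)) / scalar_product v (homog (\<gamma> x))) \<in> A"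
    by (rule cong) (use ev in eventually_elim, simp add: S)
qed

end

subsection \<open>Lifting analytic curves to blow-ups\<close>

lemma analytic_factor_power:
  fixes f :: "complex \<Rightarrow> complex"
  assumes "f analytic_on {0}" "\<exists>\<^sub>F t in at 0. f t \<noteq> 0"
  obtains k e where "e analytic_on {0}" "e 0 \<noteq> 0" "eventually (\<lambda>t. f t = t ^ k * e t) (nhds 0)"
proof -
  obtain r where r: "r > 0" "f holomorphic_on ball 0 r"
    using assms(1) by (auto simp: analytic_on_def)
  have "eventually (\<lambda>t. t \<in> ball (0::complex) r) (at 0)"
    using r(1) by (intro eventually_at_in_open') auto
  with assms(2) have "\<exists>\<^sub>F t in at 0. t \<in> ball 0 r \<and> f t \<noteq> 0"
    by (intro frequently_eventually_conj) auto
  then have nz: "\<exists>w\<in>ball 0 r. f w \<noteq> 0" using frequently_ex by blast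
  obtain s where s: "s > 0" "zor_poly f 0 holomorphic_on cball 0 s"
    "\<forall>w\<in>cball 0 s. f w = zor_poly f 0 w * (w - 0) ^ nat (zorder f 0) \<and> zor_poly f 0 w \<noteq> 0"
    using zorder_exist_zero[of f "ball 0 r" 0] r nz by (auto simp del: mem_cball)
  have "eventually (\<lambda>t. t \<in> ball (0::complex) s) (nhds 0)"
    using s(1) by (intro eventually_nhds_in_open) auto
  then have "eventually (\<lambda>t. f t = t ^ nat (zorder f 0) * zor_poly f 0 t) (nhds 0)"
    by eventually_elim (use s(3) in auto)
  moreover have "zor_poly f 0 analytic_on {0}"
    unfolding analytic_on_def using s(1,2) holomorphic_on_subset[OF s(2) ball_subset_cball] by auto
  ultimately show ?thesis using that[of "zor_poly f 0"] s(1,3) by auto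
qed

lemma analytic_div_id:
  fixes f :: "complex \<Rightarrow> complex"
  assumes "f analytic_on {0}" "f 0 = 0"
  shows "(\<lambda>t. if t = 0 then deriv f 0 else f t / t) analytic_on {0}"
  by (rule pole_theorem_analytic_0[OF assms(1), where a = 0])
    (use assms(2) in \<open>auto intro!: exI[of _ 1]\<close>)

text \<open>The common power is the least order of vanishing among the components; it exists as soon
  as one component does not vanish identically.\<close>

lemma analytic_vector_factor:
  fixes f :: "'n::finite \<Rightarrow> complex \<Rightarrow> complex"
  assumes an: "\<And>i. f i analytic_on {0}" and nz: "\<exists>\<^sub>F t in at 0. \<exists>i. f i t \<noteq> 0"
  obtains k e where "\<And>i. e i analytic_on {0}" "\<exists>i. e i 0 \<noteq> 0"
    "\<And>i. eventually (\<lambda>t. f i t = t ^ k * e i t) (nhds 0)"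
proof -
  \<comment> \<open>Induction on the order \<open>n\<close> of one component \<open>f j\<close>:
    while all components vanish at 0, all of them are divided by \<open>t\<close>. This stops at the
    latest when \<open>n\<close> is 0, for then \<open>f j 0\<close> is nonzero.\<close>
  have step: "\<exists>k e. (\<forall>i. e i analytic_on {0}) \<and> (\<exists>i. e i 0 \<noteq> 0) \<and>
      (\<forall>i. eventually (\<lambda>t. f i t = t ^ k * e i t) (nhds 0))"
    if "\<forall>i. f i analytic_on {0}" "d analytic_on {0}" "d 0 \<noteq> 0"
      "eventually (\<lambda>t. f j t = t ^ n * d t) (nhds 0)" for f :: "'n \<Rightarrow> complex \<Rightarrow> complex" and d j n
    using that
  proof (induction n arbitrary: f)
    case 0
    then have "f j 0 \<noteq> 0" using eventually_nhds_x_imp_x[OF 0(4)] by simp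
    with 0 show ?case by (intro exI[of _ 0] exI[of _ f]) auto
  next
    case (Suc n)
    show ?case
    proof (cases "\<exists>i. f i 0 \<noteq> 0")
      case True
      with Suc show ?thesis by (intro exI[of _ 0] exI[of _ f]) auto
    next
      case False
      define f' where "f' = (\<lambda>i t. if t = 0 then deriv (f i) 0 else f i t / t)"
      have an': "\<forall>i. f' i analytic_on {0}"
        using analytic_div_id Suc.prems(1) False unfolding f'_def by blast
      have eq: "f i t = t * f' i t" for i t using False by (auto simp: f'_def)
      have ev: "eventually (\<lambda>t. f' j t = t ^ n * d t) (at 0)"
        using Suc.prems(4)[unfolded eventually_nhds_conv_at, THEN conjunct1] eventually_neq_at_within[of 0]
        by eventually_elim (simp add: f'_def)
      \<comment> \<open>Cancelling \<open>t\<close> gives the factorisation of \<open>f' j\<close>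
        only at nonzero arguments; the value at 0 follows by continuity.\<close>
      have "isCont (f' j) 0" "isCont d 0"
        using an' Suc.prems(2) analytic_at_imp_isCont by auto
      then have "f' j \<midarrow>0\<rightarrow> f' j 0" and "(\<lambda>t. t ^ n * d t) \<midarrow>0\<rightarrow> 0 ^ n * d 0"
        by (auto simp: isCont_def intro!: tendsto_intros)
      from Lim_transform_eventually[OF this(1) ev] this(2) have "f' j 0 = 0 ^ n * d 0"
        by (rule LIM_unique)
      with ev
      have "eventually (\<lambda>t. f' j t = t ^ n * d t) (nhds 0)"
        by (simp add: eventually_nhds_conv_at)
      from Suc.IH[OF an' Suc.prems(2,3) this] obtain k e where ke: "\<forall>i. e i analytic_on {0}"
        "\<exists>i. e i 0 \<noteq> 0" "\<forall>i. eventually (\<lambda>t. f' i t = t ^ k * e i t) (nhds 0)" by blast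
      have "\<forall>i. eventually (\<lambda>t. f i t = t ^ Suc k * e i t) (nhds 0)"
        using ke(3) by (auto simp: eq elim: eventually_mono)
      with ke show ?thesis by blast
    qed
  qed
  have "\<exists>j. \<exists>\<^sub>F t in at 0. f j t \<noteq> 0"
  proof (rule ccontr)
    assume "\<nexists>j. \<exists>\<^sub>F t in at 0. f j t \<noteq> 0"
    then have "eventually (\<lambda>t. \<forall>j. f j t = 0) (at 0)"
      by (simp add: frequently_def eventually_all_finite)
    then have "eventually (\<lambda>t. \<not> (\<exists>i. f i t \<noteq> 0)) (at 0)" by eventually_elim simp
    with nz show False by (simp add: frequently_def)
  qed
  then obtain j where "\<exists>\<^sub>F t in at 0. f j t \<noteq> 0" ..
  then obtain n d where "d analytic_on {0}" "d 0 \<noteq> 0" "eventually (\<lambda>t. f j t = t ^ n * d t) (nhds 0)"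
    using analytic_factor_power an by metis
  then have "\<exists>k e. (\<forall>i. e i analytic_on {0}) \<and> (\<exists>i. e i 0 \<noteq> 0) \<and>
      (\<forall>i. eventually (\<lambda>t. f i t = t ^ k * e i t) (nhds 0))"
    using an by (intro step[of f d j n]) auto
  then show ?thesis using that by blast
qed

text \<open>Away from \<open>Z\<close> the constant 1 lies in the ideal, hence is locally a
  combination of the generators, which excludes a common zero. As \<open>Z\<close> is an arbitrary
  set here, a whole neighbourhood free of \<open>Z\<close> is assumed.\<close>

lemma no_common_zero:
  assumes "openin (zariski_on X) U" "generates_ideal U Z f" "x \<in> U"
    and "eventually (\<lambda>y. y \<notin> Z) (zariski_nhds X x)"
  shows "\<exists>i. f i x \<noteq> 0"
proof -
  have "eventually (\<lambda>y. y \<notin> Z) (zariski_nhds U x)"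
    using assms by (simp add: zariski_nhds_open)
  then obtain D where D: "D \<in> fst ` rational_funs" "x \<in> D" "\<forall>y\<in>U \<inter> D. y \<notin> Z"
    unfolding eventually_zariski_nhds by (elim bexE conjE)
  have op: "openin (zariski_on U) (U \<inter> D)"
    unfolding openin_zariski_on_iff eventually_zariski_nhds
    by (intro conjI ballI bexI[OF _ D(1)]) auto
  have reg: "regular_on (U \<inter> D) (\<lambda>_. 1)"
    unfolding regular_on_def
    by (intro ballI exI[of _ UNIV] exI[of _ "\<lambda>_. 1"]) (simp add: rational_funs.const)
  have "\<exists>W a. openin (zariski_on U) W \<and> x \<in> W \<and> W \<subseteq> U \<inter> D \<and> (\<forall>i. regular_on W (a i)) \<and>
      (\<forall>y\<in>W. 1 = (\<Sum>i\<in>UNIV. a i y * f i y))"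
    using assms(2)[unfolded generates_ideal_def, THEN conjunct2, rule_format, of x "U \<inter> D" "\<lambda>_. 1"]
      D assms(3) op reg by blast
  then obtain W a where W: "x \<in> W" "\<forall>y\<in>W. 1 = (\<Sum>i\<in>UNIV. a i y * f i y)" by blast
  show ?thesis
  proof (rule ccontr)
    assume "\<nexists>i. f i x \<noteq> 0"
    with W show False by auto
  qed
qed

interpretation analytic_germs: germs "nhds (0::complex)" "{f. f analytic_on {0}}" 0
  by (rule germs_analytic)

abbreviation analytic_curve :: "(complex \<Rightarrow> 'a::ambient) \<Rightarrow> bool" where
  "analytic_curve \<equiv> germs.germ_map (nhds (0::complex)) {f. f analytic_on {0}} 0"

text \<open>Along the curve the generators become \<open>t ^ k * e i t\<close>. Once the power is
  cancelled, the vector \<open>e\<close> has a nonzero value at 0, and this is the missing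
  projective coordinate of the lift.\<close>

lemma lift_curve:
  fixes c :: "complex \<Rightarrow> 'a::ambient" and g :: "'a \<Rightarrow> 'n::finite proj"
  assumes g: "ideal_generator_map X Z g" and c: "analytic_curve c"
    and cX: "eventually (\<lambda>t. c t \<in> X) (nhds 0)"
    and cZ: "eventually (\<lambda>t. eventually (\<lambda>y. y \<notin> Z) (zariski_nhds X (c t))) (at 0)"
  obtains c' where "analytic_curve c'" "eventually (\<lambda>t. c' t \<in> blowup X Z g) (nhds 0)"
    "\<And>t. fst (c' t) = c t" "eventually (\<lambda>t. c' t = (c t, g (c t))) (at 0)"
proof -
  have c0: "c 0 \<in> X" using cX by (rule eventually_nhds_x_imp_x)
  with g obtain U f where U: "openin (zariski_on X) U" "c 0 \<in> U" "generates_ideal U Z f"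
    and gf: "\<forall>y\<in>U - Z. g y = proj_of (\<chi> i. f i y)"
    unfolding ideal_generator_map_def by blast
  have an: "(\<lambda>t. f i (c t)) analytic_on {0}" for i
  proof -
    have "f i \<in> regular_at X (c 0)"
      using U by (intro regular_on_imp_regular_at[of U]) (auto simp: generates_ideal_def)
    from analytic_germs.germ_map_regular[OF c this cX] show ?thesis by simp
  qed
  have cU: "eventually (\<lambda>t. c t \<in> U) (nhds 0)"
    by (rule analytic_germs.germ_map_nhds[OF c _ cX]) (intro openin_zariski_on_nhds U)
  have cZ': "eventually (\<lambda>t. c t \<notin> Z) (at 0)"
    using cZ cX[unfolded eventually_nhds_conv_at, THEN conjunct1]
    by eventually_elim (rule eventually_zariski_nhds_self)
  have cU': "eventually (\<lambda>t. c t \<in> U) (at 0)" "eventually (\<lambda>t. c t \<in> X) (at 0)"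
    using cU cX by (auto simp: eventually_nhds_conv_at)
  have nz: "eventually (\<lambda>t. \<exists>i. f i (c t) \<noteq> 0) (at 0)"
    using cZ cU'(1) by eventually_elim (rule no_common_zero[OF U(1,3)])
  obtain k e where e: "\<And>i. e i analytic_on {0}" "\<exists>i. e i 0 \<noteq> 0"
    "\<And>i. eventually (\<lambda>t. f i (c t) = t ^ k * e i t) (nhds 0)"
    using analytic_vector_factor[of "\<lambda>i t. f i (c t)", OF an eventually_frequently[OF at_neq_bot nz]]
    by metis
  define c' where "c' = (\<lambda>t. (c t, proj_of (\<chi> i. e i t)))"
  have "analytic_curve (\<lambda>t. proj_of (\<chi> i. e i t))"
    by (rule analytic_germs.germ_map_proj[of e]) (use e in auto)
  with c have c': "analytic_curve c'"
    unfolding c'_def by (rule analytic_germs.germ_map_Pair)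
  have fe: "eventually (\<lambda>t. \<forall>i. f i (c t) = t ^ k * e i t) (at 0)"
    using e(3) by (simp add: eventually_all_finite eventually_nhds_conv_at)
  have graph: "eventually (\<lambda>t. c' t = (c t, g (c t))) (at 0)"
    using fe cZ' cU'(1) eventually_neq_at_within[of 0]
  proof eventually_elim
    case (elim t)
    have "(\<chi> i. f i (c t)) = t ^ k *s (\<chi> i. e i t)" using elim by (simp add: vec_eq_iff)
    then show ?case using elim gf by (simp add: c'_def proj_of_scale)
  qed
  let ?G = "{(x, g x) | x. x \<in> X - Z}"
  have inG: "eventually (\<lambda>t. c' t \<in> ?G) (at 0)"
    using graph cZ' cU'(2) by eventually_elim auto
  have sub: "?G \<subseteq> X \<times> UNIV" by auto
  have GB: "?G \<subseteq> blowup X Z g"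
    unfolding blowup_def using closure_of_subset[of ?G "zariski_on (X \<times> UNIV)"] sub by simp
  have c'X: "eventually (\<lambda>t. c' t \<in> X \<times> UNIV) (nhds 0)"
    using cX by eventually_elim (simp add: c'_def)
  \<comment> \<open>The punctured curve lies on the graph and enters every Zariski neighbourhood of
    \<open>c' 0\<close>, so this point is in the closure.\<close>
  have "c' 0 \<in> blowup X Z g"
    unfolding blowup_def in_closure_of_zariski_on[OF sub]
  proof (intro conjI)
    show "c' 0 \<in> X \<times> UNIV" using c0 by (simp add: c'_def)
    show "\<exists>\<^sub>F y in zariski_nhds (X \<times> UNIV) (c' 0). y \<in> ?G"
      unfolding frequently_def
    proof
      assume "eventually (\<lambda>y. y \<notin> ?G) (zariski_nhds (X \<times> UNIV) (c' 0))"
      then have "eventually (\<lambda>t. c' t \<notin> ?G) (nhds 0)"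
        by (rule analytic_germs.germ_map_nhds[OF c' _ c'X])
      then have "eventually (\<lambda>t. c' t \<notin> ?G) (at 0)" by (simp add: eventually_nhds_conv_at)
      with inG have "eventually (\<lambda>t. False) (at (0::complex))" by eventually_elim blast
      then show False by simp
    qed
  qed
  moreover have "eventually (\<lambda>t. c' t \<in> blowup X Z g) (at 0)"
    using inG by eventually_elim (use GB in blast)
  ultimately have "eventually (\<lambda>t. c' t \<in> blowup X Z g) (nhds 0)"
    by (simp add: eventually_nhds_conv_at)
  then show ?thesis using that[OF c' _ _ graph] by (simp add: c'_def)
qed

subsection \<open>The projective plane\<close>

definition cross3 :: "complex ^ 3 \<Rightarrow> complex ^ 3 \<Rightarrow> complex ^ 3" where
  "cross3 u v = vector [u$2 * v$3 - u$3 * v$2, u$3 * v$1 - u$1 * v$3, u$1 * v$2 - u$2 * v$1]"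

lemma cross3_nth [simp]:
  "cross3 u v $ 1 = u$2 * v$3 - u$3 * v$2"
  "cross3 u v $ 2 = u$3 * v$1 - u$1 * v$3"
  "cross3 u v $ 3 = u$1 * v$2 - u$2 * v$1"
  by (simp_all add: cross3_def)

lemma vec3_eq_iff: "u = v \<longleftrightarrow> u$1 = v$1 \<and> u$2 = v$2 \<and> u$3 = v$3" for u v :: "'a ^ 3"
  by (auto simp: vec_eq_iff forall_3)

lemma scalar_product_3:
  "scalar_product u v = u$1 * v$1 + u$2 * v$2 + u$3 * v$3" for u v :: "complex ^ 3"
  by (simp add: scalar_product_def sum_3)

lemma scalar_product_commute: "scalar_product u v = scalar_product v u" for u v :: "complex ^ 'n"
  by (simp add: scalar_product_def mult.commute)

lemma scalar_product_scale:
  "scalar_product (a *s u) v = a * scalar_product u v"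
  "scalar_product u (a *s v) = a * scalar_product u v" for u v :: "complex ^ 'n"
  by (simp_all add: scalar_product_def sum_distrib_left mult.assoc mult.left_commute)

lemma scalar_product_vector_matrix:
  "scalar_product (m v* A) w = scalar_product m (A *v w)" for A :: "complex ^ 'n ^ 'm"
proof -
  have "scalar_product (m v* A) w = (\<Sum>i\<in>UNIV. \<Sum>j\<in>UNIV. m $ j * A $ j $ i * w $ i)"
    by (simp add: scalar_product_def vector_matrix_mult_def sum_distrib_right sum_distrib_left mult_ac)
  also have "\<dots> = (\<Sum>j\<in>UNIV. \<Sum>i\<in>UNIV. m $ j * A $ j $ i * w $ i)"
    by (rule sum.swap)
  also have "\<dots> = scalar_product m (A *v w)"
    by (simp add: scalar_product_def matrix_vector_mult_def sum_distrib_left mult_ac)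
  finally show ?thesis .
qed

lemma scalar_product_eqI:
  fixes u v :: "complex ^ 'n"
  assumes "\<And>w. scalar_product u w = scalar_product v w"
  shows "u = v"
proof -
  have "u $ i = scalar_product u (axis i 1)" for u :: "complex ^ 'n" and i
    by (simp add: scalar_product_def axis_def if_distrib sum.delta cong: if_cong)
  then show ?thesis using assms by (simp add: vec_eq_iff)
qed

lemma cross3_eq_0_iff:
  assumes "v \<noteq> 0"
  shows "cross3 u v = 0 \<longleftrightarrow> (\<exists>c. u = c *s v)"
proof
  assume "cross3 u v = 0"
  then have eq: "u$2 * v$3 = u$3 * v$2" "u$3 * v$1 = u$1 * v$3" "u$1 * v$2 = u$2 * v$1"
    by (auto simp: vec3_eq_iff)
  from assms consider "v$1 \<noteq> 0" | "v$2 \<noteq> 0" | "v$3 \<noteq> 0" by (auto simp: vec3_eq_iff)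
  then show "\<exists>c. u = c *s v"
  proof cases
    case 1
    then show ?thesis using eq by (intro exI[of _ "u$1 / v$1"]) (simp add: vec3_eq_iff field_simps)
  next
    case 2
    then show ?thesis using eq by (intro exI[of _ "u$2 / v$2"]) (simp add: vec3_eq_iff field_simps)
  next
    case 3
    then show ?thesis using eq by (intro exI[of _ "u$3 / v$3"]) (simp add: vec3_eq_iff field_simps)
  qed
qed (auto simp: vec3_eq_iff)

lemma orthogonal_to_both:
  assumes "scalar_product s u = 0" "scalar_product s v = 0" "cross3 u v \<noteq> 0"
  shows "\<exists>c. s = c *s cross3 u v"
proof -
  \<comment> \<open>Lagrange's formula for the double cross product.\<close>
  have "cross3 s (cross3 u v) = scalar_product s v *s u - scalar_product s u *s v"
    by (simp add: vec3_eq_iff scalar_product_3 algebra_simps)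
  then have "cross3 s (cross3 u v) = 0" using assms by simp
  then show ?thesis using assms(3) by (simp add: cross3_eq_0_iff)
qed

lemma proj_of_eq_iff_cross3:
  assumes "u \<noteq> 0" "v \<noteq> 0"
  shows "proj_of u = proj_of v \<longleftrightarrow> cross3 u v = 0"
  using assms by (simp add: proj_of_eq_iff cross3_eq_0_iff)

lemma on_line_proj_of:
  assumes "u \<noteq> 0" "m \<noteq> 0"
  shows "on_line (proj_of u) (proj_of m) \<longleftrightarrow> scalar_product m u = 0"
proof -
  obtain c where "c \<noteq> 0" "homog (proj_of u) = c *s u" using homog_proj_of assms(1) .
  moreover obtain d where "d \<noteq> 0" "homog (proj_of m) = d *s m" using homog_proj_of assms(2) .
  ultimately show ?thesis by (simp add: on_line_def scalar_product_scale)
qed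

lemma join_commute: "join p q = join q p"
  by (simp add: join_def conj_commute)

section \<open>Coordinates adapted to the conic: parameter, poles and chords\<close>

definition kv :: "complex \<Rightarrow> complex ^ 3" where "kv t = vector [1, t, t ^ 2]"

lemma kv_nth [simp]: "kv t $ 1 = 1" "kv t $ 2 = t" "kv t $ 3 = t ^ 2"
  by (simp_all add: kv_def)

lemma kv_nonzero [simp]: "kv t \<noteq> 0"
  by (simp add: vec3_eq_iff)

text \<open>The rows of \<open>Ni\<close> are the coordinate forms of the new basis. On the conic
  the first one vanishes only at the point with new coordinates \<open>(0, 0, 1)\<close>, where the
  parameter would be infinite.\<close>

definition chart_dom :: "complex ^ 3 ^ 3 \<Rightarrow> 3 proj set" where
  "chart_dom Ni = {k. scalar_product (Ni $ 1) (homog k) \<noteq> 0}"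

definition par :: "complex ^ 3 ^ 3 \<Rightarrow> 3 proj \<Rightarrow> complex" where
  "par Ni k = scalar_product (Ni $ 2) (homog k) / scalar_product (Ni $ 1) (homog k)"

text \<open>Coordinates in which the conic is \<open>w\<^sub>2\<^sup>2 = w\<^sub>1 w\<^sub>3\<close>; the columns of \<open>N\<close> are the new basis.
  Lines are transformed contragrediently, so that incidence keeps its form.\<close>

locale conic_frame =
  fixes M N Ni :: "complex ^ 3 ^ 3" and \<kappa> :: complex
  assumes NiN: "Ni ** N = mat 1" and NNi: "N ** Ni = mat 1" and \<kappa>: "\<kappa> \<noteq> 0"
    and form: "scalar_product (N *v v) (M *v (N *v w)) =
      \<kappa> * (v$1 * w$3 - 2 * (v$2 * w$2) + v$3 * w$1)"
begin

definition pt :: "complex ^ 3 \<Rightarrow> 3 proj" where "pt w = proj_of (N *v w)"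
definition lin :: "complex ^ 3 \<Rightarrow> 3 proj" where "lin m = proj_of (m v* Ni)"

lemma N_inverse [simp]: "Ni *v (N *v w) = w" "N *v (Ni *v w) = w"
    "(m v* Ni) v* N = m" "(m v* N) v* Ni = m"
  by (simp_all add: matrix_vector_mul_assoc vector_matrix_mul_assoc NiN NNi)

lemma N_eq_0_iff [simp]: "N *v w = 0 \<longleftrightarrow> w = 0" "m v* Ni = 0 \<longleftrightarrow> m = 0"
  by (metis N_inverse(1) matrix_vector_mult_0_right) (metis N_inverse(3) vector_matrix_mult_0)

lemma pt_cases:
  obtains w where "w \<noteq> 0" "p = pt w"
proof
  show "p = pt (Ni *v homog p)" by (simp add: pt_def homog_props)
  show "Ni *v homog p \<noteq> 0"
    using homog_props(1)[of p] N_inverse(2)[of "homog p"] by (metis matrix_vector_mult_0_right)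
qed

lemma lin_cases:
  obtains m where "m \<noteq> 0" "l = lin m"
proof
  show "l = lin (homog l v* N)" by (simp add: lin_def homog_props)
  show "homog l v* N \<noteq> 0"
    using homog_props(1)[of l] N_inverse(4)[of "homog l"] by (metis vector_matrix_mult_0)
qed

lemma on_line_iff:
  "w \<noteq> 0 \<Longrightarrow> m \<noteq> 0 \<Longrightarrow> on_line (pt w) (lin m) \<longleftrightarrow> scalar_product m w = 0"
  by (simp add: pt_def lin_def on_line_proj_of scalar_product_vector_matrix)

lemma pt_scale: "c \<noteq> 0 \<Longrightarrow> pt (c *s w) = pt w"
  by (simp add: pt_def matrix_vector_mult_scaleR vec.scale proj_of_scale)

lemma lin_scale: "c \<noteq> 0 \<Longrightarrow> lin (c *s m) = lin m"
proof -
  assume "c \<noteq> 0"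
  moreover have "(c *s m) v* Ni = c *s (m v* Ni)"
    by (simp add: vec3_eq_iff vector_matrix_mult_def sum_3 algebra_simps)
  ultimately show ?thesis by (simp add: lin_def proj_of_scale)
qed

lemma lin_eq_iff:
  assumes "u \<noteq> 0" "v \<noteq> 0"
  shows "lin u = lin v \<longleftrightarrow> cross3 u v = 0"
proof -
  have s: "(c *s m) v* A = c *s (m v* A)" for c m and A :: "complex ^ 3 ^ 3"
    by (simp add: vec3_eq_iff vector_matrix_mult_def sum_3 algebra_simps)
  have "(u v* Ni = c *s (v v* Ni)) \<longleftrightarrow> u = c *s v" for c
    by (metis N_inverse(3) s)
  then show ?thesis using assms by (simp add: lin_def proj_of_eq_iff cross3_eq_0_iff)
qed

lemma join_pt:
  assumes "cross3 u v \<noteq> 0"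
  shows "join (pt u) (pt v) = lin (cross3 u v)"
  unfolding join_def
proof (rule the_equality)
  have nz: "u \<noteq> 0" "v \<noteq> 0" using assms by (auto simp: vec3_eq_iff)
  then show "on_line (pt u) (lin (cross3 u v)) \<and> on_line (pt v) (lin (cross3 u v))"
    using assms by (simp add: on_line_iff) (simp add: scalar_product_3 algebra_simps)
  fix l assume l: "on_line (pt u) l \<and> on_line (pt v) l"
  obtain m where m: "m \<noteq> 0" "l = lin m" by (rule lin_cases)
  then have "scalar_product m u = 0" "scalar_product m v = 0" using l nz by (auto simp: on_line_iff)
  then obtain c where "m = c *s cross3 u v" using orthogonal_to_both assms by blast
  with m show "l = lin (cross3 u v)" by (cases "c = 0") (auto simp: lin_scale)
qed

lemma meet_ln:
  assumes "cross3 u v \<noteq> 0"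
  shows "meet (lin u) (lin v) = pt (cross3 u v)"
  unfolding meet_def
proof (rule the_equality)
  have nz: "u \<noteq> 0" "v \<noteq> 0" using assms by (auto simp: vec3_eq_iff)
  then show "on_line (pt (cross3 u v)) (lin u) \<and> on_line (pt (cross3 u v)) (lin v)"
    using assms by (simp add: on_line_iff) (simp add: scalar_product_3 algebra_simps)
  fix p assume p: "on_line p (lin u) \<and> on_line p (lin v)"
  obtain w where w: "w \<noteq> 0" "p = pt w" by (rule pt_cases)
  then have "scalar_product w u = 0" "scalar_product w v = 0"
    using p nz by (auto simp: on_line_iff scalar_product_commute)
  then obtain c where "w = c *s cross3 u v" using orthogonal_to_both assms by blast
  with w show "p = pt (cross3 u v)" by (cases "c = 0") (auto simp: pt_scale)
qed

lemma pt_in_conic_iff: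
  assumes "w \<noteq> 0"
  shows "pt w \<in> conic M \<longleftrightarrow> w$2 ^ 2 = w$1 * w$3"
proof -
  obtain c where c: "c \<noteq> 0" "homog (pt w) = c *s (N *v w)"
    using homog_proj_of[of "N *v w"] assms by (auto simp: pt_def)
  have "M *v (c *s (N *v w)) = c *s (M *v (N *v w))" by (rule vec.scale)
  then have "pt w \<in> conic M \<longleftrightarrow> c * (c * (\<kappa> * (w$1 * w$3 - 2 * (w$2 * w$2) + w$3 * w$1))) = 0"
    by (simp only: conic_def mem_Collect_eq c scalar_product_scale form)
  also have "w$1 * w$3 - 2 * (w$2 * w$2) + w$3 * w$1 = 2 * (w$1 * w$3 - w$2 ^ 2)"
    by (simp add: power2_eq_square algebra_simps)
  finally show ?thesis using c \<kappa> by auto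
qed

text \<open>The covector \<open>M *v (N *v w)\<close> is determined by its pairings with the vectors
  \<open>N *v v\<close>, and these are given by \<open>form\<close>.\<close>

lemma polar_pt:
  assumes "w \<noteq> 0"
  shows "polar M (pt w) = lin (vector [w$3, -2 * w$2, w$1])"
proof -
  obtain c where c: "c \<noteq> 0" "homog (pt w) = c *s (N *v w)"
    using homog_proj_of[of "N *v w"] assms by (auto simp: pt_def)
  have "(M *v (N *v w)) v* N = \<kappa> *s vector [w$3, -2 * w$2, w$1]" (is "_ = ?m")
  proof (rule scalar_product_eqI)
    fix v
    have "scalar_product ((M *v (N *v w)) v* N) v = scalar_product (N *v v) (M *v (N *v w))"
      by (metis scalar_product_vector_matrix scalar_product_commute)
    also have "\<dots> = scalar_product ?m v"
      unfolding form by (simp add: scalar_product_3 algebra_simps)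
    finally show "scalar_product ((M *v (N *v w)) v* N) v = scalar_product ?m v" .
  qed
  then have "M *v (N *v w) = ?m v* Ni" by (metis N_inverse(4))
  then have "polar M (pt w) = lin ?m"
    by (simp add: polar_def c vec.scale proj_of_scale lin_def)
  then show ?thesis using \<kappa> by (simp add: lin_scale)
qed

lemma pole_ln:
  assumes "m \<noteq> 0"
  shows "pole M (lin m) = pt (vector [m$3, - m$2 / 2, m$1])"
  unfolding pole_def
proof (rule the_equality)
  show "polar M (pt (vector [m$3, - m$2 / 2, m$1])) = lin m"
  proof -
    have "vector [m$3, - m$2 / 2, m$1] \<noteq> (0 :: complex ^ 3)" using assms by (auto simp: vec3_eq_iff)
    moreover have "vector [m$1, m$2, m$3] = m" by (simp add: vec3_eq_iff)
    ultimately show ?thesis by (simp add: polar_pt)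
  qed
  fix p assume p: "polar M p = lin m"
  obtain w where w: "w \<noteq> 0" "p = pt w" by (rule pt_cases)
  have nz: "vector [w$3, -2 * w$2, w$1] \<noteq> (0 :: complex ^ 3)" using w(1) by (auto simp: vec3_eq_iff)
  with p w assms have "cross3 (vector [w$3, -2 * w$2, w$1]) m = 0"
    by (simp add: polar_pt lin_eq_iff)
  then obtain c where "vector [w$3, -2 * w$2, w$1] = c *s m"
    using assms by (auto simp: cross3_eq_0_iff)
  then have c: "w = c *s vector [m$3, - m$2 / 2, m$1]" by (simp add: vec3_eq_iff) algebra
  then have "c \<noteq> 0" using w(1) by auto
  then show "p = pt (vector [m$3, - m$2 / 2, m$1])" using w(2) c pt_scale by metis
qed

lemma scalar_product_row: "scalar_product (A $ i) v = (A *v v) $ i" for A :: "complex ^ 'n ^ 'm"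
  by (simp add: scalar_product_def matrix_vector_mult_def)

lemma chart:
  assumes "k \<in> conic M" "k \<in> chart_dom Ni"
  shows "k = pt (kv (par Ni k))"
proof -
  define w where "w = Ni *v homog k"
  have k: "k = pt w" by (simp add: pt_def w_def homog_props)
  have w1: "w $ 1 \<noteq> 0" using assms(2) by (simp add: chart_dom_def scalar_product_row w_def)
  then have "w \<noteq> 0" by auto
  then have "w$2 ^ 2 = w$1 * w$3" using assms(1) k pt_in_conic_iff by blast
  moreover have "par Ni k = w$2 / w$1" by (simp add: par_def scalar_product_row w_def)
  ultimately have "w = w$1 *s kv (par Ni k)"
    using w1 by (simp only: vec3_eq_iff) (simp add: field_simps power2_eq_square)
  then show ?thesis using k w1 pt_scale by metis
qed

lemma par_pt_kv [simp]: "par Ni (pt (kv t)) = t" "pt (kv t) \<in> chart_dom Ni" "pt (kv t) \<in> conic M"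
proof -
  obtain c where c: "c \<noteq> 0" "homog (pt (kv t)) = c *s (N *v kv t)"
    using homog_proj_of[of "N *v kv t"] by (auto simp: pt_def)
  show "par Ni (pt (kv t)) = t" "pt (kv t) \<in> chart_dom Ni"
    using c by (simp_all add: par_def chart_dom_def scalar_product_scale scalar_product_row vec.scale)
  show "pt (kv t) \<in> conic M" by (simp add: pt_in_conic_iff)
qed

lemma pt_kv_eq_iff [simp]: "pt (kv s) = pt (kv t) \<longleftrightarrow> s = t"
  using par_pt_kv(1) by metis

text \<open>The covector of the monic quadratic with roots \<open>s\<close> and \<open>t\<close>:
  its pairing with \<open>kv u\<close> is \<open>(u - s) * (u - t)\<close>. It keeps a meaning for
  \<open>s = t\<close>, as the tangent, where \<open>cross3 (kv s) (kv t)\<close> vanishes.\<close>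

definition chord :: "complex \<Rightarrow> complex \<Rightarrow> complex ^ 3" where
  "chord s t = vector [s * t, - (s + t), 1]"

lemma chord_nth [simp]: "chord s t $ 1 = s * t" "chord s t $ 2 = - (s + t)" "chord s t $ 3 = 1"
  by (simp_all add: chord_def)

lemma chord_nonzero [simp]: "chord s t \<noteq> 0"
  by (simp add: vec3_eq_iff)

lemma join_pt_kv:
  assumes "s \<noteq> t"
  shows "join (pt (kv s)) (pt (kv t)) = lin (chord s t)"
proof -
  have c: "cross3 (kv s) (kv t) = (t - s) *s chord s t"
    by (simp add: vec3_eq_iff power2_eq_square algebra_simps)
  have "cross3 (kv s) (kv t) \<noteq> 0" using assms by (simp add: c)
  then have "join (pt (kv s)) (pt (kv t)) = lin ((t - s) *s chord s t)"
    unfolding c[symmetric] by (rule join_pt)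
  also have "\<dots> = lin (chord s t)" using assms by (intro lin_scale) simp
  finally show ?thesis .
qed

text \<open>Proportional chords are equal, because their third entries are normalised, and then they
  have the same roots.\<close>

lemma cross3_chord_nonzero:
  assumes "distinct [a, b, c, d]"
  shows "cross3 (chord a b) (chord c d) \<noteq> 0"
proof
  assume "cross3 (chord a b) (chord c d) = 0"
  then have "- a - b = - c - d" "c * d = a * b" by (auto simp: vec3_eq_iff)
  then have "(a - c) * (a - d) = 0" by algebra
  with assms show False by simp
qed

end

subsection \<open>The Pascal line\<close>

text \<open>The columns are \<open>a\<close>, \<open>b\<close>, \<open>c\<close>. An arbitrary
  commutative ring is allowed because the same formulas are evaluated on integers and used over the
  complex numbers.\<close>

definition det3 :: "'a::comm_ring_1 \<Rightarrow> 'a \<Rightarrow> 'a \<Rightarrow> 'a \<Rightarrow> 'a \<Rightarrow> 'a \<Rightarrow> 'a \<Rightarrow> 'a \<Rightarrow> 'a \<Rightarrow> 'a" where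
  "det3 a1 a2 a3 b1 b2 b3 c1 c2 c3 =
    a1 * (b2 * c3 - b3 * c2) - b1 * (a2 * c3 - a3 * c2) + c1 * (a2 * b3 - a3 * b2)"

text \<open>The Pascal line meets the conic in the fixed points of the projectivity \<open>x\<^sub>i \<mapsto> y\<^sub>i\<close>. The graph
  of this projectivity is the zero set in \<open>(t, u)\<close> of the determinant with rows
  \<open>(t u, u, t, 1)\<close>, \<open>(x\<^sub>i y\<^sub>i, y\<^sub>i, x\<^sub>i, 1)\<close>; setting \<open>u = t\<close> gives a quadratic polynomial in \<open>t\<close>, whose
  coefficients are the following.\<close>

definition pasc1 :: "'a::comm_ring_1 \<Rightarrow> 'a \<Rightarrow> 'a \<Rightarrow> 'a \<Rightarrow> 'a \<Rightarrow> 'a \<Rightarrow> 'a" where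
  "pasc1 x1 x2 x3 y1 y2 y3 = - det3 (x1 * y1) (x2 * y2) (x3 * y3) y1 y2 y3 x1 x2 x3"

definition pasc2 :: "'a::comm_ring_1 \<Rightarrow> 'a \<Rightarrow> 'a \<Rightarrow> 'a \<Rightarrow> 'a \<Rightarrow> 'a \<Rightarrow> 'a" where
  "pasc2 x1 x2 x3 y1 y2 y3 = det3 (x1 * y1) (x2 * y2) (x3 * y3) y1 y2 y3 1 1 1
    - det3 (x1 * y1) (x2 * y2) (x3 * y3) x1 x2 x3 1 1 1"

definition pasc3 :: "'a::comm_ring_1 \<Rightarrow> 'a \<Rightarrow> 'a \<Rightarrow> 'a \<Rightarrow> 'a \<Rightarrow> 'a \<Rightarrow> 'a" where
  "pasc3 x1 x2 x3 y1 y2 y3 = det3 y1 y2 y3 x1 x2 x3 1 1 1"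

lemmas pasc_defs = pasc1_def pasc2_def pasc3_def det3_def

definition pasc :: "(3 \<Rightarrow> complex) \<Rightarrow> (3 \<Rightarrow> complex) \<Rightarrow> complex ^ 3" where
  "pasc x y = vector [pasc1 (x 1) (x 2) (x 3) (y 1) (y 2) (y 3),
    pasc2 (x 1) (x 2) (x 3) (y 1) (y 2) (y 3), pasc3 (x 1) (x 2) (x 3) (y 1) (y 2) (y 3)]"

lemma pasc_nth [simp]:
  "pasc x y $ 1 = pasc1 (x 1) (x 2) (x 3) (y 1) (y 2) (y 3)"
  "pasc x y $ 2 = pasc2 (x 1) (x 2) (x 3) (y 1) (y 2) (y 3)"
  "pasc x y $ 3 = pasc3 (x 1) (x 2) (x 3) (y 1) (y 2) (y 3)"
  by (simp_all add: pasc_def)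

instance letter :: finite
proof
  have *: "(UNIV :: letter set) = {LA, LB, LC, LD, LE, LF}" using letter.exhaust by blast
  show "finite (UNIV :: letter set)" unfolding * by simp
qed

lemma UNIV_letter: "(UNIV :: letter set) = {LA, LB, LC, LD, LE, LF}"
  using letter.exhaust by blast

lemma card_letter: "CARD(letter) = 6"
  by (simp add: UNIV_letter)

lemma pascal_array_inj:
  assumes "a \<in> pascal_arrays"
  shows "inj (case_prod a)"
proof (rule eq_card_imp_inj_on)
  have "CARD(2 \<times> 3) = 6" by simp
  then show "card (range (case_prod a)) = card (UNIV :: (2 \<times> 3) set)"
    using assms card_letter by (simp add: pascal_arrays_def)
qed simp

lemma pascal_array_eq_iff:
  "a \<in> pascal_arrays \<Longrightarrow> a i j = a i' j' \<longleftrightarrow> i = i' \<and> j = j'"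
  using pascal_array_inj[of a] by (auto simp: inj_def)

lemma pascal_symbol_rep:
  assumes "s \<in> pascal_symbols"
  obtains a where "a \<in> pascal_arrays" "s = array_equiv `` {a}"
  using assms by (auto simp: pascal_symbols_def quotient_def)

lemma in_array_class_iff:
  assumes "a \<in> pascal_arrays"
  shows "b \<in> array_equiv `` {a} \<longleftrightarrow> b \<in> pascal_arrays \<and>
    (\<exists>\<sigma> \<tau>. bij \<sigma> \<and> bij \<tau> \<and> b = (\<lambda>i j. a (\<sigma> i) (\<tau> j)))"
  using assms by (auto simp: array_equiv_def)

lemma self_in_array_class: "a \<in> pascal_arrays \<Longrightarrow> a \<in> array_equiv `` {a}"
  unfolding in_array_class_iff by (intro conjI exI[of _ id]) (auto simp: id_def[symmetric])

context conic_frame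
begin

text \<open>All three intersection points are incident with \<open>pasc\<close>, and two of them
  already span a line; both facts are polynomial identities in the six parameters.\<close>

lemma pascal_line_eq:
  assumes a: "a \<in> pascal_arrays" and z: "inj z"
  shows "pascal_line (array_equiv `` {a}) (\<lambda>L. pt (kv (z L))) = lin (pasc (\<lambda>j. z (a 0 j)) (\<lambda>j. z (a 1 j)))"
    and "pasc (\<lambda>j. z (a 0 j)) (\<lambda>j. z (a 1 j)) \<noteq> 0"
proof -
  define x y where xy: "x = (\<lambda>j. z (a 0 j))" "y = (\<lambda>j. z (a 1 j))"
  define h where "h = (\<lambda>L. pt (kv (z L)))"
  have xeq: "x i = x j \<longleftrightarrow> i = j" "y i = y j \<longleftrightarrow> i = j" "x i \<noteq> y j" "y i \<noteq> x j" for i j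
    by (simp_all add: xy inj_eq[OF z] pascal_array_eq_iff[OF a])
  \<comment> \<open>At \<open>t = u = x 1\<close> the moving row of the determinant minus the row of
    \<open>(x 1, y 1)\<close> is \<open>x 1 - y 1\<close> times \<open>(x 1, 1, 0, 0)\<close>, which
    makes the value a product.\<close>
  have "scalar_product (pasc x y) (kv (x 1)) = - (x 1 - y 1) * (y 2 - y 3) * (x 1 - x 2) * (x 1 - x 3)"
    by (simp add: scalar_product_3 pasc_defs) algebra
  also have "\<dots> \<noteq> 0" by (simp add: xeq)
  finally show nz: "pasc x y \<noteq> 0" by (auto simp: scalar_product_def)
  define X where "X = (\<lambda>i j. cross3 (chord (x i) (y j)) (chord (x j) (y i)))"
  have Xnz: "X i j \<noteq> 0" if "i \<noteq> j" for i j
    unfolding X_def by (rule cross3_chord_nonzero) (use xeq that in auto)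
  have meet: "meet (join (h (a 0 i)) (h (a 1 j))) (join (h (a 0 j)) (h (a 1 i))) = pt (X i j)"
    if "i \<noteq> j" for i j
  proof -
    have "join (h (a 0 i)) (h (a 1 j)) = lin (chord (x i) (y j))" for i j
      using join_pt_kv[OF xeq(3)[of i j]] by (simp add: h_def xy)
    then show ?thesis using Xnz[OF that] by (simp add: meet_ln X_def)
  qed
  have sym: "scalar_product v (X j i) = - scalar_product v (X i j)" for v i j
    by (simp add: X_def scalar_product_3 algebra_simps)
  have X0: "scalar_product (pasc x y) (X 1 2) = 0" "scalar_product (pasc x y) (X 1 3) = 0"
    "scalar_product (pasc x y) (X 2 3) = 0"
    by (simp_all add: scalar_product_3 pasc_defs X_def) algebra+
  have Xpasc: "scalar_product (pasc x y) (X i j) = 0" if "i \<noteq> j" for i j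
    using exhaust_3[of i] exhaust_3[of j] that X0
      sym[of "pasc x y" 1 2] sym[of "pasc x y" 1 3] sym[of "pasc x y" 2 3]
    by auto
  \<comment> \<open>Source of uniqueness: since \<open>x 1\<close> differs from \<open>y 1\<close>
    and the form is nonzero, these two points are distinct.\<close>
  have cross: "cross3 (X 1 2) (X 1 3) = (x 1 - y 1) *s pasc x y"
    unfolding vec3_eq_iff
    by (intro conjI; simp add: pasc_defs X_def; algebra)
  have line: "(\<forall>i j. i \<noteq> j \<longrightarrow>
      on_line (meet (join (h (a 0 i)) (h (a 1 j))) (join (h (a 0 j)) (h (a 1 i)))) l) \<longleftrightarrow>
      l = lin (pasc x y)" for l
  proof
    assume *: "\<forall>i j. i \<noteq> j \<longrightarrow>
      on_line (meet (join (h (a 0 i)) (h (a 1 j))) (join (h (a 0 j)) (h (a 1 i)))) l"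
    obtain m where m: "m \<noteq> 0" "l = lin m" by (rule lin_cases)
    have "scalar_product m (X i j) = 0" if "i \<noteq> j" for i j
      using * that m meet Xnz by (simp add: on_line_iff)
    then have "scalar_product m (X 1 2) = 0" "scalar_product m (X 1 3) = 0" by simp_all
    moreover have "cross3 (X 1 2) (X 1 3) \<noteq> 0" using nz xeq by (simp add: cross)
    ultimately obtain c where "m = c *s cross3 (X 1 2) (X 1 3)" using orthogonal_to_both by blast
    then have c: "m = (c * (x 1 - y 1)) *s pasc x y" by (simp only: cross vector_smult_assoc)
    then have "c * (x 1 - y 1) \<noteq> 0" using m(1) by auto
    then show "l = lin (pasc x y)" unfolding m(2) c by (rule lin_scale)
  next
    assume "l = lin (pasc x y)"
    then show "\<forall>i j. i \<noteq> j \<longrightarrow>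
      on_line (meet (join (h (a 0 i)) (h (a 1 j))) (join (h (a 0 j)) (h (a 1 i)))) l"
      using meet Xnz nz Xpasc by (simp add: on_line_iff)
  qed
  have "(\<forall>b\<in>array_equiv `` {a}. \<forall>i j. i \<noteq> j \<longrightarrow>
      on_line (meet (join (h (b 0 i)) (h (b 1 j))) (join (h (b 0 j)) (h (b 1 i)))) l) \<longleftrightarrow>
      (\<forall>i j. i \<noteq> j \<longrightarrow>
      on_line (meet (join (h (a 0 i)) (h (a 1 j))) (join (h (a 0 j)) (h (a 1 i)))) l)" (is "?L \<longleftrightarrow> ?R") for l
  proof
    assume ?L then show ?R using self_in_array_class[OF a] by blast
  next
    assume R: ?R
    \<comment> \<open>Another representative permutes columns and possibly swaps the rows. A swap
      amounts to exchanging \<open>i\<close> and \<open>j\<close>, up to the order of the two points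
      in each join.\<close>
    show ?L
    proof (intro ballI allI impI)
      fix b and i j :: 3 assume "b \<in> array_equiv `` {a}" "i \<noteq> j"
      then obtain \<sigma> \<tau> where b: "bij \<sigma>" "bij \<tau>" "b = (\<lambda>i j. a (\<sigma> i) (\<tau> j))"
        using in_array_class_iff[OF a] by blast
      have ne: "\<tau> i \<noteq> \<tau> j" "\<sigma> 0 \<noteq> \<sigma> 1"
        using b(1,2) \<open>i \<noteq> j\<close> by (auto dest!: bij_is_inj simp: inj_eq)
      have "u = 0 \<or> u = 1" for u :: 2 using exhaust_2[of u] by auto
      then consider "\<sigma> 0 = 0" "\<sigma> 1 = 1" | "\<sigma> 0 = 1" "\<sigma> 1 = 0" using ne(2) by metis
      then show "on_line (meet (join (h (b 0 i)) (h (b 1 j))) (join (h (b 0 j)) (h (b 1 i)))) l"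
      proof cases
        case 1
        then show ?thesis using R ne b(3) by simp
      next
        case 2
        have "on_line (meet (join (h (a 0 (\<tau> j))) (h (a 1 (\<tau> i)))) (join (h (a 0 (\<tau> i))) (h (a 1 (\<tau> j))))) l"
          using R ne by metis
        then show ?thesis using 2 b(3) by (simp add: join_commute)
      qed
    qed
  qed
  then have "pascal_line (array_equiv `` {a}) h = (THE l. l = lin (pasc x y))"
    unfolding pascal_line_def by (simp only: line)
  then show "pascal_line (array_equiv `` {a}) h = lin (pasc x y)" by simp
qed

end

subsection \<open>Adapted coordinates\<close>

lemma matrix_eqI:
  fixes A :: "complex ^ 3 ^ 3"
  assumes "\<And>v. A *v v = v"
  shows "A = mat 1"
proof -
  have "A $ i $ j = (A *v axis j 1) $ i" for i j
    by (simp add: matrix_vector_mult_def axis_def if_distrib cong: if_cong)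
  then show ?thesis unfolding assms by (simp add: vec_eq_iff mat_def axis_def)
qed

text \<open>The frame is built from isotropic vectors over the three points by rational operations
  on their mutual products.\<close>

lemma conic_frame_exists:
  assumes M: "nonsingular_conic M" and on: "P \<in> conic M" "Q \<in> conic M" "R \<in> conic M"
    and ne: "P \<noteq> Q" "P \<noteq> R" "Q \<noteq> R"
  obtains N Ni \<kappa> where "conic_frame M N Ni \<kappa>" "P = proj_of (N *v kv 0)" "Q = proj_of (N *v kv 1)"
    "R = proj_of (N *v kv (-1))"
proof -
  define B where "B = (\<lambda>u v. scalar_product u (M *v v))"
  have tr: "transpose M = M" using M by (simp add: nonsingular_conic_def)
  have Msym: "M $ i $ j = M $ j $ i" for i j
    using arg_cong[OF tr, of "\<lambda>A. A $ j $ i"] by (simp add: transpose_def)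
  have Bsym: "B u v = B v u" for u v
    unfolding B_def scalar_product_3 matrix_vector_mult_def
    by (simp add: sum_3 Msym[of 2 1] Msym[of 3 1] Msym[of 3 2] algebra_simps)
  have Badd: "B u (v + w) = B u v + B u w" for u v w
    by (simp add: B_def scalar_product_def matrix_vector_right_distrib distrib_left sum.distrib)
  have Bscale: "B u (c *s v) = c * B u v" for u v c
    by (simp add: B_def vec.scale scalar_product_scale)
  have Badd': "B (v + w) u = B v u + B w u" for u v w using Badd Bsym by metis
  have Bscale': "B (c *s v) u = c * B v u" for u v c using Bscale Bsym by metis
  have Bdiff: "B u (v - w) = B u v - B u w" "B (v - w) u = B v u - B w u" for u v w
    using Badd[of u v "(-1) *s w"] Badd'[of v "(-1) *s w" u] Bscale[of u "-1" w] Bscale'[of "-1" w u]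
    by simp_all
  have Minj: "v = 0" if "M *v v = 0" for v
  proof (rule ccontr)
    assume "v \<noteq> 0"
    moreover have "scalar_product v (M *v v) = 0" using that by (simp add: scalar_product_def)
    ultimately show False using M that unfolding nonsingular_conic_def by blast
  qed
  \<comment> \<open>Otherwise the conic would contain the line through both points:
    \<open>M *v u\<close> and \<open>M *v v\<close> would each be a multiple of
    \<open>cross3 u v\<close>, so \<open>M\<close> would have a kernel.\<close>
  have nz: "B u v \<noteq> 0"
    if uv: "B u u = 0" "B v v = 0" "cross3 u v \<noteq> 0" for u v
  proof
    assume "B u v = 0"
    then have "B v u = 0" by (subst Bsym)
    moreover have "scalar_product (M *v a) b = B b a" for a b
      unfolding B_def by (rule scalar_product_commute)
    ultimately have o: "scalar_product (M *v u) u = 0" "scalar_product (M *v u) v = 0"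
      "scalar_product (M *v v) u = 0" "scalar_product (M *v v) v = 0"
      using uv \<open>B u v = 0\<close> by simp_all
    obtain c where c: "M *v u = c *s cross3 u v"
      using orthogonal_to_both[OF o(1,2) uv(3)] by blast
    obtain d where d: "M *v v = d *s cross3 u v"
      using orthogonal_to_both[OF o(3,4) uv(3)] by blast
    note cd = c d
    have "M *v (d *s u - c *s v) = d *s (c *s cross3 u v) - c *s (d *s cross3 u v)"
      by (simp add: matrix_vector_mult_diff_distrib vec.scale cd)
    then have "d *s u - c *s v = 0" by (rule Minj[OF trans]) (simp add: vector_smult_assoc mult.commute)
    then have e: "d *s u = c *s v" by simp
    have nz: "u \<noteq> 0" "v \<noteq> 0" using uv(3) by (auto simp: vec3_eq_iff)
    have "c = 0"
    proof (rule ccontr)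
      assume "c \<noteq> 0"
      then have "v = (d / c) *s u" using e by (simp add: vec3_eq_iff field_simps)
      then show False using uv(3) by (auto simp: vec3_eq_iff)
    qed
    then have "M *v u = 0" using cd by simp
    then show False using Minj nz by blast
  qed
  define p q r where pqr: "p = homog P" "q = homog Q" "r = homog R"
  have B0: "B p p = 0" "B q q = 0" "B r r = 0"
    using on by (simp_all add: conic_def B_def pqr)
  have cross: "cross3 (homog S) (homog T) \<noteq> 0" if "S \<noteq> T" for S T :: "3 proj"
    using proj_of_eq_iff_cross3[of "homog S" "homog T"] that by (simp add: homog_props)
  define x y z where xyz: "x = B p q" "y = B p r" "z = B q r"
  have xyz0: "x \<noteq> 0" "y \<noteq> 0" "z \<noteq> 0"
    unfolding xyz using nz B0 cross ne pqr by metis+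
  \<comment> \<open>Solved from two requirements: \<open>n0\<close>, \<open>n0 + n1 + n2\<close> and
    \<open>n0 - n1 + n2\<close> are multiples of \<open>p\<close>, \<open>q\<close>,
    \<open>r\<close>, and the Gram matrix is the standard one up to \<kappa>. The two sums come out
    as \<open>(4 * y) *s q\<close> and \<open>(4 * x) *s r\<close>.\<close>
  define n0 n1 n2 where n: "n0 = z *s p" "n1 = (2 * y) *s q + (- 2 * x) *s r"
    "n2 = (- z) *s p + ((2 * y) *s q + (2 * x) *s r)"
  define \<kappa> where "\<kappa> = 4 * x * y * z"
  have \<kappa>: "\<kappa> \<noteq> 0" using xyz0 by (simp add: \<kappa>_def)
  have Bp: "B q p = x" "B r p = y" "B r q = z" "B p q = x" "B p r = y" "B q r = z"
    using Bsym xyz by auto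
  have Bn: "B n0 n0 = 0" "B n0 n1 = 0" "B n0 n2 = \<kappa>" "B n1 n1 = - 2 * \<kappa>" "B n1 n2 = 0" "B n2 n2 = 0"
    by (simp_all add: n Badd Badd' Bdiff Bscale Bscale' Bp B0 \<kappa>_def algebra_simps)
  define N :: "complex ^ 3 ^ 3" where
    "N = (\<chi> i j. if j = 1 then n0 $ i else if j = 2 then n1 $ i else n2 $ i)"
  have Nv: "N *v w = w$1 *s n0 + (w$2 *s n1 + w$3 *s n2)" for w
    by (simp add: vec3_eq_iff matrix_vector_mult_def sum_3 N_def)
  \<comment> \<open>The inverse consists of the dual basis for \<open>B\<close>: \<open>n0\<close>
    and \<open>n2\<close> pair to \<kappa>, while \<open>n1\<close> pairs with itself to
    \<open>- 2 * \<kappa>\<close>.\<close>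
  define Ni :: "complex ^ 3 ^ 3" where
    "Ni = vector [(1 / \<kappa>) *s (M *v n2), (- 1 / (2 * \<kappa>)) *s (M *v n1), (1 / \<kappa>) *s (M *v n0)]"
  have row: "(A *v v) $ i = scalar_product (A $ i) v" for A :: "complex ^ 3 ^ 3" and v i
    by (simp add: scalar_product_def matrix_vector_mult_def)
  have sneg: "scalar_product v (- w) = - scalar_product v w" for v w :: "complex ^ 3"
    by (simp add: scalar_product_3)
  have Niv: "(Ni *v v) $ 1 = B n2 v / \<kappa>" "(Ni *v v) $ 2 = - B n1 v / (2 * \<kappa>)" "(Ni *v v) $ 3 = B n0 v / \<kappa>" for v
    by (simp_all add: row Ni_def scalar_product_scale Bsym[of _ v])
      (simp_all add: B_def scalar_product_commute sneg scalar_product_scale)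
  have "(Ni ** N) *v w = w" for w
  proof -
    have "(Ni ** N) *v w = Ni *v (N *v w)" by (simp add: matrix_vector_mul_assoc)
    also have "\<dots> = w"
      using \<kappa> by (simp add: vec3_eq_iff Niv Nv Badd Bscale Bn Bsym[of n2 n0] Bsym[of n1 n0] Bsym[of n2 n1])
    finally show ?thesis .
  qed
  then have NiN: "Ni ** N = mat 1" by (rule matrix_eqI)
  then have NNi: "N ** Ni = mat 1" by (simp add: matrix_left_right_inverse)
  have "conic_frame M N Ni \<kappa>"
  proof
    fix v w
    have "scalar_product (N *v v) (M *v (N *v w)) = B (N *v v) (N *v w)" by (simp add: B_def)
    also have "\<dots> = \<kappa> * (v$1 * w$3 - 2 * (v$2 * w$2) + v$3 * w$1)"
      by (simp add: Nv Badd Badd' Bscale Bscale' Bn Bsym[of n2 n0] Bsym[of n1 n0] Bsym[of n2 n1] algebra_simps)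
    finally show "scalar_product (N *v v) (M *v (N *v w)) = \<kappa> * (v$1 * w$3 - 2 * (v$2 * w$2) + v$3 * w$1)" .
  qed (fact \<kappa> NiN NNi)+
  moreover have "N *v kv 0 = z *s p" "N *v kv 1 = (4 * y) *s q" "N *v kv (-1) = (4 * x) *s r"
    by (simp_all add: Nv n vec3_eq_iff algebra_simps)
  then have "P = proj_of (N *v kv 0)" "Q = proj_of (N *v kv 1)" "R = proj_of (N *v kv (-1))"
    using xyz0 by (simp_all add: proj_of_scale pqr homog_props)
  ultimately show ?thesis using that by blast
qed

subsection \<open>Hexads\<close>

lemma polydiagonals_block:
  assumes "h \<in> polydiagonals K T" "\<And>\<tau>. \<tau> \<in> T \<Longrightarrow> \<exists>m. m \<in># \<tau> \<and> n \<le> m"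
  obtains b where "n \<le> card b" "\<And>x y. x \<in> b \<Longrightarrow> y \<in> b \<Longrightarrow> h x = h y"
proof -
  obtain \<pi> where \<pi>: "h \<in> polydiagonal K \<pi>" "partition_type \<pi> \<in> T"
    using assms(1) unfolding polydiagonals_def by blast
  from assms(2)[OF \<pi>(2)] obtain b where "b \<in> \<pi>" "n \<le> card b"
    by (auto simp: partition_type_def)
  moreover have "h x = h y" if "x \<in> b" "y \<in> b" for x y
    using \<pi>(1) \<open>b \<in> \<pi>\<close> that unfolding polydiagonal_def by blast
  ultimately show ?thesis using that by metis
qed

lemma inj_not_polydiagonals:
  assumes "inj h" "\<And>\<tau>. \<tau> \<in> T \<Longrightarrow> \<exists>m. m \<in># \<tau> \<and> 2 \<le> m"
  shows "h \<notin> polydiagonals K T"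
proof
  assume "h \<in> polydiagonals K T"
  then obtain b where b: "2 \<le> card b" "\<And>x y. x \<in> b \<Longrightarrow> y \<in> b \<Longrightarrow> h x = h y"
    using polydiagonals_block assms(2) by blast
  then have "b \<subseteq> {x}" if "x \<in> b" for x using assms(1) that by (auto simp: inj_def)
  moreover obtain x where "x \<in> b" using b(1) by fastforce
  ultimately have "card b \<le> card {x}" by (intro card_mono) auto
  with b(1) show False by simp
qed

lemma inj_in_Hcirc: "inj h \<Longrightarrow> range h \<subseteq> K \<Longrightarrow> h \<in> Hcirc K"
  unfolding Hcirc_def hexads_def by (auto dest!: inj_not_polydiagonals[of h "{{#3, 2, 1#}, {#4, 1, 1#}}" K])

lemma inj_not_Zlocus: "inj h \<Longrightarrow> h \<notin> Zlocus K"
  unfolding Zlocus_def by (auto dest!: inj_not_polydiagonals[of h "{{#2, 2, 2#}}" K])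

lemma inj_not_Ylocus: "inj h \<Longrightarrow> h \<notin> Ylocus K"
  unfolding Ylocus_def
  by (auto dest!: inj_not_polydiagonals[of h "{{#2, 2, 1, 1#}, {#3, 1, 1, 1#}}" K])

text \<open>Both excluded partition types have a block of at least three letters.\<close>

lemma in_Hcirc_if_fibres_small:
  assumes "range h \<subseteq> K" "\<And>L. card {L'. h L' = h L} \<le> 2"
  shows "h \<in> Hcirc K"
proof -
  have "h \<notin> polydiagonals K {{#3, 2, 1#}, {#4, 1, 1#}}"
  proof
    assume "h \<in> polydiagonals K {{#3, 2, 1#}, {#4, 1, 1#}}"
    moreover have "\<exists>m. m \<in># \<tau> \<and> 3 \<le> m" if "\<tau> \<in> {{#3, 2, 1#}, {#4, 1, 1#}}" for \<tau> :: "nat multiset"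
      using that by auto
    ultimately obtain b where b: "3 \<le> card b" "\<And>x y. x \<in> b \<Longrightarrow> y \<in> b \<Longrightarrow> h x = h y"
      using polydiagonals_block[of h K "{{#3, 2, 1#}, {#4, 1, 1#}}" 3] by metis
    obtain x where "x \<in> b" using b(1) by fastforce
    then have "b \<subseteq> {L'. h L' = h x}" using b(2) by blast
    then have "card b \<le> card {L'. h L' = h x}" by (intro card_mono) auto
    with b(1) assms(2)[of x] show False by simp
  qed
  with assms(1) show ?thesis by (simp add: Hcirc_def hexads_def)
qed

lemma Hcirc_range: "h \<in> Hcirc K \<Longrightarrow> h L \<in> K"
  by (auto simp: Hcirc_def hexads_def)

lemma (in germs) par_germ:
  assumes "germ_map \<gamma>" "\<gamma> x0 L \<in> chart_dom Ni"
  shows "eventually (\<lambda>x. \<gamma> x L \<in> chart_dom Ni) F" "(\<lambda>x. par Ni (\<gamma> x L)) \<in> A"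
  using homog_ratio[OF germ_map_fun_apply[OF assms(1)]] assms(2)
  by (auto simp: chart_dom_def par_def)

lemma eventually_quadratic_nonzero:
  fixes d \<eta> \<epsilon> :: complex
  assumes "\<epsilon> \<noteq> 0"
  shows "eventually (\<lambda>t. d + t * \<eta> + t ^ 2 * \<epsilon> \<noteq> 0) (at 0)"
proof -
  have "finite {t. poly [:d, \<eta>, \<epsilon>:] t = 0}"
    using assms by (intro poly_roots_finite) simp
  then have "\<not> 0 islimpt {t. poly [:d, \<eta>, \<epsilon>:] t = 0}" by (rule islimpt_finite)
  then have "eventually (\<lambda>t. t \<notin> {t. poly [:d, \<eta>, \<epsilon>:] t = 0}) (at 0)"
    by (simp add: islimpt_iff_eventually)
  then show ?thesis by (simp add: algebra_simps power2_eq_square)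
qed

text \<open>Near \<open>y\<close> the map is given by generators without common zero, so the graph
  map is regular there and pulls basic domains back to neighbourhoods.\<close>

lemma graph_continuous:
  assumes g: "ideal_generator_map X Z g" and y: "y \<in> X" "eventually (\<lambda>z. z \<notin> Z) (zariski_nhds X y)"
    and D: "D \<in> fst ` rational_funs" "(y, g y) \<in> D"
  shows "eventually (\<lambda>z. (z, g z) \<in> D) (zariski_nhds X y)"
proof -
  interpret germs "zariski_nhds X y" "regular_at X y" y by (rule germs_zariski[OF y(1)])
  from g y(1) obtain U f where U: "openin (zariski_on X) U" "y \<in> U" "generates_ideal U Z f"
    and gf: "\<forall>z\<in>U - Z. g z = proj_of (\<chi> i. f i z)"
    unfolding ideal_generator_map_def by blast
  have "f i \<in> regular_at X y" for i
    using U by (intro regular_on_imp_regular_at[of U]) (auto simp: generates_ideal_def)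
  moreover have "\<exists>i. f i y \<noteq> 0" using no_common_zero[OF U(1,3,2) y(2)] .
  moreover have "eventually (\<lambda>z. g z = proj_of (\<chi> i. f i z)) (zariski_nhds X y)"
    using openin_zariski_on_nhds[OF U(1,2)] y(2) by eventually_elim (use gf in blast)
  ultimately have "germ_map g" by (rule germ_map_proj)
  then have gm: "germ_map (\<lambda>z. (z, g z))" by (intro germ_map_Pair germ_map_id_zariski y)
  obtain \<phi> where "(D, \<phi>) \<in> rational_funs" using D(1) by auto
  from germ_map_rational[OF gm this] D(2) show ?thesis by blast
qed

text \<open>Distinct weights for the letters, used as quadratic coefficients of the curves
  below.\<close>

fun letter_code :: "letter \<Rightarrow> complex" where
  "letter_code LA = 0" | "letter_code LB = 1" | "letter_code LC = 2"
| "letter_code LD = 3" | "letter_code LE = 4" | "letter_code LF = 5"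

lemma inj_letter_code: "inj letter_code"
  unfolding inj_def
proof (intro allI impI)
  fix L L' assume "letter_code L = letter_code L'"
  then show "L = L'" by (cases L; cases L') simp_all
qed

section \<open>The two blow-ups over hexads in the affine chart\<close>

locale hexad_blowup = conic_frame +
  fixes g1 :: "(letter \<Rightarrow> 3 proj) \<Rightarrow> 'n::finite proj"
    and g2 :: "(letter \<Rightarrow> 3 proj) \<times> 'n proj \<Rightarrow> 'm::finite proj"
    and H Z X' Y' X
  assumes H: "H = Hcirc (conic M)" and Z: "Z = Zlocus (conic M)"
    and g1: "ideal_generator_map H Z g1" and X': "X' = blowup H Z g1"
    and Y': "Y' = proper_transform X' Z (Ylocus (conic M))"
    and g2: "ideal_generator_map X' Y' g2" and X: "X = blowup X' Y' g2"
begin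

definition chart_hexads :: "(letter \<Rightarrow> 3 proj) set" where
  "chart_hexads = {h. \<forall>L. h L \<in> chart_dom Ni}"

lemma X'_sub: "X' \<subseteq> H \<times> UNIV"
  unfolding X' blowup_def
  using closure_of_subset_topspace[of "zariski_on (H \<times> UNIV)"] by simp

lemma X_sub: "X \<subseteq> X' \<times> UNIV"
  unfolding X blowup_def
  using closure_of_subset_topspace[of "zariski_on (X' \<times> UNIV)"] by simp

lemma H_conic: "h \<in> H \<Longrightarrow> h L \<in> conic M"
  unfolding H by (rule Hcirc_range)

lemma eventually_neq:
  assumes "h \<in> H" "h L \<in> chart_dom Ni" "h L' \<in> chart_dom Ni" "h L \<noteq> h L'"
  shows "eventually (\<lambda>h. h L \<noteq> h L') (zariski_nhds H h)"
proof -
  interpret germs "zariski_nhds H h" "regular_at H h" h by (rule germs_zariski) fact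
  have id: "germ_map (\<lambda>h. h)" by (rule germ_map_id_zariski) fact
  have "(\<lambda>h. par Ni (h L) - par Ni (h L')) \<in> regular_at H h"
    by (intro diff par_germ id assms)
  moreover have "par Ni (h L) \<noteq> par Ni (h L')"
    using chart[OF H_conic[OF assms(1)] assms(2)] chart[OF H_conic[OF assms(1)] assms(3)] assms(4) by metis
  ultimately have "eventually (\<lambda>h. par Ni (h L) - par Ni (h L') \<noteq> 0) (zariski_nhds H h)"
    using nonzero[of "\<lambda>h. par Ni (h L) - par Ni (h L')"] by simp
  then show ?thesis by eventually_elim auto
qed

lemma eventually_inj:
  assumes "h \<in> H" "h \<in> chart_hexads" "inj h"
  shows "eventually inj (zariski_nhds H h)"
proof -
  have "eventually (\<lambda>h. \<forall>L L'. L \<noteq> L' \<longrightarrow> h L \<noteq> h L') (zariski_nhds H h)"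
  proof (intro eventually_all_finite)
    fix L L'
    show "eventually (\<lambda>h. L \<noteq> L' \<longrightarrow> h L \<noteq> h L') (zariski_nhds H h)"
      using eventually_neq[of h L L'] assms by (cases "L = L'") (auto simp: chart_hexads_def inj_def)
  qed
  then show ?thesis by eventually_elim (auto simp: inj_def)
qed

text \<open>There are finitely many polydiagonals of this type, and each is avoided by an inequality
  between two letters of one block, which is an open condition.\<close>

lemma eventually_not_Z:
  assumes "h \<in> H" "h \<in> chart_hexads" "h \<notin> Z"
  shows "eventually (\<lambda>h. h \<notin> Z) (zariski_nhds H h)"
proof -
  have hex: "h \<in> hexads (conic M)" using assms(1) by (simp add: H Hcirc_def)
  let ?\<Pi> = "{\<pi>. partition_on UNIV \<pi> \<and> partition_type \<pi> \<in> {{#2, 2, 2#}}}"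
  have "eventually (\<lambda>h. \<forall>\<pi>\<in>?\<Pi>. h \<notin> polydiagonal (conic M) \<pi>) (zariski_nhds H h)"
  proof (intro eventually_ball_finite ballI)
    fix \<pi> assume \<pi>: "\<pi> \<in> ?\<Pi>"
    then have "h \<notin> polydiagonal (conic M) \<pi>"
      using assms by (auto simp: Z Zlocus_def H polydiagonals_def)
    then obtain b L L' where b: "b \<in> \<pi>" "L \<in> b" "L' \<in> b" "h L \<noteq> h L'"
      using hex by (auto simp: polydiagonal_def)
    have "eventually (\<lambda>h. h L \<noteq> h L') (zariski_nhds H h)"
      using assms b by (intro eventually_neq) (auto simp: chart_hexads_def)
    then show "eventually (\<lambda>h. h \<notin> polydiagonal (conic M) \<pi>) (zariski_nhds H h)"
      by eventually_elim (use b in \<open>auto simp: polydiagonal_def\<close>)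
  qed simp
  then show ?thesis
    by eventually_elim (auto simp: Z Zlocus_def polydiagonals_def)
qed

text \<open>\<open>Y'\<close> is a closure, so injectivity of the hexad under a point
  \<open>y\<close> alone does not exclude \<open>y\<close>; injectivity throughout a neighbourhood
  of \<open>y\<close> does. Hence the nested \<open>eventually\<close>.\<close>

lemma eventually_not_Y':
  assumes "x \<in> X'" "fst x \<in> chart_hexads" "inj (fst x)"
  shows "eventually (\<lambda>y. y \<notin> Y') (zariski_nhds X' x)"
proof -
  interpret germs "zariski_nhds X' x" "regular_at X' x" x by (rule germs_zariski) fact
  have fst: "germ_map fst" using germ_map_fst[OF germ_map_id_zariski[OF assms(1)]] by simp
  have "eventually inj (zariski_nhds H (fst x))"
    using assms X'_sub by (intro eventually_inj) auto
  then have "eventually (\<lambda>y. inj (fst y)) (zariski_nhds X' x)"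
    by (rule germ_map_nhds[OF fst])
      (use eventually_zariski_nhds_in X'_sub in \<open>fastforce elim: eventually_mono\<close>)
  then have "eventually (\<lambda>y. eventually (\<lambda>y. inj (fst y)) (zariski_nhds X' y)) (zariski_nhds X' x)"
    by (rule eventually_eventually_zariski_nhds)
  then show ?thesis
  proof eventually_elim
    case (elim y)
    let ?S = "{x \<in> X'. fst x \<in> Ylocus (conic M) - Z}"
    from elim have "eventually (\<lambda>y. y \<notin> ?S) (zariski_nhds X' y)"
      by eventually_elim (auto dest: inj_not_Ylocus)
    then show "y \<notin> Y'"
      unfolding Y' proper_transform_def using in_closure_of_zariski_on[of ?S X' y]
      by (auto simp: frequently_def)
  qed
qed

text \<open>The quadratic term makes the curve consist of injective hexads even where \<open>h\<close> and the direction
  \<open>\<xi>\<close> agree on two letters.\<close>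

definition hexad_curve :: "(letter \<Rightarrow> 3 proj) \<Rightarrow> (letter \<Rightarrow> complex) \<Rightarrow> (letter \<Rightarrow> complex) \<Rightarrow> complex \<Rightarrow> letter \<Rightarrow> 3 proj" where
  "hexad_curve h \<xi> \<theta> t = (\<lambda>L. pt (kv (par Ni (h L) + t * \<xi> L + t ^ 2 * \<theta> L)))"

lemma hexad_curve:
  assumes h: "h \<in> H" "h \<in> chart_hexads" and \<theta>: "inj \<theta>"
  shows "analytic_curve (hexad_curve h \<xi> \<theta>)" "hexad_curve h \<xi> \<theta> 0 = h"
    "eventually (\<lambda>t. inj (hexad_curve h \<xi> \<theta> t)) (at 0)"
    "eventually (\<lambda>t. hexad_curve h \<xi> \<theta> t \<in> H) (nhds 0)"
    "hexad_curve h \<xi> \<theta> t \<in> chart_hexads"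
proof -
  define u where "u = (\<lambda>L t. par Ni (h L) + t * \<xi> L + t ^ 2 * \<theta> L)"
  have c: "hexad_curve h \<xi> \<theta> t = (\<lambda>L. pt (kv (u L t)))" for t
    by (simp add: hexad_curve_def u_def)
  show c0: "hexad_curve h \<xi> \<theta> 0 = h"
    unfolding c using h by (intro ext) (simp add: u_def chart_hexads_def flip: chart[OF H_conic])
  have an: "(\<lambda>t. (N *v kv (u L t)) $ i) analytic_on {0}" for L i
    by (simp add: matrix_vector_mult_def sum_3 u_def) (intro analytic_intros)
  show "analytic_curve (hexad_curve h \<xi> \<theta>)"
  proof (rule analytic_germs.germ_map_fun)
    fix L
    show "analytic_curve (\<lambda>t. hexad_curve h \<xi> \<theta> t L)"
    proof (rule analytic_germs.germ_map_proj)
      show "\<exists>i. (N *v kv (u L 0)) $ i \<noteq> 0"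
        by (metis N_eq_0_iff(1) kv_nonzero vec_eq_iff zero_index)
      show "eventually (\<lambda>t. hexad_curve h \<xi> \<theta> t L = proj_of (\<chi> i. (N *v kv (u L t)) $ i)) (nhds 0)"
        by (simp add: c pt_def)
    qed (use an in simp)
  qed
  have "eventually (\<lambda>t. \<forall>L L'. L \<noteq> L' \<longrightarrow> u L t \<noteq> u L' t) (at 0)"
  proof (intro eventually_all_finite)
    fix L L'
    show "eventually (\<lambda>t. L \<noteq> L' \<longrightarrow> u L t \<noteq> u L' t) (at 0)"
    proof (cases "L = L'")
      case False
      \<comment> \<open>The difference of the two parameters is quadratic in \<open>t\<close> with
        this leading coefficient, so it has only finitely many zeros.\<close>
      then have "\<theta> L - \<theta> L' \<noteq> 0" using \<theta> by (auto simp: inj_def)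
      from eventually_quadratic_nonzero[OF this, of "par Ni (h L) - par Ni (h L')" "\<xi> L - \<xi> L'"]
      show ?thesis by eventually_elim (auto simp: u_def algebra_simps)
    qed simp
  qed
  then show inj: "eventually (\<lambda>t. inj (hexad_curve h \<xi> \<theta> t)) (at 0)"
    by eventually_elim (auto simp: inj_def c)
  have "hexad_curve h \<xi> \<theta> t \<in> H" if "inj (hexad_curve h \<xi> \<theta> t)" for t
    unfolding H using that by (intro inj_in_Hcirc) (auto simp: c)
  with inj have "eventually (\<lambda>t. hexad_curve h \<xi> \<theta> t \<in> H) (at 0)"
    by (auto elim: eventually_mono)
  then show "eventually (\<lambda>t. hexad_curve h \<xi> \<theta> t \<in> H) (nhds 0)"
    using h by (simp add: eventually_nhds_conv_at c0)
  show "hexad_curve h \<xi> \<theta> t \<in> chart_hexads" by (simp add: chart_hexads_def c)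
qed

text \<open>For small nonzero \<open>t\<close> the hexads are injective, hence have neighbourhoods
  free of both blow-up centres, and \<open>lift_curve\<close> applies once to each blow-up.\<close>

lemma lift_hexad_curve:
  assumes h: "h \<in> H" "h \<in> chart_hexads" and \<theta>: "inj \<theta>"
  obtains c where "analytic_curve c" "eventually (\<lambda>t. c t \<in> X) (nhds 0)"
    "\<And>t. fst (fst (c t)) = hexad_curve h \<xi> \<theta> t"
proof -
  let ?c = "hexad_curve h \<xi> \<theta>"
  note hc = hexad_curve[OF h \<theta>, of \<xi>]
  have "eventually (\<lambda>t. ?c t \<in> H) (at 0)" using hc(4) by (simp add: eventually_nhds_conv_at)
  with hc(3) have notZ: "eventually (\<lambda>t. eventually (\<lambda>h. h \<notin> Z) (zariski_nhds H (?c t))) (at 0)"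
  proof eventually_elim
    case (elim t)
    then have "eventually inj (zariski_nhds H (?c t))" using hc(5) by (intro eventually_inj)
    then show ?case by eventually_elim (simp add: Z inj_not_Zlocus)
  qed
  obtain c1 where c1: "analytic_curve c1" "eventually (\<lambda>t. c1 t \<in> X') (nhds 0)" "\<And>t. fst (c1 t) = ?c t"
    using lift_curve[OF g1 hc(1,4) notZ] unfolding X' by blast
  have "eventually (\<lambda>t. c1 t \<in> X') (at 0)" using c1(2) by (simp add: eventually_nhds_conv_at)
  with hc(3) have notY: "eventually (\<lambda>t. eventually (\<lambda>y. y \<notin> Y') (zariski_nhds X' (c1 t))) (at 0)"
    by eventually_elim (use hc(5) c1(3) eventually_not_Y' in simp)
  obtain c2 where "analytic_curve c2" "eventually (\<lambda>t. c2 t \<in> X) (nhds 0)" "\<And>t. fst (c2 t) = c1 t"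
    using lift_curve[OF g2 c1(1,2) notY] unfolding X by blast
  with c1(3) show ?thesis using that by simp
qed

text \<open>Three approximations, each within the open set left by the previous one: to a point of
  the second graph, to a point of the first graph, and along a curve to an injective hexad.\<close>

lemma dense_injective:
  assumes x: "x \<in> X" "fst (fst x) \<in> chart_hexads" and P: "eventually P (zariski_nhds X x)"
  shows "\<exists>y\<in>X. P y \<and> inj (fst (fst y))"
proof -
  let ?G1 = "{(h, g1 h) | h. h \<in> H - Z}" and ?G2 = "{(x, g2 x) | x. x \<in> X' - Y'}"
  have sub: "?G1 \<subseteq> H \<times> UNIV" "?G2 \<subseteq> X' \<times> UNIV" by auto
  have G1: "?G1 \<subseteq> X'"
    unfolding X' blowup_def using closure_of_subset[of ?G1 "zariski_on (H \<times> UNIV)"] sub(1) by simp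
  have G2: "?G2 \<subseteq> X"
    unfolding X blowup_def using closure_of_subset[of ?G2 "zariski_on (X' \<times> UNIV)"] sub(2) by simp
  \<comment> \<open>Membership in the chart is joined to \<open>P\<close>, because the hexad reached
    later differs from the given one and still has to have parameters.\<close>
  have "eventually (\<lambda>y. fst (fst y) \<in> chart_hexads) (zariski_nhds X x)"
  proof -
    interpret germs "zariski_nhds X x" "regular_at X x" x by (rule germs_zariski) fact
    have "germ_map (\<lambda>y. fst (fst y))"
      by (intro germ_map_fst germ_map_id_zariski x)
    from par_germ(1)[OF this] x(2) show ?thesis
      by (simp add: chart_hexads_def eventually_all_finite)
  qed
  with P have "eventually (\<lambda>y. P y \<and> fst (fst y) \<in> chart_hexads) (zariski_nhds X x)"
    by (rule eventually_conj)
  then obtain D where D: "D \<in> fst ` rational_funs" "x \<in> D"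
    "\<forall>y\<in>X \<inter> D. P y \<and> fst (fst y) \<in> chart_hexads"
    unfolding eventually_zariski_nhds by (elim bexE conjE)
  have "\<exists>\<^sub>F y in zariski_nhds (X' \<times> UNIV) x. y \<in> ?G2"
    using x(1) unfolding X blowup_def in_closure_of_zariski_on[OF sub(2)] by simp
  then have "\<exists>\<^sub>F y in zariski_nhds (X' \<times> UNIV) x. y \<in> D \<and> y \<in> ?G2"
    using eventually_zariski_nhds_dom[OF D(1,2)] by (rule frequently_eventually_conj)
  then obtain y where y: "y \<in> X'" "y \<notin> Y'" "(y, g2 y) \<in> D"
    by (auto dest!: frequently_ex)
  have "closedin (zariski_on X') Y'" unfolding Y' proper_transform_def by simp
  then have "openin (zariski_on X') (X' - Y')" by (simp add: closedin_def)
  from openin_zariski_on_nhds[OF this] have nY: "eventually (\<lambda>z. z \<notin> Y') (zariski_nhds X' y)"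
    using y(1,2) by (simp add: eventually_conj_iff)
  from graph_continuous[OF g2 y(1) nY D(1) y(3)] nY
  have "eventually (\<lambda>z. (z, g2 z) \<in> D \<and> z \<notin> Y') (zariski_nhds X' y)"
    by (rule eventually_conj)
  then obtain D' where D': "D' \<in> fst ` rational_funs" "y \<in> D'" "\<forall>z\<in>X' \<inter> D'. (z, g2 z) \<in> D \<and> z \<notin> Y'"
    unfolding eventually_zariski_nhds by (elim bexE conjE)
  have "\<exists>\<^sub>F z in zariski_nhds (H \<times> UNIV) y. z \<in> ?G1"
    using y(1) unfolding X' blowup_def in_closure_of_zariski_on[OF sub(1)] by simp
  then have "\<exists>\<^sub>F z in zariski_nhds (H \<times> UNIV) y. z \<in> D' \<and> z \<in> ?G1"
    using eventually_zariski_nhds_dom[OF D'(1,2)] by (rule frequently_eventually_conj)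
  then obtain h where h: "h \<in> H" "h \<notin> Z" "(h, g1 h) \<in> D'"
    by (auto dest!: frequently_ex)
  \<comment> \<open>\<open>D'\<close> is chosen such that lifting through both graphs ends in
    \<open>D\<close>. This applies to every such hexad, so also to the injective one found at the
    end.\<close>
  have good: "((h, g1 h), g2 (h, g1 h)) \<in> X \<and> P ((h, g1 h), g2 (h, g1 h)) \<and> h \<in> chart_hexads"
    if "h \<in> H" "h \<notin> Z" "(h, g1 h) \<in> D'" for h
  proof -
    have "(h, g1 h) \<in> X'" using G1 that by auto
    with that(3) D'(3) have "((h, g1 h), g2 (h, g1 h)) \<in> D" "(h, g1 h) \<notin> Y'" by blast+
    moreover from this(2) \<open>(h, g1 h) \<in> X'\<close> have "((h, g1 h), g2 (h, g1 h)) \<in> X" using G2 by blast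
    ultimately show ?thesis using D(3)[rule_format, of "((h, g1 h), g2 (h, g1 h))"] by simp
  qed
  have hch: "h \<in> chart_hexads" using good[OF h] by blast
  have near: "eventually (\<lambda>h. (h, g1 h) \<in> D') (zariski_nhds H h)"
    by (intro graph_continuous[OF g1] eventually_not_Z h hch D')
  \<comment> \<open>With zero direction, the quadratic term alone separates the letters.\<close>
  note hc = hexad_curve[OF h(1) hch inj_letter_code, of "\<lambda>_. 0"]
  have "eventually (\<lambda>t. (hexad_curve h (\<lambda>_. 0) letter_code t, g1 (hexad_curve h (\<lambda>_. 0) letter_code t)) \<in> D') (nhds 0)"
    by (rule analytic_germs.germ_map_nhds[OF hc(1) _ hc(4)]) (simp add: hc(2) near)
  then have "eventually (\<lambda>t. (hexad_curve h (\<lambda>_. 0) letter_code t, g1 (hexad_curve h (\<lambda>_. 0) letter_code t)) \<in> D') (at 0)"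
    "eventually (\<lambda>t. hexad_curve h (\<lambda>_. 0) letter_code t \<in> H) (at 0)"
    using hc(4) by (simp_all add: eventually_nhds_conv_at)
  with hc(3) have "eventually (\<lambda>t. \<exists>h\<in>H. inj h \<and> (h, g1 h) \<in> D') (at (0::complex))"
    by eventually_elim blast
  then obtain k where k: "k \<in> H" "inj k" "(k, g1 k) \<in> D'"
    using eventually_happens'[OF at_neq_bot] by blast
  then have "k \<notin> Z" by (simp add: Z inj_not_Zlocus)
  from good[OF k(1) this k(3)] k(2) show ?thesis by force
qed

end

section \<open>Values of the extended Pascal maps on a fibre\<close>

lemma isCont_eventually_zero:
  fixes f :: "complex \<Rightarrow> complex"
  assumes "isCont f 0" "eventually (\<lambda>t. f t = 0) (at 0)"
  shows "f 0 = 0"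
proof -
  have "f \<midarrow>0\<rightarrow> f 0" using assms(1) by (simp add: isCont_def)
  from LIM_const_eq[OF Lim_transform_eventually[OF this assms(2)]] show ?thesis by simp
qed

definition pasc_at :: "(2 \<Rightarrow> 3 \<Rightarrow> letter) \<Rightarrow> (letter \<Rightarrow> complex) \<Rightarrow> complex ^ 3" where
  "pasc_at a z = pasc (\<lambda>j. z (a 0 j)) (\<lambda>j. z (a 1 j))"

context hexad_blowup
begin

abbreviation params :: "(letter \<Rightarrow> 3 proj) \<Rightarrow> letter \<Rightarrow> complex" where
  "params h L \<equiv> par Ni (h L)"

lemma chart_hexad_eq:
  assumes "h \<in> H" "h \<in> chart_hexads"
  shows "h = (\<lambda>L. pt (kv (params h L)))"
proof
  fix L
  show "h L = pt (kv (params h L))"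
    using chart[OF H_conic[OF assms(1)]] assms(2) by (simp add: chart_hexads_def)
qed

lemma pascal_line_chart:
  assumes "h \<in> H" "h \<in> chart_hexads" "inj h" "a \<in> pascal_arrays"
  shows "pascal_line (array_equiv `` {a}) h = lin (pasc_at a (params h))"
    and "pasc_at a (params h) \<noteq> 0"
proof -
  note h = chart_hexad_eq[OF assms(1,2)]
  have "inj (params h)"
  proof (rule injI)
    fix L L' assume "params h L = params h L'"
    then have "h L = h L'" using fun_cong[OF h, of L] fun_cong[OF h, of L'] by simp
    then show "L = L'" using assms(3) by (simp add: inj_eq)
  qed
  from pascal_line_eq[OF assms(4) this] h
  show "pascal_line (array_equiv `` {a}) h = lin (pasc_at a (params h))" "pasc_at a (params h) \<noteq> 0"
    by (simp_all add: pasc_at_def)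
qed

lemma X_H: "x \<in> X \<Longrightarrow> fst (fst x) \<in> H"
  using subsetD[OF X_sub, of x] subsetD[OF X'_sub, of "fst x"] by (simp add: mem_Times_iff)

text \<open>A regular function that is nonzero at \<open>x\<close> remains so on a neighbourhood,
  and this neighbourhood meets the points over injective hexads.\<close>

lemma zero_by_density:
  assumes "x \<in> X" "fst (fst x) \<in> chart_hexads" "\<phi> \<in> regular_at X x"
    and "eventually (\<lambda>y. inj (fst (fst y)) \<longrightarrow> \<phi> y = 0) (zariski_nhds X x)"
  shows "\<phi> x = 0"
proof (rule ccontr)
  interpret germs "zariski_nhds X x" "regular_at X x" x by (rule germs_zariski) fact
  assume "\<phi> x \<noteq> 0"
  then have "eventually (\<lambda>y. \<phi> y \<noteq> 0) (zariski_nhds X x)" by (rule nonzero[OF assms(3)])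
  with assms(4) have "eventually (\<lambda>y. \<not> inj (fst (fst y))) (zariski_nhds X x)"
    by eventually_elim blast
  then show False using dense_injective[OF assms(1,2)] by blast
qed

lemma params_regular:
  assumes "x \<in> X" "fst (fst x) \<in> chart_hexads"
  shows "(\<lambda>y. params (fst (fst y)) L) \<in> regular_at X x"
    and "eventually (\<lambda>y. fst (fst y) \<in> chart_hexads) (zariski_nhds X x)"
proof -
  interpret germs "zariski_nhds X x" "regular_at X x" x by (rule germs_zariski) fact
  have gm: "germ_map (\<lambda>y. fst (fst y))"
    by (intro germ_map_fst germ_map_id_zariski assms)
  show "(\<lambda>y. params (fst (fst y)) L) \<in> regular_at X x"
    "eventually (\<lambda>y. fst (fst y) \<in> chart_hexads) (zariski_nhds X x)"
    using par_germ[OF gm] assms(2) by (simp_all add: chart_hexads_def eventually_all_finite)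
qed

lemma regular_map_coords:
  assumes "regular_map X q" "x \<in> X"
  obtains U G where "openin (zariski_on X) U" "x \<in> U" "\<And>i. (\<lambda>y. G y $ i) \<in> regular_at X x"
    "\<And>y. y \<in> U \<Longrightarrow> G y \<noteq> 0 \<and> q y = lin (G y)"
proof -
  interpret germs "zariski_nhds X x" "regular_at X x" x by (rule germs_zariski) fact
  from assms obtain U f where U: "openin (zariski_on X) U" "x \<in> U" "\<forall>i. regular_on U (f i)"
    "\<forall>y\<in>U. (\<chi> i. f i y) \<noteq> 0 \<and> q y = proj_of (\<chi> i. f i y)"
    unfolding regular_map_def by blast
  have f: "f i \<in> regular_at X x" for i using U by (intro regular_on_imp_regular_at[of U]) auto
  define G where "G = (\<lambda>y. (\<chi> i. f i y) v* N)"
  have "(\<lambda>y. G y $ i) \<in> regular_at X x" for i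
    unfolding G_def vector_matrix_mult_def by (simp, intro sum mult const f)
  moreover have "G y \<noteq> 0 \<and> q y = lin (G y)" if "y \<in> U" for y
  proof -
    have "(\<chi> i. f i y) = G y v* Ni" by (simp add: G_def)
    then show ?thesis using U(4) that by (metis lin_def N_eq_0_iff(2))
  qed
  ultimately show ?thesis using that U(1,2) by blast
qed

text \<open>Proportionality is stated with \<open>G\<close> as the multiple, since \<open>G\<close>
  has no zero near \<open>x\<close> while the Pascal form may vanish at \<open>x\<close>; no
  regularity of the factor \<open>c\<close> is claimed.\<close>

lemma extension_near:
  assumes x: "x \<in> X" "fst (fst x) \<in> chart_hexads" and a: "a \<in> pascal_arrays"
    and q: "extends_pascal X (fst \<circ> fst) (array_equiv `` {a}) q"
  obtains G where "\<And>i. (\<lambda>y. G y $ i) \<in> regular_at X x" "G x \<noteq> 0" "q x = lin (G x)"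
    "eventually (\<lambda>y. inj (fst (fst y)) \<longrightarrow> (\<exists>c. G y = c *s pasc_at a (params (fst (fst y))))) (zariski_nhds X x)"
proof -
  obtain U G where U: "openin (zariski_on X) U" "x \<in> U" "\<And>i. (\<lambda>y. G y $ i) \<in> regular_at X x"
    "\<And>y. y \<in> U \<Longrightarrow> G y \<noteq> 0 \<and> q y = lin (G y)"
    using regular_map_coords[OF _ x(1)] q unfolding extends_pascal_def by blast
  have "eventually (\<lambda>y. inj (fst (fst y)) \<longrightarrow> (\<exists>c. G y = c *s pasc_at a (params (fst (fst y))))) (zariski_nhds X x)"
    using openin_zariski_on_nhds[OF U(1,2)] params_regular(2)[OF x] eventually_zariski_nhds_in
  proof (eventually_elim, intro impI)
    fix y assume y: "y \<in> U" "fst (fst y) \<in> chart_hexads" "y \<in> X" "inj (fst (fst y))"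
    note p = pascal_line_chart[OF X_H[OF y(3)] y(2,4) a]
    have "q y = lin (pasc_at a (params (fst (fst y))))"
      using q y p(1) by (simp add: extends_pascal_def)
    then have "cross3 (G y) (pasc_at a (params (fst (fst y)))) = 0"
      using U(4)[OF y(1)] p(2) by (simp add: lin_eq_iff)
    then show "\<exists>c. G y = c *s pasc_at a (params (fst (fst y)))"
      using p(2) by (simp add: cross3_eq_0_iff)
  qed
  with U(2-4) that show ?thesis by blast
qed

lemma pasc_at_regular:
  assumes "x \<in> X" "fst (fst x) \<in> chart_hexads"
  shows "(\<lambda>y. pasc_at a (params (fst (fst y))) $ i) \<in> regular_at X x"
proof -
  interpret germs "zariski_nhds X x" "regular_at X x" x by (rule germs_zariski) fact
  show ?thesis
    using exhaust_3[of i]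
    by (elim disjE) (simp_all only: pasc_at_def pasc_nth pasc_defs, (intro intros params_regular(1)[OF assms])+)
qed

text \<open>Proportionality is the vanishing of a cross product, whose entries are regular; it
  therefore persists at \<open>x\<close>, where a nonzero Pascal form fixes the line.\<close>

lemma extension_value:
  assumes x: "x \<in> X" "fst (fst x) \<in> chart_hexads" and a: "a \<in> pascal_arrays"
    and q: "extends_pascal X (fst \<circ> fst) (array_equiv `` {a}) q"
    and nz: "pasc_at a (params (fst (fst x))) \<noteq> 0"
  shows "q x = lin (pasc_at a (params (fst (fst x))))"
proof -
  interpret germs "zariski_nhds X x" "regular_at X x" x by (rule germs_zariski) fact
  obtain G where G: "\<And>i. (\<lambda>y. G y $ i) \<in> regular_at X x" "G x \<noteq> 0" "q x = lin (G x)"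
    "eventually (\<lambda>y. inj (fst (fst y)) \<longrightarrow> (\<exists>c. G y = c *s pasc_at a (params (fst (fst y))))) (zariski_nhds X x)"
    using extension_near[OF x a q] by blast
  define C where "C = (\<lambda>y. cross3 (G y) (pasc_at a (params (fst (fst y)))))"
  have "C x $ i = 0" for i
  proof (rule zero_by_density[OF x, of "\<lambda>y. C y $ i"])
    show "(\<lambda>y. C y $ i) \<in> regular_at X x"
      using exhaust_3[of i] unfolding C_def
      by (elim disjE) (simp_all only: cross3_nth, (intro diff mult G(1) pasc_at_regular[OF x])+)
    show "eventually (\<lambda>y. inj (fst (fst y)) \<longrightarrow> C y $ i = 0) (zariski_nhds X x)"
      using G(4)
    proof (eventually_elim, intro impI)
      fix y
      assume "inj (fst (fst y)) \<longrightarrow> (\<exists>c. G y = c *s pasc_at a (params (fst (fst y))))" "inj (fst (fst y))"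
      then obtain c where "G y = c *s pasc_at a (params (fst (fst y)))" by blast
      then have "C y = 0" by (simp add: C_def vec3_eq_iff)
      then show "C y $ i = 0" by simp
    qed
  qed
  then have "C x = 0" by (simp add: vec_eq_iff)
  then show ?thesis using G(2,3) nz by (simp add: C_def lin_eq_iff)
qed

text \<open>\<open>D\<close> is a moving point incident with every Pascal line of the symbol; its
  incidence with the extended line follows by density wherever it is nonzero.\<close>

lemma extension_on_point:
  assumes x: "x \<in> X" "fst (fst x) \<in> chart_hexads" and a: "a \<in> pascal_arrays"
    and q: "extends_pascal X (fst \<circ> fst) (array_equiv `` {a}) q"
    and D: "\<And>i. (\<lambda>y. D (params (fst (fst y))) $ i) \<in> regular_at X x"
      "\<And>z. scalar_product (pasc_at a z) (D z) = 0" "D (params (fst (fst x))) \<noteq> 0"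
  shows "on_line (pt (D (params (fst (fst x))))) (q x)"
proof -
  interpret germs "zariski_nhds X x" "regular_at X x" x by (rule germs_zariski) fact
  obtain G where G: "\<And>i. (\<lambda>y. G y $ i) \<in> regular_at X x" "G x \<noteq> 0" "q x = lin (G x)"
    "eventually (\<lambda>y. inj (fst (fst y)) \<longrightarrow> (\<exists>c. G y = c *s pasc_at a (params (fst (fst y))))) (zariski_nhds X x)"
    using extension_near[OF x a q] by blast
  have "scalar_product (G x) (D (params (fst (fst x)))) = 0"
  proof (rule zero_by_density[OF x, of "\<lambda>y. scalar_product (G y) (D (params (fst (fst y))))"])
    show "(\<lambda>y. scalar_product (G y) (D (params (fst (fst y))))) \<in> regular_at X x"
      unfolding scalar_product_def by (intro sum mult G D)
    show "eventually (\<lambda>y. inj (fst (fst y)) \<longrightarrow> scalar_product (G y) (D (params (fst (fst y)))) = 0) (zariski_nhds X x)"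
      using G(4) by eventually_elim (auto simp: scalar_product_scale D(2))
  qed
  then show ?thesis using G(2,3) D(3) by (simp add: on_line_iff)
qed

text \<open>\<open>m\<close> is the Pascal form along the curve with its power of \<open>t\<close>
  removed, so \<open>lin (m 0)\<close> is the limit line; the point \<open>x\<close> is the value at
  0 of the lifted curve.\<close>

lemma extension_along_curve:
  assumes h: "h \<in> H" "h \<in> chart_hexads" and a: "a \<in> pascal_arrays"
    and q: "extends_pascal X (fst \<circ> fst) (array_equiv `` {a}) q"
    and m: "\<And>i. isCont (\<lambda>t. m t $ i) 0" "m 0 \<noteq> 0"
      "\<And>t. pasc_at a (\<lambda>L. params h L + t * \<xi> L + t ^ 2 * letter_code L) = t ^ k *s m t"
  shows "\<exists>x\<in>X. fst (fst x) = h \<and> q x = lin (m 0)"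
proof -
  note hc = hexad_curve[OF h inj_letter_code, of \<xi>]
  obtain c where c: "analytic_curve c" "eventually (\<lambda>t. c t \<in> X) (nhds 0)"
    "\<And>t. fst (fst (c t)) = hexad_curve h \<xi> letter_code t"
    using lift_hexad_curve[OF h inj_letter_code] by blast
  have c0: "c 0 \<in> X" using c(2) by (rule eventually_nhds_x_imp_x)
  obtain U G where U: "openin (zariski_on X) U" "c 0 \<in> U" "\<And>i. (\<lambda>y. G y $ i) \<in> regular_at X (c 0)"
    "\<And>y. y \<in> U \<Longrightarrow> G y \<noteq> 0 \<and> q y = lin (G y)"
    using regular_map_coords[OF _ c0] q unfolding extends_pascal_def by blast
  have cont: "isCont (\<lambda>t. G (c t) $ i) 0" for i
    using analytic_germs.germ_map_regular[OF c(1) U(3) c(2)] analytic_at_imp_isCont by simp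
  have "eventually (\<lambda>t. c t \<in> U) (nhds 0)"
    by (rule analytic_germs.germ_map_nhds[OF c(1) openin_zariski_on_nhds[OF U(1,2)] c(2)])
  then have "eventually (\<lambda>t. c t \<in> U) (at 0)" "eventually (\<lambda>t. c t \<in> X) (at 0)"
    using c(2) by (simp_all add: eventually_nhds_conv_at)
  with hc(3) have ev: "eventually (\<lambda>t. cross3 (G (c t)) (m t) = 0) (at 0)"
  proof eventually_elim
    case (elim t)
    let ?h = "hexad_curve h \<xi> letter_code t"
    have "?h \<in> H" using X_H[OF elim(3)] c(3) by simp
    note p = pascal_line_chart[OF this hc(5) elim(1) a]
    have "params ?h = (\<lambda>L. params h L + t * \<xi> L + t ^ 2 * letter_code L)"
      by (simp add: hexad_curve_def)
    then have pm: "pasc_at a (params ?h) = t ^ k *s m t" using m(3) by simp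
    have "q (c t) = pascal_line (array_equiv `` {a}) ?h"
      using q elim c(3) by (simp add: extends_pascal_def)
    then have "cross3 (G (c t)) (t ^ k *s m t) = 0"
      using U(4)[OF elim(2)] p by (simp add: lin_eq_iff flip: pm)
    \<comment> \<open>The power can be cancelled because the Pascal form of an injective hexad is
      nonzero.\<close>
    moreover have "t ^ k \<noteq> 0" using p(2) pm by auto
    ultimately show ?case by (auto simp: vec3_eq_iff)
  qed
  have "cross3 (G (c 0)) (m 0) $ i = 0" for i
  proof (rule isCont_eventually_zero[of "\<lambda>t. cross3 (G (c t)) (m t) $ i"])
    show "isCont (\<lambda>t. cross3 (G (c t)) (m t) $ i) 0"
      using exhaust_3[of i] by (elim disjE) (simp_all, (intro continuous_intros cont m(1))+)
    show "eventually (\<lambda>t. cross3 (G (c t)) (m t) $ i = 0) (at 0)"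
      using ev by eventually_elim simp
  qed
  then have "cross3 (G (c 0)) (m 0) = 0" by (simp add: vec_eq_iff)
  then have "q (c 0) = lin (m 0)" using U(4)[OF U(2)] m(2) by (simp add: lin_eq_iff)
  then show ?thesis using c0 c(3)[of 0] hc(2) by auto
qed

subsection \<open>The three kinds of Pascal symbols over a hexad\<close>

lemma image_constant:
  assumes h: "h \<in> H" "h \<in> chart_hexads" and a: "a \<in> pascal_arrays"
    and q: "extends_pascal X (fst \<circ> fst) (array_equiv `` {a}) q"
    and nz: "pasc_at a (params h) \<noteq> 0"
  shows "q ` {x \<in> X. fst (fst x) = h} = {lin (pasc_at a (params h))}"
proof -
  \<comment> \<open>The curve with zero direction shows that the value is attained, in other words
    that the fibre has a point.\<close>
  have *: "isCont (\<lambda>t. pasc_at a (\<lambda>L. params h L + t * 0 + t ^ 2 * letter_code L) $ i) 0" for i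
    using exhaust_3[of i] by (elim disjE) (simp_all only: pasc_at_def pasc_nth pasc_defs, (intro continuous_intros)+)
  have "\<exists>x\<in>X. fst (fst x) = h \<and> q x = lin (pasc_at a (\<lambda>L. params h L + 0 * 0 + 0 ^ 2 * letter_code L))"
    by (rule extension_along_curve[OF h a q *, where \<xi> = "\<lambda>_. 0" and k = 0]) (use nz in simp_all)
  moreover have "q x = lin (pasc_at a (params h))" if "x \<in> X" "fst (fst x) = h" for x
    using extension_value[OF that(1) _ a q] that h(2) nz by simp
  ultimately show ?thesis by auto
qed

text \<open>If each column is a doubled point, the coefficient of \<open>t\<close> in the Pascal
  form is, up to the Vandermonde product, the quadratic interpolating at the points
  \<open>p j\<close> the velocities of the second row relative to the first. By Lagrange
  interpolation it can be any quadratic.\<close>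

lemma image_UNIV:
  assumes h: "h \<in> H" "h \<in> chart_hexads" and a: "a \<in> pascal_arrays"
    and q: "extends_pascal X (fst \<circ> fst) (array_equiv `` {a}) q"
    and eq: "\<And>j. h (a 0 j) = h (a 1 j)"
    and ne: "h (a 0 1) \<noteq> h (a 0 2)" "h (a 0 1) \<noteq> h (a 0 3)" "h (a 0 2) \<noteq> h (a 0 3)"
  shows "q ` {x \<in> X. fst (fst x) = h} = UNIV"
proof -
  have "l \<in> q ` {x \<in> X. fst (fst x) = h}" for l
  proof -
    obtain v where v: "v \<noteq> 0" "l = lin v" by (rule lin_cases)
    define p where "p = (\<lambda>j. params h (a 0 j))"
    have pne: "p 1 \<noteq> p 2" "p 1 \<noteq> p 3" "p 2 \<noteq> p 3"
      using ne chart_hexad_eq[OF h] unfolding p_def by metis+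
    \<comment> \<open>The velocities are the values of the prescribed form \<open>v\<close> at the
      points, so interpolation returns \<open>v\<close>.\<close>
    define \<xi> where "\<xi> = (\<lambda>L. if L \<in> range (a 1) then scalar_product v (kv (params h L)) else 0)"
    have \<xi>: "\<xi> (a 0 j) = 0" "\<xi> (a 1 j) = scalar_product v (kv (p j))" for j
      using pascal_array_eq_iff[OF a] eq by (auto simp: \<xi>_def p_def)
    define z where "z = (\<lambda>t L. params h L + t * \<xi> L + t ^ 2 * letter_code L)"
    define \<delta> where "\<delta> = (\<lambda>j t. \<xi> (a 1 j) + t * (letter_code (a 1 j) - letter_code (a 0 j)))"
    have z1: "z t (a 1 j) = z t (a 0 j) + t * \<delta> j t" for t j
      by (simp add: z_def \<delta>_def \<xi>(1) eq power2_eq_square algebra_simps)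
    define x where "x = (\<lambda>j t. z t (a 0 j))"
    define y where "y = (\<lambda>j t. z t (a 1 j))"
    \<comment> \<open>Subtracting the column of the \<open>x j\<close> from that of the
      \<open>y j\<close> leaves \<open>t\<close> times the column of the \<delta>; \<open>m\<close>
      is the result with the factor \<open>t\<close> removed.\<close>
    define m :: "complex \<Rightarrow> complex ^ 3" where "m = (\<lambda>t. vector
      [- det3 (x 1 t * y 1 t) (x 2 t * y 2 t) (x 3 t * y 3 t) (\<delta> 1 t) (\<delta> 2 t) (\<delta> 3 t) (x 1 t) (x 2 t) (x 3 t),
       det3 (x 1 t * y 1 t) (x 2 t * y 2 t) (x 3 t * y 3 t) (\<delta> 1 t) (\<delta> 2 t) (\<delta> 3 t) 1 1 1,
       det3 (\<delta> 1 t) (\<delta> 2 t) (\<delta> 3 t) (x 1 t) (x 2 t) (x 3 t) 1 1 1])"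
    have cx: "isCont (x j) 0" "isCont (y j) 0" "isCont (\<delta> j) 0" for j
      unfolding x_def y_def z_def \<delta>_def by (intro continuous_intros)+
    have cont: "isCont (\<lambda>t. m t $ i) 0" for i
      using exhaust_3[of i] unfolding m_def det3_def
      by (elim disjE) (simp_all, (intro continuous_intros cx)+)
    have "pasc_at a (z t) = t *s m t" for t
    proof -
      have y: "y j t = x j t + t * \<delta> j t" for j by (simp add: x_def y_def z1)
      have "pasc (\<lambda>j. x j t) (\<lambda>j. y j t) = t *s m t"
        unfolding vec3_eq_iff
        by (simp add: m_def pasc_defs y algebra_simps)
      then show ?thesis by (simp add: x_def y_def pasc_at_def)
    qed
    then have pm: "pasc_at a (\<lambda>L. params h L + t * \<xi> L + t ^ 2 * letter_code L) = t ^ 1 *s m t" for t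
      by (simp add: z_def)
    define V where "V = (p 1 - p 2) * (p 1 - p 3) * (p 2 - p 3)"
    have "V \<noteq> 0" using pne by (simp add: V_def)
    have at0: "x j 0 = p j" "y j 0 = p j" "\<delta> j 0 = scalar_product v (kv (p j))" for j
      by (simp_all add: x_def y_def z_def \<delta>_def \<xi>(2) p_def eq)
    have "m 0 = V *s v"
      by (simp add: vec3_eq_iff m_def at0 det3_def V_def scalar_product_3 power2_eq_square algebra_simps)
    then have "m 0 \<noteq> 0" "lin (m 0) = l" using v \<open>V \<noteq> 0\<close> by (simp_all add: lin_scale)
    with extension_along_curve[OF h a q cont _ pm] obtain x
      where "x \<in> X" "fst (fst x) = h" "q x = l" by blast
    then show ?thesis by blast
  qed
  then show ?thesis by blast
qed

text \<open>At \<open>h\<close> the differences \<open>x3 - x2\<close> and \<open>y3 - y2\<close>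
  vanish, and their velocities can be prescribed independently. They are the coefficients of two
  forms that become multiples of \<open>chord p w\<close> and \<open>chord p u\<close>, which span
  the pencil.\<close>

lemma image_pencil:
  assumes h: "h \<in> H" "h \<in> chart_hexads" and a: "a \<in> pascal_arrays"
    and q: "extends_pascal X (fst \<circ> fst) (array_equiv `` {a}) q"
    and eq: "h (a 0 1) = h (a 1 1)" "h (a 0 2) = h (a 0 3)" "h (a 1 2) = h (a 1 3)"
    and ne: "h (a 0 1) \<noteq> h (a 0 2)" "h (a 0 1) \<noteq> h (a 1 2)" "h (a 0 2) \<noteq> h (a 1 2)"
  shows "q ` {x \<in> X. fst (fst x) = h} = pencil (h (a 0 1))"
proof -
  define p u w where puw: "p = params h (a 0 1)" "u = params h (a 0 2)" "w = params h (a 1 2)"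
  have puw_ne: "p \<noteq> u" "p \<noteq> w" "u \<noteq> w"
    using ne chart_hexad_eq[OF h] unfolding puw by metis+
  have hp: "h (a 0 1) = pt (kv p)" using chart_hexad_eq[OF h] unfolding puw by metis
  \<comment> \<open>In the determinant, row 3 minus row 2 is \<open>x3 - x2\<close> times
    \<open>(y3, 0, 1, 0)\<close> plus \<open>y3 - y2\<close> times \<open>(x2, 1, 0, 0)\<close>.
    \<open>A\<close> and \<open>B\<close> arise from putting these two vectors in place of row
    3.\<close>
  define A B :: "(letter \<Rightarrow> complex) \<Rightarrow> complex ^ 3"
    where AB: "A = (\<lambda>z. let x1 = z (a 0 1); x2 = z (a 0 2); y1 = z (a 1 1); y2 = z (a 1 2); y3 = z (a 1 3) in
      vector [- det3 (x1 * y1) (x2 * y2) y3 y1 y2 0 x1 x2 1,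
        det3 (x1 * y1) (x2 * y2) y3 y1 y2 0 1 1 0 - det3 (x1 * y1) (x2 * y2) y3 x1 x2 1 1 1 0,
        det3 y1 y2 0 x1 x2 1 1 1 0])"
    "B = (\<lambda>z. let x1 = z (a 0 1); x2 = z (a 0 2); y1 = z (a 1 1); y2 = z (a 1 2) in
      vector [- det3 (x1 * y1) (x2 * y2) x2 y1 y2 1 x1 x2 0,
        det3 (x1 * y1) (x2 * y2) x2 y1 y2 1 1 1 0 - det3 (x1 * y1) (x2 * y2) x2 x1 x2 0 1 1 0,
        det3 y1 y2 1 x1 x2 0 1 1 0])"
  have pasc_AB: "pasc_at a z = (z (a 0 3) - z (a 0 2)) *s A z + (z (a 1 3) - z (a 1 2)) *s B z" for z
    by (simp add: vec3_eq_iff pasc_at_def AB Let_def pasc_defs algebra_simps)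
  define c1 c2 where c: "c1 = w - p" "c2 = p - u"
  have pr: "params h (a 0 1) = p" "params h (a 1 1) = p" "params h (a 0 2) = u" "params h (a 0 3) = u"
    "params h (a 1 2) = w" "params h (a 1 3) = w"
    using eq by (simp_all add: puw)
  have A0: "A (params h) = c1 *s chord p w" and B0: "B (params h) = c2 *s chord p u"
    by (simp_all add: vec3_eq_iff AB c Let_def det3_def pr algebra_simps)
  have c0: "c1 \<noteq> 0" "c2 \<noteq> 0" using puw_ne by (simp_all add: c)
  \<comment> \<open>The intersection of the two moving lines lies identically on the Pascal line and
    specialises at \<open>h\<close> to a nonzero multiple of \<open>kv p\<close>.\<close>
  define D where "D = (\<lambda>z. cross3 (A z) (B z))"
  have D0: "D (params h) = (c1 * c2 * (u - w)) *s kv p"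
    by (simp add: D_def A0 B0 vec3_eq_iff power2_eq_square algebra_simps)
  have "on_line (pt (kv p)) (q x)" if x: "x \<in> X" "fst (fst x) = h" for x
  proof -
    interpret germs "zariski_nhds X x" "regular_at X x" x by (rule germs_zariski) fact
    have ch: "fst (fst x) \<in> chart_hexads" using h x by simp
    note [intro] = params_regular(1)[OF x(1) ch]
    have "(\<lambda>y. A (params (fst (fst y))) $ i) \<in> regular_at X x"
      "(\<lambda>y. B (params (fst (fst y))) $ i) \<in> regular_at X x" for i
      using exhaust_3[of i] unfolding AB det3_def Let_def
      by (auto intro!: intros)
    then have "(\<lambda>y. D (params (fst (fst y))) $ i) \<in> regular_at X x" for i
      using exhaust_3[of i] unfolding D_def by (auto intro!: diff mult)
    moreover have "scalar_product (pasc_at a z) (D z) = 0" for z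
      by (simp add: pasc_AB D_def scalar_product_3 algebra_simps)
    moreover have "c1 * c2 * (u - w) \<noteq> 0" using c0 puw_ne by simp
    then have "pt (D (params h)) = pt (kv p)" "D (params h) \<noteq> 0"
      unfolding D0 by (simp_all only: pt_scale vector_mul_eq_0 kv_nonzero simp_thms)
    ultimately show ?thesis using extension_on_point[OF x(1) ch a q, of D] x(2) by simp
  qed
  moreover have "l \<in> q ` {x \<in> X. fst (fst x) = h}" if l: "on_line (pt (kv p)) l" for l
  proof -
    obtain v where v: "v \<noteq> 0" "l = lin v" by (rule lin_cases)
    have v0: "v$1 = - (v$2 * p + v$3 * p ^ 2)"
      using l v by (simp add: on_line_iff scalar_product_3 add_eq_0_iff add.assoc)
    \<comment> \<open>Comparison of the third and second entries gives
      \<open>\<alpha> + \<beta> = v$3\<close> and \<open>\<alpha> * w + \<beta> * u = - n\<close>;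
      the first entry then agrees because \<open>l\<close> passes through the point with parameter
      \<open>p\<close>.\<close>
    define n where "n = v$2 + p * v$3"
    define \<alpha> where "\<alpha> = (- n - u * v$3) / (w - u)"
    define \<beta> where "\<beta> = v$3 - \<alpha>"
    have \<alpha>: "\<alpha> * (w - u) = - n - u * v$3" using puw_ne by (simp add: \<alpha>_def)
    have v_eq: "v = \<alpha> *s chord p w + \<beta> *s chord p u"
    proof -
      have "\<alpha> * w + \<beta> * u = - n" using \<alpha> by (simp add: \<beta>_def algebra_simps)
      then show ?thesis
        unfolding vec3_eq_iff
        by (simp add: v0 n_def \<beta>_def) algebra
    qed
    \<comment> \<open>At first order only the third column moves; dividing by \<open>c1\<close> and
      \<open>c2\<close> compensates for the factors in \<open>A0\<close> and
      \<open>B0\<close>.\<close>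
    define \<xi> where "\<xi> = (\<lambda>L. if L = a 0 3 then \<alpha> / c1 else if L = a 1 3 then \<beta> / c2 else 0)"
    have \<xi>: "\<xi> (a 0 2) = 0" "\<xi> (a 1 2) = 0" "\<xi> (a 0 3) = \<alpha> / c1" "\<xi> (a 1 3) = \<beta> / c2"
      by (simp_all add: \<xi>_def pascal_array_eq_iff[OF a])
    define z where "z = (\<lambda>t L. params h L + t * \<xi> L + t ^ 2 * letter_code L)"
    define m where "m = (\<lambda>t. (\<alpha> / c1 + t * (letter_code (a 0 3) - letter_code (a 0 2))) *s A (z t)
      + (\<beta> / c2 + t * (letter_code (a 1 3) - letter_code (a 1 2))) *s B (z t))"
    have cz: "isCont (\<lambda>t. z t L) 0" for L unfolding z_def by (intro continuous_intros)
    have cA: "isCont (\<lambda>t. A (z t) $ i) 0" for i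
      using exhaust_3[of i] unfolding AB det3_def Let_def
      by (elim disjE) (simp_all, (intro continuous_intros cz)+)
    have cB: "isCont (\<lambda>t. B (z t) $ i) 0" for i
      using exhaust_3[of i] unfolding AB det3_def Let_def
      by (elim disjE) (simp_all, (intro continuous_intros cz)+)
    have "isCont (\<lambda>t. (e1 + t * d1) * A (z t) $ i + (e2 + t * d2) * B (z t) $ i) 0" for e1 d1 e2 d2 i
      by (intro continuous_intros cA cB)
    then have cont: "isCont (\<lambda>t. m t $ i) 0" for i by (simp only: m_def vector_add_component vector_smult_component)
    have zd: "z t (a 0 3) - z t (a 0 2) = t * (\<alpha> / c1 + t * (letter_code (a 0 3) - letter_code (a 0 2)))"
      "z t (a 1 3) - z t (a 1 2) = t * (\<beta> / c2 + t * (letter_code (a 1 3) - letter_code (a 1 2)))" for t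
      by (simp_all add: z_def \<xi> eq power2_eq_square algebra_simps)
    have "pasc_at a (z t) = t *s m t" for t
      unfolding pasc_AB zd m_def
      by (simp only: vec3_eq_iff vector_add_component vector_smult_component) (simp add: algebra_simps)
    then have pm: "pasc_at a (\<lambda>L. params h L + t * \<xi> L + t ^ 2 * letter_code L) = t ^ 1 *s m t" for t
      by (simp add: z_def)
    have "z 0 = params h" by (simp add: z_def)
    then have "m 0 = v" using c0 by (simp add: m_def A0 B0 v_eq vector_smult_assoc)
    with extension_along_curve[OF h a q cont _ pm] v obtain x
      where "x \<in> X" "fst (fst x) = h" "q x = l" by blast
    then show ?thesis by blast
  qed
  ultimately show ?thesis by (auto simp: pencil_def hp)
qed

end

subsection \<open>Counting Pascal symbols\<close>

lemma equiv_array_equiv: "equiv pascal_arrays array_equiv"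
proof (rule equivI)
  show "array_equiv \<subseteq> pascal_arrays \<times> pascal_arrays" by (auto simp: array_equiv_def)
  show "refl_on pascal_arrays array_equiv"
    by (rule refl_onI) (use self_in_array_class in blast)
  show "sym array_equiv"
  proof (rule symI)
    fix a b assume "(a, b) \<in> array_equiv"
    then obtain \<sigma> \<tau> where *: "a \<in> pascal_arrays" "b \<in> pascal_arrays" "bij \<sigma>" "bij \<tau>"
      "b = (\<lambda>i j. a (\<sigma> i) (\<tau> j))" by (auto simp: array_equiv_def)
    have "a i j = b (inv \<sigma> i) (inv \<tau> j)" for i j
      unfolding *(5) surj_f_inv_f[OF bij_is_surj[OF *(3)]] surj_f_inv_f[OF bij_is_surj[OF *(4)]] ..
    then have eq: "a = (\<lambda>i j. b (inv \<sigma> i) (inv \<tau> j))" by blast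
    have "\<exists>\<sigma> \<tau>. bij \<sigma> \<and> bij \<tau> \<and> a = (\<lambda>i j. b (\<sigma> i) (\<tau> j))"
      by (rule exI[of _ "inv \<sigma>"], rule exI[of _ "inv \<tau>"])
        (intro conjI bij_imp_bij_inv *(3,4) eq)
    then show "(b, a) \<in> array_equiv" using *(1,2) by (simp add: array_equiv_def)
  qed
  show "trans array_equiv"
  proof (rule transI)
    fix a b c assume "(a, b) \<in> array_equiv" "(b, c) \<in> array_equiv"
    then obtain \<sigma> \<tau> \<sigma>' \<tau>' where *: "a \<in> pascal_arrays" "c \<in> pascal_arrays" "bij \<sigma>" "bij \<tau>" "bij \<sigma>'" "bij \<tau>'"
      "b = (\<lambda>i j. a (\<sigma> i) (\<tau> j))" "c = (\<lambda>i j. b (\<sigma>' i) (\<tau>' j))" by (auto simp: array_equiv_def)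
    then have "c = (\<lambda>i j. a ((\<sigma> \<circ> \<sigma>') i) ((\<tau> \<circ> \<tau>') j))" "bij (\<sigma> \<circ> \<sigma>')" "bij (\<tau> \<circ> \<tau>')"
      by (auto intro: bij_comp)
    then have "\<exists>\<sigma> \<tau>. bij \<sigma> \<and> bij \<tau> \<and> c = (\<lambda>i j. a (\<sigma> i) (\<tau> j))" by blast
    then show "(a, c) \<in> array_equiv" using *(1,2) by (simp add: array_equiv_def)
  qed
qed

lemma permuted_array:
  assumes "a \<in> pascal_arrays" "bij \<sigma>" "bij \<tau>"
  shows "(\<lambda>i j. a (\<sigma> i) (\<tau> j)) \<in> pascal_arrays"
proof -
  have "surj (map_prod \<sigma> \<tau>)" using assms by (intro map_prod_surj bij_is_surj)
  moreover have "case_prod (\<lambda>i j. a (\<sigma> i) (\<tau> j)) = case_prod a \<circ> map_prod \<sigma> \<tau>" by auto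
  moreover have "surj (case_prod a)" using assms(1) by (simp add: pascal_arrays_def)
  ultimately have "surj (case_prod (\<lambda>i j. a (\<sigma> i) (\<tau> j)))" by (simp only: comp_surj)
  then show ?thesis by (simp add: pascal_arrays_def)
qed

lemma array_class_permuted:
  assumes "a \<in> pascal_arrays" "bij \<tau>"
  shows "(\<lambda>i j. a i (\<tau> j)) \<in> pascal_arrays" "array_equiv `` {\<lambda>i j. a i (\<tau> j)} = array_equiv `` {a}"
proof -
  show *: "(\<lambda>i j. a i (\<tau> j)) \<in> pascal_arrays" using permuted_array[OF assms(1) bij_id assms(2)] by simp
  have "(a, \<lambda>i j. a i (\<tau> j)) \<in> array_equiv"
    unfolding array_equiv_def using assms * by (auto intro!: exI[of _ id] exI[of _ \<tau>])
  then show "array_equiv `` {\<lambda>i j. a i (\<tau> j)} = array_equiv `` {a}"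
    using equiv_class_eq[OF equiv_array_equiv] by blast
qed

lemma card_bij_UNIV: "card {f :: 'a::finite \<Rightarrow> 'a. bij f} = fact CARD('a)"
proof -
  have "{f :: 'a \<Rightarrow> 'a. bij f} = {f. f permutes UNIV}"
    by (auto simp: permutes_bij intro: bij_imp_permutes)
  then show ?thesis by (simp add: card_permutations)
qed

text \<open>The six entries are distinct, so the 2! * 3! = 12 pairs of row and column permutations
  give different arrays.\<close>

lemma card_array_class:
  assumes a: "a \<in> pascal_arrays"
  shows "card (array_equiv `` {a}) = 12"
proof -
  let ?f = "\<lambda>(\<sigma> :: 2 \<Rightarrow> 2, \<tau> :: 3 \<Rightarrow> 3). \<lambda>i j. a (\<sigma> i) (\<tau> j)"
  have eq: "array_equiv `` {a} = ?f ` ({\<sigma>. bij \<sigma>} \<times> {\<tau>. bij \<tau>})"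
    using in_array_class_iff[OF a] permuted_array[OF a] by (auto simp: image_iff)
  have "inj_on ?f ({\<sigma>. bij \<sigma>} \<times> {\<tau>. bij \<tau>})"
  proof (rule inj_onI)
    fix u v :: "(2 \<Rightarrow> 2) \<times> (3 \<Rightarrow> 3)"
    assume "?f u = ?f v"
    then have "a (fst u i) (snd u j) = a (fst v i) (snd v j)" for i j
      by (simp add: case_prod_unfold fun_eq_iff)
    then show "u = v" using pascal_array_eq_iff[OF a] by (auto simp: prod_eq_iff)
  qed
  then show ?thesis
    unfolding eq by (simp add: card_image card_cartesian_product card_bij_UNIV fact_numeral)
qed

definition array_list :: "(2 \<Rightarrow> 3 \<Rightarrow> letter) \<Rightarrow> letter list" where
  "array_list a = [a 0 1, a 0 2, a 0 3, a 1 1, a 1 2, a 1 3]"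

lemma UNIV_2': "(UNIV :: 2 set) = {0, 1}"
proof -
  have "i = 0 \<or> i = 1" for i :: 2 using exhaust_2[of i] by auto
  then show ?thesis by blast
qed

lemma set_array_list: "set (array_list a) = range (case_prod a)"
proof -
  have "(UNIV :: (2 \<times> 3) set) = {0, 1} \<times> {1, 2, 3}"
    by (simp add: UNIV_2'[symmetric] UNIV_3[symmetric])
  then have "range (case_prod a) = case_prod a ` ({0, 1} \<times> {1, 2, 3})" by simp
  also have "\<dots> = set (array_list a)" by (auto simp: array_list_def)
  finally show ?thesis ..
qed

text \<open>Identifies arrays with the 720 orderings of the letters, over which properties can be
  evaluated.\<close>

lemma bij_betw_array_list:
  "bij_betw array_list pascal_arrays (set (permutations_of_set_list [LA, LB, LC, LD, LE, LF]))"
proof -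
  have perms: "set (permutations_of_set_list [LA, LB, LC, LD, LE, LF]) = {l. set l = UNIV \<and> distinct l}"
    using permutations_of_list[of "[LA, LB, LC, LD, LE, LF]"]
    by (simp add: UNIV_letter permutations_of_set_def)
  have "inj array_list"
  proof (rule injI)
    fix a b assume "array_list a = array_list b"
    then have "a i j = b i j" for i j
    proof -
      have "i = 0 \<or> i = 1" using exhaust_2[of i] by auto
      then show ?thesis using exhaust_3[of j] \<open>array_list a = array_list b\<close> by (auto simp: array_list_def)
    qed
    then show "a = b" by blast
  qed
  moreover have "array_list ` pascal_arrays = {l. set l = UNIV \<and> distinct l}"
  proof (intro equalityI subsetI)
    fix l assume "l \<in> array_list ` pascal_arrays"
    then obtain a where a: "a \<in> pascal_arrays" "l = array_list a" by blast
    then have l: "set l = UNIV" by (simp add: set_array_list pascal_arrays_def)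
    moreover have "length l = 6" by (simp add: a(2) array_list_def)
    ultimately show "l \<in> {l. set l = UNIV \<and> distinct l}" by (simp add: card_distinct card_letter)
  next
    fix l :: "letter list" assume l: "l \<in> {l. set l = UNIV \<and> distinct l}"
    then have "length l = 6" using distinct_card[of l] by (simp add: card_letter)
    then obtain x1 x2 x3 y1 y2 y3 where l6: "l = [x1, x2, x3, y1, y2, y3]"
      by (auto simp: numeral_eq_Suc length_Suc_conv)
    define a :: "2 \<Rightarrow> 3 \<Rightarrow> letter" where
      "a = (\<lambda>i j. if i = 0 then if j = 1 then x1 else if j = 2 then x2 else x3
        else if j = 1 then y1 else if j = 2 then y2 else y3)"
    have "l = array_list a" by (simp add: array_list_def a_def l6)
    moreover from this have "a \<in> pascal_arrays" using l by (simp add: pascal_arrays_def flip: set_array_list)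
    ultimately show "l \<in> array_list ` pascal_arrays" by blast
  qed
  ultimately show ?thesis unfolding perms bij_betw_def by (blast intro: inj_on_subset)
qed

text \<open>The classes cut the arrays into sets of 12, so a property of symbols that can be read
  off any representative is counted on orderings.\<close>

lemma card_pascal_symbols_filter:
  assumes "\<And>a. a \<in> pascal_arrays \<Longrightarrow> Pr (array_equiv `` {a}) \<longleftrightarrow> pr (array_list a)"
  shows "12 * card {s \<in> pascal_symbols. Pr s} =
    length (filter pr (permutations_of_set_list [LA, LB, LC, LD, LE, LF]))"
proof -
  let ?S = "{s \<in> pascal_symbols. Pr s}" and ?A = "{a \<in> pascal_arrays. pr (array_list a)}"
  let ?P = "permutations_of_set_list [LA, LB, LC, LD, LE, LF]"
  have fin: "finite pascal_arrays"
    using bij_betw_finite[OF bij_betw_array_list] by simp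
  have U: "\<Union>?S = ?A"
  proof (intro equalityI subsetI)
    fix b assume "b \<in> \<Union>?S"
    then obtain s where s: "s \<in> pascal_symbols" "Pr s" "b \<in> s" by blast
    then have b: "b \<in> pascal_arrays"
      using in_quotient_imp_subset[OF equiv_array_equiv] unfolding pascal_symbols_def by blast
    obtain a where "a \<in> pascal_arrays" "s = array_equiv `` {a}"
      using s(1) by (rule pascal_symbol_rep)
    with s(3) have "s = array_equiv `` {b}"
      using equiv_class_eq[OF equiv_array_equiv] by simp
    then show "b \<in> ?A" using s assms b by blast
  next
    fix a assume "a \<in> ?A"
    then show "a \<in> \<Union>?S" using assms self_in_array_class[of a]
      by (auto simp: pascal_symbols_def quotient_def)
  qed
  have "finite (\<Union>?S)" unfolding U using fin by simp
  then have "12 * card ?S = card (\<Union>?S)"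
  proof (intro card_partition)
    show "finite ?S" using \<open>finite (\<Union>?S)\<close> by (rule finite_UnionD)
    show "card c = 12" if "c \<in> ?S" for c
      using that card_array_class pascal_symbol_rep[of c] by (metis (no_types, lifting) mem_Collect_eq)
    show "c1 \<inter> c2 = {}" if "c1 \<in> ?S" "c2 \<in> ?S" "c1 \<noteq> c2" for c1 c2
      using that quotient_disj[OF equiv_array_equiv] unfolding pascal_symbols_def by blast
  qed
  also have "card (\<Union>?S) = card (array_list ` ?A)"
    unfolding U using bij_betw_array_list by (intro card_image[symmetric]) (auto simp: bij_betw_def inj_on_def)
  also have "array_list ` ?A = set (filter pr ?P)"
    using bij_betw_array_list unfolding bij_betw_def by auto
  also have "card (set (filter pr ?P)) = length (filter pr ?P)"
    by (intro distinct_card distinct_filter distinct_permutations_of_set_list) simp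
  finally show ?thesis .
qed

text \<open>In the coordinate on the conic in which \<open>P, Q, R\<close> are \<open>0, 1, -1\<close>, the hexad \<open>h\<close> is the
  following.\<close>

fun place :: "letter \<Rightarrow> int" where
  "place LA = 0" | "place LF = 0" | "place LB = 1" | "place LE = 1" | "place LC = -1" | "place LD = -1"

text \<open>Quadratic polynomials for the lines \<open>PQ, PR, QR, PP', QQ', RR'\<close> and \<open>ch\<close>: a line corresponds to
  the polynomial whose roots are its intersections with the conic.\<close>

definition targets :: "(int \<times> int \<times> int) list" where
  "targets = [(0, -1, 1), (0, 1, 1), (-1, 0, 1), (0, 1, 0), (1, 2, -3), (1, -2, -3), (1, 0, 3)]"

definition proportional :: "int \<times> int \<times> int \<Rightarrow> int \<times> int \<times> int \<Rightarrow> bool" where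
  "proportional u v = (case (u, v) of ((u1, u2, u3), (v1, v2, v3)) \<Rightarrow>
    u2 * v3 = u3 * v2 \<and> u3 * v1 = u1 * v3 \<and> u1 * v2 = u2 * v1)"

definition point_kind :: "int \<Rightarrow> nat" where
  "point_kind p = (if p = 0 then 7 else if p = 1 then 8 else 9)"

definition pasc_int :: "int \<Rightarrow> int \<Rightarrow> int \<Rightarrow> int \<Rightarrow> int \<Rightarrow> int \<Rightarrow> int \<times> int \<times> int" where
  "pasc_int x1 x2 x3 y1 y2 y3 = (pasc1 x1 x2 x3 y1 y2 y3, pasc2 x1 x2 x3 y1 y2 y3, pasc3 x1 x2 x3 y1 y2 y3)"

text \<open>Kinds \<open>0\<close> to \<open>6\<close> are the constant symbols, numbered by their line in \<open>targets\<close>; kinds \<open>7, 8, 9\<close>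
  are those with a pencil as image and kind \<open>10\<close> has image the dual plane.\<close>

definition kind :: "int \<Rightarrow> int \<Rightarrow> int \<Rightarrow> int \<Rightarrow> int \<Rightarrow> int \<Rightarrow> nat" where
  "kind x1 x2 x3 y1 y2 y3 =
    (let v = pasc_int x1 x2 x3 y1 y2 y3 in
     if v \<noteq> (0, 0, 0) then length (takeWhile (\<lambda>w. \<not> proportional v w) targets)
     else if x1 = y1 then (if x2 = y2 then 10 else point_kind x1)
     else if x2 = y2 then point_kind x2 else point_kind x3)"

text \<open>An executable certificate: vanishing coefficients come with the coincidences and
  inequalities that \<open>image_UNIV\<close> or \<open>image_pencil\<close> assumes, and other
  coefficients match one of the seven targets; a kind of 7 from the first branch would mean that
  none matched.\<close>

definition kind_correct :: "int \<Rightarrow> int \<Rightarrow> int \<Rightarrow> int \<Rightarrow> int \<Rightarrow> int \<Rightarrow> bool" where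
  "kind_correct x1 x2 x3 y1 y2 y3 =
    (if pasc_int x1 x2 x3 y1 y2 y3 \<noteq> (0, 0, 0) then kind x1 x2 x3 y1 y2 y3 < 7
     else if x1 = y1 then
       (if x2 = y2 then x3 = y3 \<and> distinct [x1, x2, x3] else x2 = x3 \<and> y2 = y3 \<and> distinct [x1, x2, y2])
     else if x2 = y2 then x1 = x3 \<and> y1 = y3 \<and> distinct [x2, x1, y1]
     else x3 = y3 \<and> x1 = x2 \<and> y1 = y2 \<and> distinct [x3, x1, y1])"

text \<open>The default 11 lies outside the kinds 0 to 10.\<close>

fun kind_of :: "letter list \<Rightarrow> nat" where
  "kind_of [x1, x2, x3, y1, y2, y3] = kind (place x1) (place x2) (place x3) (place y1) (place y2) (place y3)"
| "kind_of _ = 11"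

fun kind_of_correct :: "letter list \<Rightarrow> bool" where
  "kind_of_correct [x1, x2, x3, y1, y2, y3] =
    kind_correct (place x1) (place x2) (place x3) (place y1) (place y2) (place y3)"
| "kind_of_correct _ = False"

definition tally :: "nat list \<Rightarrow> nat list" where
  "tally ks = map (\<lambda>k. length (filter (\<lambda>k'. k' = k) ks)) [0..<11]"

lemma kind_of_correct: "list_all kind_of_correct (permutations_of_set_list [LA, LB, LC, LD, LE, LF])"
  by code_simp

text \<open>Each entry is 12 times the number of symbols of that kind; together they account for all
  720 orderings.\<close>

lemma tally_kinds:
  "tally (map kind_of (permutations_of_set_list [LA, LB, LC, LD, LE, LF])) = [96, 96, 96, 48, 48, 48, 96, 48, 48, 48, 48]"
  by code_simp

lemma card_symbols_of_kind:
  assumes "\<And>a. a \<in> pascal_arrays \<Longrightarrow> Pr (array_equiv `` {a}) \<longleftrightarrow> kind_of (array_list a) = k" "k < 11"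
  shows "card {s \<in> pascal_symbols. Pr s} = [8, 8, 8, 4, 4, 4, 8, 4, 4, 4, 4] ! k"
proof -
  let ?P = "permutations_of_set_list [LA, LB, LC, LD, LE, LF]"
  have "12 * card {s \<in> pascal_symbols. Pr s} = length (filter (\<lambda>l. kind_of l = k) ?P)"
    using assms(1) by (rule card_pascal_symbols_filter)
  also have "\<dots> = length (filter (\<lambda>k'. k' = k) (map kind_of ?P))"
    by (simp add: filter_map o_def)
  also have "\<dots> = tally (map kind_of ?P) ! k" using assms(2) by (simp add: tally_def)
  also have "\<dots> = 12 * [8, 8, 8, 4, 4, 4, 8, 4, 4, 4, 4] ! k"
  proof -
    have "map ((*) 12) [8, 8, 8, 4, 4, 4, 8, 4, 4, 4, 4] ! k = 12 * [8, 8, 8, 4, 4, 4, 8, 4, 4, 4, 4::nat] ! k"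
      using assms(2) by (intro nth_map) simp
    then show ?thesis unfolding tally_kinds by simp
  qed
  finally show ?thesis by simp
qed

section \<open>From integer data to lines and pencils; separating the eleven images\<close>

definition int_vec :: "int \<times> int \<times> int \<Rightarrow> complex ^ 3" where
  "int_vec v = (case v of (v1, v2, v3) \<Rightarrow> vector [of_int v1, of_int v2, of_int v3])"

lemma int_vec_nth [simp]:
  "int_vec (v1, v2, v3) $ 1 = of_int v1" "int_vec (v1, v2, v3) $ 2 = of_int v2"
  "int_vec (v1, v2, v3) $ 3 = of_int v3"
  by (simp_all add: int_vec_def)

lemma int_vec_eq_0_iff: "int_vec v = 0 \<longleftrightarrow> v = (0, 0, 0)"
  by (cases v) (simp add: vec3_eq_iff)

lemma proportional_iff: "proportional u v \<longleftrightarrow> cross3 (int_vec u) (int_vec v) = 0"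
proof (cases u, cases v)
  fix u1 u2 u3 v1 v2 v3 assume uv: "u = (u1, u2, u3)" "v = (v1, v2, v3)"
  have "cross3 (int_vec u) (int_vec v) = int_vec (u2 * v3 - u3 * v2, u3 * v1 - u1 * v3, u1 * v2 - u2 * v1)"
    by (simp add: vec3_eq_iff uv)
  then show ?thesis by (simp add: int_vec_eq_0_iff proportional_def uv)
qed

lemma pasc_at_int:
  "pasc_at a (\<lambda>L. of_int (f L)) =
    int_vec (pasc_int (f (a 0 1)) (f (a 0 2)) (f (a 0 3)) (f (a 1 1)) (f (a 1 2)) (f (a 1 3)))"
  by (simp add: vec3_eq_iff pasc_at_def pasc_int_def pasc_defs)

lemma targets_nonzero: "k < 7 \<Longrightarrow> int_vec (targets ! k) \<noteq> 0"
  by (auto simp: int_vec_eq_0_iff targets_def less_Suc_eq numeral_eq_Suc)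

lemma targets_distinct:
  assumes "k < 7" "k' < 7" "proportional (targets ! k) (targets ! k')"
  shows "k = k'"
proof -
  have "\<forall>k<7. \<forall>k'<7. proportional (targets ! k) (targets ! k') \<longrightarrow> k = k'"
    by code_simp
  then show ?thesis using assms by blast
qed

definition kind_point :: "nat \<Rightarrow> complex" where
  "kind_point k = (if k = 7 then 0 else if k = 8 then 1 else -1)"

context conic_frame
begin

definition kind_image :: "nat \<Rightarrow> 3 proj set" where
  "kind_image k = (if k < 7 then {lin (int_vec (targets ! k))}
    else if k = 10 then UNIV else pencil (pt (kv (kind_point k))))"

lemma chord_in_pencil_iff: "lin (chord s t) \<in> pencil (pt (kv u)) \<longleftrightarrow> u = s \<or> u = t"
proof -
  have "scalar_product (chord s t) (kv u) = (u - s) * (u - t)"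
    by (simp add: scalar_product_3 power2_eq_square algebra_simps)
  then show ?thesis by (simp add: pencil_def on_line_iff)
qed

lemma lin_chord_neq: "t \<noteq> t' \<Longrightarrow> lin (chord s t) \<noteq> lin (chord s t')"
  by (simp add: lin_eq_iff vec3_eq_iff)

lemma kind_image_not_singleton:
  assumes "7 \<le> k"
  shows "kind_image k \<noteq> {l}"
proof
  assume *: "kind_image k = {l}"
  \<comment> \<open>5 and 6 stand for any two parameters other than 0, 1, -1; the two chords are
    distinct members of the image.\<close>
  have "lin (chord (kind_point k) 5) \<in> kind_image k" "lin (chord (kind_point k) 6) \<in> kind_image k"
    using assms by (simp_all add: kind_image_def chord_in_pencil_iff)
  then have "lin (chord (kind_point k) 5) = lin (chord (kind_point k) 6)" using * by simp
  then show False using lin_chord_neq[of 5 6] by simp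
qed

text \<open>Symbols of different kinds never share an image, so counting by image agrees with
  counting by kind.\<close>

lemma kind_image_inj:
  assumes "k < 11" "k' < 11" "kind_image k = kind_image k'"
  shows "k = k'"
proof -
  consider "k < 7" "k' < 7" | "k < 7" "7 \<le> k'" | "7 \<le> k" "k' < 7" | "7 \<le> k" "7 \<le> k'" by linarith
  then show ?thesis
  proof cases
    case 1
    then have "proportional (targets ! k) (targets ! k')"
      using assms(3) by (simp add: kind_image_def lin_eq_iff targets_nonzero proportional_iff)
    then show ?thesis using 1 targets_distinct by blast
  next
    case 2
    then have "kind_image k = {lin (int_vec (targets ! k))}" by (simp add: kind_image_def)
    then show ?thesis using 2 assms(3) kind_image_not_singleton by metis
  next
    case 3
    then have "kind_image k' = {lin (int_vec (targets ! k'))}" by (simp add: kind_image_def)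
    then show ?thesis using 3 assms(3) kind_image_not_singleton by metis
  next
    case 4
    have "lin (chord s t) \<in> kind_image j \<longleftrightarrow> j = 10 \<or> kind_point j = s \<or> kind_point j = t" if "7 \<le> j" for j s t
      using that by (simp add: kind_image_def chord_in_pencil_iff)
    with assms(3) 4 have *: "(k = 10 \<or> kind_point k = s \<or> kind_point k = t) \<longleftrightarrow>
      (k' = 10 \<or> kind_point k' = s \<or> kind_point k' = t)" for s t by metis
    have "k \<in> {7, 8, 9, 10}" "k' \<in> {7, 8, 9, 10}" using 4 assms(1,2) by auto
    moreover have "kind_point 7 = 0" "kind_point 8 = 1" "kind_point 9 = -1" by (simp_all add: kind_point_def)
    \<comment> \<open>A chord from 0, 1 or -1 to 5 lies in exactly one of the three pencils, and the
      chord of 5 and 6 in none, which isolates kind 10.\<close>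
    ultimately show ?thesis using *[of 0 5] *[of 1 5] *[of "-1" 5] *[of 5 6]
      by (auto simp: kind_point_def split: if_splits)
  qed
qed

end

lemma place_eq_iff: "place L = 0 \<longleftrightarrow> L = LA \<or> L = LF" "place L = 1 \<longleftrightarrow> L = LB \<or> L = LE"
    "place L = -1 \<longleftrightarrow> L = LC \<or> L = LD"
  by (cases L; simp)+

context hexad_blowup
begin

definition h0 :: "letter \<Rightarrow> 3 proj" where
  "h0 = (\<lambda>L. pt (kv (of_int (place L))))"

lemma params_h0 [simp]: "par Ni (h0 L) = of_int (place L)"
  by (simp add: h0_def)

lemma h0_eq_iff [simp]: "h0 L = h0 L' \<longleftrightarrow> place L = place L'"
  by (simp add: h0_def)

lemma h0_chart: "h0 \<in> chart_hexads"
  by (simp add: chart_hexads_def h0_def)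

lemma h0_H: "h0 \<in> H"
  unfolding H
proof (rule in_Hcirc_if_fibres_small)
  show "range h0 \<subseteq> conic M" by (auto simp: h0_def)
  fix L
  show "card {L'. h0 L' = h0 L} \<le> 2"
    by (cases L) (simp_all add: place_eq_iff Collect_disj_eq)
qed

text \<open>Permuting columns stays within the symbol, so the doubled column can be brought to the
  front.\<close>

lemma image_pencil_column:
  assumes a: "a \<in> pascal_arrays" and q: "extends_pascal X (fst \<circ> fst) (array_equiv `` {a}) q"
    and j: "distinct [j, k, l]"
    and pl: "place (a 0 j) = place (a 1 j)" "place (a 0 k) = place (a 0 l)" "place (a 1 k) = place (a 1 l)"
      "distinct [place (a 0 j), place (a 0 k), place (a 1 k)]"
  shows "q ` {x \<in> X. fst (fst x) = h0} = pencil (h0 (a 0 j))"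
proof -
  define \<tau> :: "3 \<Rightarrow> 3" where "\<tau> = (\<lambda>i. if i = 1 then j else if i = 2 then k else l)"
  have \<tau>: "\<tau> 1 = j" "\<tau> 2 = k" "\<tau> 3 = l" by (simp_all add: \<tau>_def)
  have "inj \<tau>"
  proof (rule injI)
    fix x y assume "\<tau> x = \<tau> y"
    then show "x = y" using exhaust_3[of x] exhaust_3[of y] \<tau> j by auto
  qed
  then have "bij \<tau>" by (simp add: bij_def finite_UNIV_inj_surj)
  note a' = array_class_permuted[OF a this]
  show ?thesis
    using image_pencil[OF h0_H h0_chart a'(1), of q] q pl by (simp add: a'(2) \<tau>)
qed

text \<open>The link between evaluation and geometry: in each branch \<open>kind_correct\<close>
  supplies the hypotheses of the corresponding image lemma.\<close>

lemma image_kind: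
  assumes a: "a \<in> pascal_arrays" and q: "extends_pascal X (fst \<circ> fst) (array_equiv `` {a}) q"
  shows "q ` {x \<in> X. fst (fst x) = h0} = kind_image (kind_of (array_list a))"
    and "kind_of (array_list a) < 11"
proof -
  define x1 x2 x3 y1 y2 y3 where xy: "x1 = place (a 0 1)" "x2 = place (a 0 2)" "x3 = place (a 0 3)"
    "y1 = place (a 1 1)" "y2 = place (a 1 2)" "y3 = place (a 1 3)"
  have k: "kind_of (array_list a) = kind x1 x2 x3 y1 y2 y3" by (simp add: array_list_def xy)
  have "array_list a \<in> set (permutations_of_set_list [LA, LB, LC, LD, LE, LF])"
    using bij_betw_array_list a by (auto simp: bij_betw_def)
  then have "kind_of_correct (array_list a)" using kind_of_correct by (simp add: list_all_iff)
  then have c: "kind_correct x1 x2 x3 y1 y2 y3" by (simp add: array_list_def xy)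
  have place_range: "place L \<in> {0, 1, -1}" for L by (cases L) auto
  have pen: "pencil (h0 (a i j)) = kind_image (point_kind (place (a i j)))" for i j
    using place_range[of "a i j"] by (auto simp: h0_def kind_image_def point_kind_def kind_point_def)
  have pk: "point_kind p < 11" for p by (simp add: point_kind_def)
  note defs = kind_correct_def kind_def Let_def
  have "q ` {x \<in> X. fst (fst x) = h0} = kind_image (kind x1 x2 x3 y1 y2 y3) \<and> kind x1 x2 x3 y1 y2 y3 < 11"
  proof (cases "pasc_int x1 x2 x3 y1 y2 y3 = (0, 0, 0)")
    case False
    let ?v = "pasc_int x1 x2 x3 y1 y2 y3" and ?k = "kind x1 x2 x3 y1 y2 y3"
    have k7: "?k < 7" using c False by (simp add: kind_correct_def)
    have k: "?k = length (takeWhile (\<lambda>w. \<not> proportional ?v w) targets)" using False by (simp add: kind_def Let_def)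
    have "length targets = 7" by (simp add: targets_def)
    \<comment> \<open>A prefix shorter than the list of targets ends just before the first
      proportional entry.\<close>
    then have "proportional ?v (targets ! ?k)"
      using nth_length_takeWhile[of "\<lambda>w. \<not> proportional ?v w" targets] k k7 by simp
    moreover have v: "pasc_at a (\<lambda>L. par Ni (h0 L)) = int_vec ?v" by (simp add: pasc_at_int xy)
    moreover have "int_vec ?v \<noteq> 0" using False by (simp add: int_vec_eq_0_iff)
    ultimately have "lin (pasc_at a (\<lambda>L. par Ni (h0 L))) = lin (int_vec (targets ! ?k))"
      unfolding v proportional_iff using lin_eq_iff targets_nonzero[OF k7] by blast
    moreover have "pasc_at a (\<lambda>L. par Ni (h0 L)) \<noteq> 0" using False v by (simp add: int_vec_eq_0_iff)
    ultimately show ?thesis using image_constant[OF h0_H h0_chart a q] k7 by (simp add: kind_image_def)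
  next
    case 0: True
    consider (all) "x1 = y1" "x2 = y2" | (first) "x1 = y1" "x2 \<noteq> y2" | (second) "x1 \<noteq> y1" "x2 = y2"
      | (third) "x1 \<noteq> y1" "x2 \<noteq> y2" by blast
    then show ?thesis
    proof cases
      case all
      then have *: "x3 = y3" "distinct [x1, x2, x3]" using c 0 by (simp_all add: defs)
      have "place (a 0 j) = place (a 1 j)" for j
        using exhaust_3[of j] all * by (auto simp: xy)
      then have "q ` {x \<in> X. fst (fst x) = h0} = UNIV"
        using image_UNIV[OF h0_H h0_chart a q] * by (simp add: xy)
      then show ?thesis using all 0 by (simp add: defs kind_image_def)
    next
      case first
      then have "q ` {x \<in> X. fst (fst x) = h0} = pencil (h0 (a 0 1))"
        using c 0 by (intro image_pencil_column[OF a q, of 1 2 3]) (simp_all add: defs xy)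
      then show ?thesis using first 0 by (simp add: defs pen pk) (simp add: xy)
    next
      case second
      then have "q ` {x \<in> X. fst (fst x) = h0} = pencil (h0 (a 0 2))"
        using c 0 by (intro image_pencil_column[OF a q, of 2 1 3]) (simp_all add: defs xy)
      then show ?thesis using second 0 by (simp add: defs pen pk) (simp add: xy)
    next
      case third
      then have "q ` {x \<in> X. fst (fst x) = h0} = pencil (h0 (a 0 3))"
        using c 0 by (intro image_pencil_column[OF a q, of 3 1 2]) (simp_all add: defs xy)
      then show ?thesis using third 0 by (simp add: defs pen pk) (simp add: xy)
    qed
  qed
  then show "q ` {x \<in> X. fst (fst x) = h0} = kind_image (kind_of (array_list a))"
    "kind_of (array_list a) < 11" by (simp_all add: k)
qed

text \<open>Rules out an empty fibre, on which every map would be constant with empty image.\<close>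

lemma X_h0_nonempty: "{x \<in> X. fst (fst x) = h0} \<noteq> {}"
proof -
  obtain c where "eventually (\<lambda>t. c t \<in> X) (nhds 0)"
    "\<And>t. fst (fst (c t)) = hexad_curve h0 (\<lambda>_. 0) letter_code t"
    using lift_hexad_curve[OF h0_H h0_chart inj_letter_code] by blast
  then have "c 0 \<in> {x \<in> X. fst (fst x) = h0}"
    using eventually_nhds_x_imp_x hexad_curve(2)[OF h0_H h0_chart inj_letter_code] by fastforce
  then show ?thesis by blast
qed

lemma card_images:
  assumes q: "\<forall>s\<in>pascal_symbols. extends_pascal X (fst \<circ> fst) s (q s)"
  shows "k < 11 \<Longrightarrow> card {s \<in> pascal_symbols. q s ` {x \<in> X. fst (fst x) = h0} = kind_image k}
      = [8, 8, 8, 4, 4, 4, 8, 4, 4, 4, 4] ! k"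
    and "card {s \<in> pascal_symbols. q s constant_on {x \<in> X. fst (fst x) = h0}} = 44"
    and "card {s \<in> pascal_symbols. \<not> q s constant_on {x \<in> X. fst (fst x) = h0}} = 16"
proof -
  let ?X = "{x \<in> X. fst (fst x) = h0}"
  let ?S = "\<lambda>k. {s \<in> pascal_symbols. q s ` ?X = kind_image k}"
  have cls: "array_equiv `` {a} \<in> pascal_symbols" if "a \<in> pascal_arrays" for a
    using that by (simp add: pascal_symbols_def quotientI)
  have qa: "q (array_equiv `` {a}) ` ?X = kind_image (kind_of (array_list a)) \<and> kind_of (array_list a) < 11"
    if "a \<in> pascal_arrays" for a
    using image_kind[OF that, of "q (array_equiv `` {a})"] q cls[OF that] by blast
  have card: "card (?S k) = [8, 8, 8, 4, 4, 4, 8, 4, 4, 4, 4] ! k" if "k < 11" for k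
  proof (rule card_symbols_of_kind[OF _ that])
    fix a assume a: "a \<in> pascal_arrays"
    show "q (array_equiv `` {a}) ` ?X = kind_image k \<longleftrightarrow> kind_of (array_list a) = k"
      using qa[OF a] kind_image_inj that by metis
  qed
  then show "k < 11 \<Longrightarrow> card (?S k) = [8, 8, 8, 4, 4, 4, 8, 4, 4, 4, 4] ! k" by blast
  have fin: "finite pascal_symbols"
  proof -
    have "finite pascal_arrays" using bij_betw_finite[OF bij_betw_array_list] by simp
    then show ?thesis unfolding pascal_symbols_def
      by (rule finite_quotient[OF _ equiv_type[OF equiv_array_equiv]])
  qed
  have kinds: "\<exists>k<11. q s ` ?X = kind_image k" if s: "s \<in> pascal_symbols" for s
  proof -
    obtain a where "a \<in> pascal_arrays" "s = array_equiv `` {a}" using s by (rule pascal_symbol_rep)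
    then show ?thesis using qa by blast
  qed
  \<comment> \<open>On a nonempty fibre, being constant means having a one-point image, and only
    kinds below 7 have one.\<close>
  have const: "q s constant_on ?X \<longleftrightarrow> k < 7" if "q s ` ?X = kind_image k" for s k
  proof
    assume "q s constant_on ?X"
    then obtain l where "q s ` ?X = {l}" using X_h0_nonempty by (force simp: constant_on_def)
    then show "k < 7" using that kind_image_not_singleton[of k] by (metis not_le)
  next
    assume "k < 7"
    then have "q s ` ?X = {lin (int_vec (targets ! k))}" using that by (simp add: kind_image_def)
    then show "q s constant_on ?X" unfolding constant_on_def by blast
  qed
  have sumS: "card (\<Union>k\<in>I. ?S k) = (\<Sum>k\<in>I. [8, 8, 8, 4, 4, 4, 8, 4, 4, 4, 4] ! k)"
    if I: "I \<subseteq> {..<11}" for I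
  proof -
    have "card (\<Union>k\<in>I. ?S k) = (\<Sum>k\<in>I. card (?S k))"
    proof (rule card_UN_disjoint)
      show "finite I" using I finite_subset by blast
      show "\<forall>k\<in>I. finite (?S k)" using fin by simp
      show "\<forall>k\<in>I. \<forall>k'\<in>I. k \<noteq> k' \<longrightarrow> ?S k \<inter> ?S k' = {}"
      proof (intro ballI impI)
        fix k k' assume k: "k \<in> I" "k' \<in> I" "k \<noteq> k'"
        then have "kind_image k \<noteq> kind_image k'" using kind_image_inj[of k k'] I by auto
        then show "?S k \<inter> ?S k' = {}" by auto
      qed
    qed
    also have "\<dots> = (\<Sum>k\<in>I. [8, 8, 8, 4, 4, 4, 8, 4, 4, 4, 4] ! k)"
      using card I by (intro sum.cong) auto
    finally show ?thesis .
  qed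
  have "{s \<in> pascal_symbols. q s constant_on ?X} = (\<Union>k\<in>{..<7}. ?S k)"
    (is "?L = ?R")
  proof
    show "?L \<subseteq> ?R"
    proof
      fix s assume s: "s \<in> ?L"
      then obtain k where k: "q s ` ?X = kind_image k" using kinds by blast
      with s show "s \<in> ?R" using const[OF k] by blast
    qed
    show "?R \<subseteq> ?L" using const by blast
  qed
  then show "card {s \<in> pascal_symbols. q s constant_on ?X} = 44"
    using sumS[of "{..<7}"] by (simp add: lessThan_nat_numeral lessThan_Suc numeral_eq_Suc)
  have "{s \<in> pascal_symbols. \<not> q s constant_on ?X} = (\<Union>k\<in>{7..<11}. ?S k)"
    (is "?L = ?R")
  proof
    show "?L \<subseteq> ?R"
    proof
      fix s assume s: "s \<in> ?L"
      then obtain k where k: "k < 11" "q s ` ?X = kind_image k" using kinds by blast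
      then have "k \<in> {7..<11}" using const[OF k(2)] s by simp
      with k(2) s show "s \<in> ?R" by blast
    qed
    show "?R \<subseteq> ?L" using const by fastforce
  qed
  then show "card {s \<in> pascal_symbols. \<not> q s constant_on ?X} = 16"
    using sumS[of "{7..<11}"] by (simp add: atLeastLessThanSuc numeral_eq_Suc subset_iff)
qed

end

section \<open>The triangle, its poles and the Chasles line in coordinates\<close>

context conic_frame
begin

lemma triangle_lines:
  defines "P \<equiv> pt (kv 0)" and "Q \<equiv> pt (kv 1)" and "R \<equiv> pt (kv (-1))"
  defines "P' \<equiv> pole M (join Q R)" and "Q' \<equiv> pole M (join P R)" and "R' \<equiv> pole M (join P Q)"
  shows "{join P Q} = kind_image 0" "{join P R} = kind_image 1" "{join Q R} = kind_image 2"
    "{join P P'} = kind_image 3" "{join Q Q'} = kind_image 4" "{join R R'} = kind_image 5"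
    "{chasles_line M P Q R} = kind_image 6"
    "pencil P = kind_image 7" "pencil Q = kind_image 8" "pencil R = kind_image 9"
proof -
  have side: "join P Q = lin (chord 0 1)" "join P R = lin (chord 0 (-1))" "join Q R = lin (chord 1 (-1))"
    by (simp_all add: P_def Q_def R_def join_pt_kv)
  have pol: "P' = pt (vector [1, 0, -1])" "Q' = pt (vector [1, - 1 / 2, 0])" "R' = pt (vector [1, 1 / 2, 0])"
    by (simp_all add: P'_def Q'_def R'_def side pole_ln)
  \<comment> \<open>\<open>c\<close> absorbs the scale between a computed cross product and the
    representative chosen for the line or point.\<close>
  have join': "join (pt u) (pt v) = lin m" if "cross3 u v = c *s m" "c \<noteq> 0" "m \<noteq> 0" for u v m c
    using join_pt[of u v] that by (simp add: lin_scale)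
  have meet': "meet (lin u) (lin v) = pt m" if "cross3 u v = c *s m" "c \<noteq> 0" "m \<noteq> 0" for u v m c
    using meet_ln[of u v] that by (simp add: pt_scale)
  have med: "join P P' = lin (int_vec (0, 1, 0))" "join Q Q' = lin (int_vec (1, 2, -3))"
    "join R R' = lin (int_vec (1, -2, -3))"
    unfolding P_def Q_def R_def pol
    by (rule join'[where c = 1], simp_all add: vec3_eq_iff)
      (rule join'[where c = "1/2"], simp_all add: vec3_eq_iff,
       rule join'[where c = "-1/2"], simp_all add: vec3_eq_iff)
  have side': "join P' Q' = lin (vector [1, 2, 1])" "join P' R' = lin (vector [1, -2, 1])"
    "join Q' R' = lin (vector [0, 0, 1])"
    unfolding pol
    by (rule join'[where c = "-1/2"], simp_all add: vec3_eq_iff)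
      (rule join'[where c = "1/2"], simp_all add: vec3_eq_iff,
       rule join'[where c = 1], simp_all add: vec3_eq_iff)
  have pts: "meet (join P Q) (join P' Q') = pt (vector [-3, 1, 1])"
    "meet (join P R) (join P' R') = pt (vector [3, 1, -1])"
    "meet (join Q R) (join Q' R') = pt (vector [0, 1, 0])"
    unfolding side side'
    by (rule meet'[where c = 1], simp_all add: vec3_eq_iff)
      (rule meet'[where c = 1], simp_all add: vec3_eq_iff,
       rule meet'[where c = 1], simp_all add: vec3_eq_iff)
  have "chasles_line M P Q R = (THE l. on_line (pt (vector [-3, 1, 1])) l \<and>
      on_line (pt (vector [3, 1, -1])) l \<and> on_line (pt (vector [0, 1, 0])) l)"
    unfolding chasles_line_def Let_def
    by (simp only: P'_def[symmetric] Q'_def[symmetric] R'_def[symmetric] pts)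
  also have "\<dots> = lin (int_vec (1, 0, 3))"
  proof (rule the_equality)
    show "on_line (pt (vector [-3, 1, 1])) (lin (int_vec (1, 0, 3))) \<and>
      on_line (pt (vector [3, 1, -1])) (lin (int_vec (1, 0, 3))) \<and> on_line (pt (vector [0, 1, 0])) (lin (int_vec (1, 0, 3)))"
      by (simp add: on_line_iff vec3_eq_iff scalar_product_3)
    fix l assume l: "on_line (pt (vector [-3, 1, 1])) l \<and>
      on_line (pt (vector [3, 1, -1])) l \<and> on_line (pt (vector [0, 1, 0])) l"
    obtain m where m: "m \<noteq> 0" "l = lin m" by (rule lin_cases)
    then have "m$1 * 3 + m$2 = m$3" "m$2 = 0"
      using l by (auto simp: on_line_iff vec3_eq_iff scalar_product_3)
    then have "m$2 = 0" "m$3 = m$1 * 3" by simp_all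
    then show "l = lin (int_vec (1, 0, 3))"
      using m by (simp add: lin_eq_iff vec3_eq_iff)
  qed
  finally have ch: "chasles_line M P Q R = lin (int_vec (1, 0, 3))" .
  have sides: "lin (chord 0 1) = lin (int_vec (0, -1, 1))" "lin (chord 0 (-1)) = lin (int_vec (0, 1, 1))"
    "lin (chord 1 (-1)) = lin (int_vec (-1, 0, 1))"
    by (simp_all add: lin_eq_iff vec3_eq_iff)
  show "{join P Q} = kind_image 0" "{join P R} = kind_image 1" "{join Q R} = kind_image 2"
    "{join P P'} = kind_image 3" "{join Q Q'} = kind_image 4" "{join R R'} = kind_image 5"
    "{chasles_line M P Q R} = kind_image 6"
    by (simp_all add: kind_image_def targets_def side sides med ch)
  show "pencil P = kind_image 7" "pencil Q = kind_image 8" "pencil R = kind_image 9"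
    by (simp_all add: kind_image_def kind_point_def P_def Q_def R_def)
qed

end

text \<open>Oriented towards \<open>kind_image 10\<close> so that rewriting brings the last count
  into the form of the others.\<close>

lemma (in conic_frame) kind_image_UNIV: "UNIV = kind_image 10"
  by (simp add: kind_image_def)

theorem theorem4p3:
  fixes M :: "complex ^ 3 ^ 3"
    and K :: "3 proj set"
    and g\<^sub>1 :: "(letter \<Rightarrow> 3 proj) \<Rightarrow> 'n::finite proj"
    and X' :: "((letter \<Rightarrow> 3 proj) \<times> 'n proj) set"
    and g\<^sub>2 :: "(letter \<Rightarrow> 3 proj) \<times> 'n proj \<Rightarrow> 'm::finite proj"
    and X :: "(((letter \<Rightarrow> 3 proj) \<times> 'n proj) \<times> 'm proj) set"
    and \<beta> :: "((letter \<Rightarrow> 3 proj) \<times> 'n proj) \<times> 'm proj \<Rightarrow> letter \<Rightarrow> 3 proj"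
    and q :: "(2 \<Rightarrow> 3 \<Rightarrow> letter) set \<Rightarrow> ((letter \<Rightarrow> 3 proj) \<times> 'n proj) \<times> 'm proj \<Rightarrow> 3 proj"
    and P Q R P' Q' R' ch :: "3 proj"
    and h :: "letter \<Rightarrow> 3 proj"
    and X\<^sub>h :: "(((letter \<Rightarrow> 3 proj) \<times> 'n proj) \<times> 'm proj) set"
  assumes conic: "nonsingular_conic M" "K = conic M"
    and blowup1: "ideal_generator_map (Hcirc K) (Zlocus K) g\<^sub>1"
      "X' = blowup (Hcirc K) (Zlocus K) g\<^sub>1"
    and blowup2: "ideal_generator_map X' (proper_transform X' (Zlocus K) (Ylocus K)) g\<^sub>2"
      "X = blowup X' (proper_transform X' (Zlocus K) (Ylocus K)) g\<^sub>2"
    and beta: "\<beta> = fst \<circ> fst"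
    and q: "\<forall>s\<in>pascal_symbols. extends_pascal X \<beta> s (q s)"
    and PQR: "P \<in> K" "Q \<in> K" "R \<in> K" "P \<noteq> Q" "P \<noteq> R" "Q \<noteq> R"
    and h: "h LA = P" "h LF = P" "h LB = Q" "h LE = Q" "h LC = R" "h LD = R"
    and fibre: "X\<^sub>h = {x \<in> X. \<beta> x = h}"
    and poles: "P' = pole M (join Q R)" "Q' = pole M (join P R)" "R' = pole M (join P Q)"
    and chasles: "ch = chasles_line M P Q R"
  shows "(card {s \<in> pascal_symbols. q s constant_on X\<^sub>h} = 44 \<and>
          card {s \<in> pascal_symbols. q s ` X\<^sub>h = {join P Q}} = 8 \<and>
          card {s \<in> pascal_symbols. q s ` X\<^sub>h = {join P R}} = 8 \<and>
          card {s \<in> pascal_symbols. q s ` X\<^sub>h = {join Q R}} = 8 \<and>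
          card {s \<in> pascal_symbols. q s ` X\<^sub>h = {join P P'}} = 4 \<and>
          card {s \<in> pascal_symbols. q s ` X\<^sub>h = {join Q Q'}} = 4 \<and>
          card {s \<in> pascal_symbols. q s ` X\<^sub>h = {join R R'}} = 4 \<and>
          card {s \<in> pascal_symbols. q s ` X\<^sub>h = {ch}} = 8) \<and>
         (card {s \<in> pascal_symbols. \<not> q s constant_on X\<^sub>h} = 16 \<and>
          card {s \<in> pascal_symbols. q s ` X\<^sub>h = pencil P} = 4 \<and>
          card {s \<in> pascal_symbols. q s ` X\<^sub>h = pencil Q} = 4 \<and>
          card {s \<in> pascal_symbols. q s ` X\<^sub>h = pencil R} = 4 \<and>
          card {s \<in> pascal_symbols. q s ` X\<^sub>h = UNIV} = 4)"
proof -
  obtain N Ni \<kappa> where "conic_frame M N Ni \<kappa>" and coords: "P = proj_of (N *v kv 0)"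
    "Q = proj_of (N *v kv 1)" "R = proj_of (N *v kv (-1))"
    using conic_frame_exists[OF conic(1), of P Q R] PQR conic(2) by blast
  then interpret conic_frame M N Ni \<kappa> by simp
  interpret hexad_blowup M N Ni \<kappa> g\<^sub>1 g\<^sub>2 "Hcirc K" "Zlocus K" X'
      "proper_transform X' (Zlocus K) (Ylocus K)" X
    by unfold_locales (use conic(2) blowup1 blowup2 in simp_all)
  have pts: "P = pt (kv 0)" "Q = pt (kv 1)" "R = pt (kv (-1))"
    using coords by (simp_all add: pt_def)
  \<comment> \<open>The six prescribed values determine \<open>h\<close>, and in the frame their
    parameters are the integers given by \<open>place\<close>.\<close>
  have "h L = h0 L" for L
    by (cases L) (simp_all add: h h0_def pts)
  then have "h = h0" by blast
  then have fib: "X\<^sub>h = {x \<in> X. fst (fst x) = h0}"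
    by (simp add: fibre beta)
  note lines = triangle_lines[folded pts, folded poles, folded chasles]
  have "\<forall>s\<in>pascal_symbols. extends_pascal X (fst \<circ> fst) s (q s)"
    using q beta by simp
  note counts = card_images[OF this, folded fib]
  show ?thesis
    unfolding lines by (simp add: counts kind_image_UNIV)
qed

end
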